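(* For every real number $\lambda$, each of the two collections $$ \biggl\{\zeta(2m+1)-\lambda\,\frac{2^{2m}(2^{2m+2}-1)|B_{2m+2}|}{(2^{2m+1}-1)(m+1)(2m)!}\,\pi^{2m+1}:m=1,2,\dots,19\biggr\} $$ and $$ \biggl\{\zeta(2m+1)-\lambda\,\frac{2^{2m}(2^{2m}-1)|B_{2m}|}{(2^{2m+1}-1)m(2m)!}\,\pi^{2m+1}:m=1,2,\dots,21\biggr\} $$ contains at least one irrational number.
   Context: $\zeta(s)=\sum_{k\ge1}k^{-s}$ is the Riemann zeta function, and $B_{2m}$ denotes the $2m$-th Bernoulli number (defined by $\frac{x}{e^x-1}=\sum_{k\ge0}B_k\frac{x^k}{k!}$). *)

theory Defs
  imports "HOL-Analysis.Analysis" "HOL-Computational_Algebra.Formal_Power_Series"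
begin

(* The Dirichlet series, for real arguments; meaningful for s > 1, where it converges. *)
definition zeta :: "real \<Rightarrow> real" where
  "zeta s = (\<Sum>k. real (Suc k) powr (- s))"

(* Division of formal power series over a field cancels the common factor X,
   so the quotient is the genuine series of x / (exp x - 1). *)
definition Bernoulli :: "nat \<Rightarrow> real" where
  "Bernoulli k = fact k * fps_nth (fps_X / (fps_exp 1 - 1)) k"

lemma zeta_sums:
  assumes "s > 1"
  shows "(\<lambda>k. real (Suc k) powr (- s)) sums zeta s"
proof -
  have "summable (\<lambda>n. real n powr (- s))"
    using assms by (simp add: summable_real_powr_iff)
  hence "summable (\<lambda>k. real (Suc k) powr (- s))"
    using summable_Suc_iff[of "\<lambda>n. real n powr (- s)"] by blast
  thus ?thesis
    unfolding zeta_def by (rule summable_sums)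
qed

lemma Bernoulli_fps:
  "Abs_fps (\<lambda>k. Bernoulli k / fact k) * (fps_exp 1 - 1) = fps_X"
proof -
  have nz: "fps_nth (fps_exp (1 :: real) - 1) 1 \<noteq> 0"
    by simp
  have "subdegree (fps_exp (1 :: real) - 1) \<le> 1"
    using nz by (rule subdegree_leI)
  moreover have "fps_exp (1 :: real) - 1 \<noteq> 0"
  proof
    assume "fps_exp (1 :: real) - 1 = 0"
    from nz[unfolded this] show False by simp
  qed
  ultimately have "fps_exp (1 :: real) - 1 dvd fps_X"
    using fps_dvd_iff[of "fps_exp (1 :: real) - 1" fps_X] by simp
  moreover have "Abs_fps (\<lambda>k. Bernoulli k / fact k) = fps_X / (fps_exp 1 - 1)"
    by (rule fps_ext) (simp add: Bernoulli_def)
  ultimately show ?thesis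
    by (metis dvd_div_mult_self)
qed

end

theory Submission
  imports Defs "HOL-Computational_Algebra.Computational_Algebra"
begin

text \<open>For even \<open>n\<close>, consider the rational function
  \<open>R(t) = 4^(10n) n!^(s-10) (\<Prod>i=1..5n. t - 2n - 1/2 + i)^2 / (\<Prod>j\<le>n. t + j)^s\<close>
  and let \<open>U\<close>, \<open>V\<close> be the sums of \<open>R\<close> and of its derivative over the half-integers beyond
  \<open>2 * n\<close>. As the zeros are double, both equal the sums over all half-integers beyond the centre of
  symmetry \<open>- n / 2\<close>. If \<open>\<rho> k\<close> denotes the sum of the coefficients of the poles of order \<open>k\<close>,
  partial fractions give \<open>U = (\<Sum>k. \<rho> k * S k) + q\<close> and \<open>V = - (\<Sum>k. k * \<rho> k * S (k + 1)) - q'\<close>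
  with the same \<open>\<rho>\<close>, where \<open>S k = (2 ^ k - 1) * zeta k\<close>. The reflection \<open>t \<mapsto> - n - t\<close> kills
  \<open>\<rho> k\<close> for \<open>k\<close> of the parity opposite to \<open>s\<close>, and one of \<open>q\<close>, \<open>q'\<close>.
  By Euler's formula for the even zeta values, the members of the collections are, up to rational factors,
  \<open>S k - c * k * S (k + 1)\<close> with \<open>k\<close> odd (take \<open>s = 39\<close>), respectively
  \<open>k * S (k + 1) - c * S k\<close> with \<open>k\<close> even (take \<open>s = 40\<close>). So, if all of them were rational,
  a bounded multiple of a power of \<open>lcm(1,\<dots>,n)\<close> times \<open>U + c * V\<close>, respectively \<open>c * U + V\<close>, would be an
  integer. It tends to \<open>0\<close>, and it is not \<open>0\<close> since \<open>V / U\<close> tends to \<open>0\<close>.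
  In the second collection this requires \<open>\<lambda> \<noteq> 0\<close>; for \<open>\<lambda> = 0\<close> it contains the first one.\<close>

subsection \<open>Euler's formula for the even zeta values\<close>

text \<open>The argument is a race between exponential rates. Up to a power of \<open>n\<close>, the
  sum \<open>U\<close> is at most the \<open>n\<close>-th power of
  \<open>4^10 (11/200)^2 (10/27)^4 (4/27)^(s - 14)\<close>, and each factor
  \<open>lcm(1,...,n)\<close> costs at most a constant times \<open>(607/200)^n\<close>. The first
  form needs \<open>39\<close> such factors, the second \<open>41\<close>, since differentiation
  adds one to the denominator of \<open>q'\<close>. The second race is won narrowly: the product of
  the rates is about \<open>0.96\<close>, and \<open>3.04\<close> in place of
  \<open>607/200 = 3.035\<close> would push it above \<open>1\<close>. So the easy bound
  \<open>4^n\<close> for the lcm is out of reach, and the other constants must be nearly sharp.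
  Summing from the centre \<open>- n / 2\<close> keeps the denominators \<open>2 i + 1\<close> of
  the rational parts below \<open>n\<close>; a start at \<open>2 n\<close> would bring in odd
  numbers far beyond \<open>n\<close>. \<open>V / U\<close> tends to \<open>0\<close> because
  \<open>V\<close> weights the terms of \<open>U\<close> by the logarithmic derivative of
  \<open>R\<close>, which is close to the logarithm of the ratio of neighbouring terms and so is
  small near their peak. Summation by parts makes this precise without locating the peak.\<close>

lemma zeta_half_sums:
  assumes "k \<ge> 2"
  shows "(\<lambda>l. 1 / (real l + 1 / 2) ^ k) sums ((2 ^ k - 1) * zeta (real k))"
proof -
  let ?a = "\<lambda>j. 1 / (real j + 1) ^ k"
  have eq: "real (Suc j) powr - real k = ?a j" for j
    by (simp add: powr_minus powr_realpow field_simps)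
  have a: "?a sums zeta (real k)"
    using zeta_sums[of "real k"] assms unfolding eq by simp
  have "(\<lambda>l. sum ?a {l * 2..<l * 2 + 2}) sums zeta (real k)"
    by (rule sums_group[OF a]) simp
  also have "(\<lambda>l. sum ?a {l * 2..<l * 2 + 2}) = (\<lambda>l. ?a (2 * l) + ?a (2 * l + 1))"
    by (rule ext) (simp add: numeral_2_eq_2 mult.commute)
  finally have "(\<lambda>l. ?a (2 * l) + ?a (2 * l + 1) - ?a l * (1 / 2 ^ k)) sums (zeta (real k) - zeta (real k) * (1 / 2 ^ k))"
    by (intro sums_diff sums_mult2 a)
  also have "(\<lambda>l. ?a (2 * l) + ?a (2 * l + 1) - ?a l * (1 / 2 ^ k)) = (\<lambda>l. ?a (2 * l))"
  proof
    fix l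
    have "(real (2 * l + 1) + 1) ^ k = (real l + 1) ^ k * 2 ^ k"
      unfolding power_mult_distrib[symmetric] by (simp add: algebra_simps)
    thus "?a (2 * l) + ?a (2 * l + 1) - ?a l * (1 / 2 ^ k) = ?a (2 * l)" by simp
  qed
  finally have "(\<lambda>l. 2 ^ k * ?a (2 * l)) sums (2 ^ k * (zeta (real k) - zeta (real k) * (1 / 2 ^ k)))"
    by (rule sums_mult)
  also have "(\<lambda>l. 2 ^ k * ?a (2 * l)) = (\<lambda>l. 1 / (real l + 1 / 2) ^ k)"
  proof
    fix l
    have "(real (2 * l) + 1) ^ k = (real l + 1 / 2) ^ k * 2 ^ k"
      unfolding power_mult_distrib[symmetric] by (simp add: algebra_simps)
    thus "2 ^ k * ?a (2 * l) = 1 / (real l + 1 / 2) ^ k" by simp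
  qed
  finally show ?thesis by (simp add: algebra_simps)
qed

lemma half_plus_not_nonpos_Int:
  fixes w :: complex
  assumes "norm w < 1 / 2"
  shows "1 / 2 + w \<notin> \<int>\<^sub>\<le>\<^sub>0"
proof
  assume "1 / 2 + w \<in> \<int>\<^sub>\<le>\<^sub>0"
  then obtain n where "1 / 2 + w = of_int n" "n \<le> 0" by (auto elim!: nonpos_Ints_cases)
  hence "Re (1 / 2 + w) \<le> 0" by simp
  moreover have "\<bar>Re w\<bar> < 1 / 2" using abs_Re_le_cmod[of w] assms by simp
  ultimately show False by simp
qed

text \<open>The logarithmic derivative of the reflection formula
  \<open>Gamma (1/2 + w) * Gamma (1/2 - w) = pi / cos (pi * w)\<close>.\<close>

lemma Digamma_diff_eq_tan:
  fixes z :: complex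
  assumes "norm z < 1 / 2"
  shows "Digamma (1 / 2 + z) - Digamma (1 / 2 - z) = of_real pi * tan (of_real pi * z)"
proof -
  have refl: "Gamma (1 / 2 + w) * Gamma (1 / 2 - w) = of_real pi / cos (of_real pi * w)" for w :: complex
  proof -
    have "sin (of_real pi * (1 / 2 + w)) = sin (of_real (pi / 2) + of_real pi * w)"
      by (simp add: ring_distribs)
    also have "\<dots> = cos (of_real pi * w)"
      unfolding sin_add sin_of_real cos_of_real by simp
    finally show ?thesis
      using Gamma_reflection_complex[of "1 / 2 + w"] by simp
  qed
  have n1: "1 / 2 + z \<notin> \<int>\<^sub>\<le>\<^sub>0" "1 / 2 - z \<notin> \<int>\<^sub>\<le>\<^sub>0"
    using half_plus_not_nonpos_Int[of z] half_plus_not_nonpos_Int[of "-z"] assms by auto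
  have G: "Gamma (1 / 2 + z) * Gamma (1 / 2 - z) \<noteq> 0"
    using n1 by (simp add: Gamma_eq_zero_iff)
  hence c: "cos (of_real pi * z) \<noteq> 0" unfolding refl by auto
  have "((\<lambda>w. Gamma (1 / 2 + w) * Gamma (1 / 2 - w)) has_field_derivative
      Gamma (1 / 2 + z) * Gamma (1 / 2 - z) * (Digamma (1 / 2 + z) - Digamma (1 / 2 - z))) (at z)"
    using n1 by (auto intro!: derivative_eq_intros simp: algebra_simps)
  moreover have "((\<lambda>w. of_real pi / cos (of_real pi * w)) has_field_derivative
      of_real pi / cos (of_real pi * z) * (of_real pi * tan (of_real pi * z))) (at z)"
    using c by (auto intro!: derivative_eq_intros simp: tan_def field_simps power2_eq_square)
  ultimately have "Gamma (1 / 2 + z) * Gamma (1 / 2 - z) * (Digamma (1 / 2 + z) - Digamma (1 / 2 - z)) =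
      Gamma (1 / 2 + z) * Gamma (1 / 2 - z) * (of_real pi * tan (of_real pi * z))"
    unfolding refl by (rule DERIV_unique)
  thus ?thesis using G by simp
qed

text \<open>Differentiate \<open>Digamma_diff_eq_tan\<close> \<open>n\<close> times at
  \<open>0\<close>: for odd \<open>n\<close> the two polygamma values at \<open>1/2\<close> add up,
  and each is \<open>n!\<close> times the sum over the half-integers. Only the norm is recorded,
  which later swallows the power of the imaginary unit in
  \<open>fps_tan_nth_conv_tanh\<close>.\<close>

lemma fps_tan_nth_conv_zeta_half:
  assumes "odd n"
  shows "norm (fps_nth (fps_tan (1::complex)) n) = 2 * (2 ^ Suc n - 1) * zeta (real (Suc n)) / pi ^ Suc n"
proof -
  define g :: "nat \<Rightarrow> complex \<Rightarrow> complex" where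
    "g n z = (Polygamma n (1 / 2 + z / of_real pi) - (-1) ^ n * Polygamma n (1 / 2 - z / of_real pi)) / of_real pi ^ Suc n" for n z
  have ball: "eventually (\<lambda>z::complex. norm z < pi / 2) (nhds 0)"
    using eventually_nhds_ball[of "pi / 2" "0::complex"] by (simp add: dist_norm)
  \<comment> \<open>The identity is carried along on a neighbourhood of \<open>0\<close>, since the
    induction step differentiates it.\<close>
  have "eventually (\<lambda>z. (deriv ^^ n) tan z = g n z) (nhds 0)" for n
  proof (induction n)
    case 0
    from ball show ?case
    proof eventually_elim
      case (elim z)
      hence "norm (z / of_real pi) < 1 / 2" by (simp add: norm_divide field_simps)
      from Digamma_diff_eq_tan[OF this] show ?case by (simp add: g_def)
    qed
  next
    case (Suc n)
    have "eventually (\<lambda>z. eventually (\<lambda>z. (deriv ^^ n) tan z = g n z) (nhds z)) (nhds 0)"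
      using Suc by (simp add: eventually_eventually)
    with ball show ?case
    proof eventually_elim
      case (elim z)
      have z: "norm (z / of_real pi) < 1 / 2" using elim(1) by (simp add: norm_divide field_simps)
      have n1: "1 / 2 + z / of_real pi \<notin> \<int>\<^sub>\<le>\<^sub>0" "1 / 2 - z / of_real pi \<notin> \<int>\<^sub>\<le>\<^sub>0"
        using half_plus_not_nonpos_Int[of "z / of_real pi"] half_plus_not_nonpos_Int[of "- z / of_real pi"] z by auto
      have "(g n has_field_derivative g (Suc n) z) (at z)"
        unfolding g_def using n1
        by (auto intro!: derivative_eq_intros DERIV_chain2[OF has_field_derivative_Polygamma] simp: field_simps)
      hence "deriv (g n) z = g (Suc n) z" by (rule DERIV_imp_deriv)
      moreover have "deriv ((deriv ^^ n) tan) z = deriv (g n) z"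
        by (rule deriv_cong_ev[OF elim(2)]) simp
      ultimately show ?case by simp
    qed
  qed
  from eventually_nhds_x_imp_x[OF this] have "(deriv ^^ n) tan 0 = g n 0" .
  hence "fps_nth (fps_tan (1::complex)) n = g n 0 / fact n"
    using fps_nth_fps_expansion[OF has_fps_expansion_tan] by simp
  also have "g n 0 = of_real (2 * Polygamma n (1 / 2) / pi ^ Suc n)"
    using assms Polygamma_of_real[of "1/2::real" n, where ?'a = complex] by (simp add: g_def)
  also have "Polygamma n (1 / 2 :: real) = fact n * ((2 ^ Suc n - 1) * zeta (real (Suc n)))"
  proof -
    have "n \<noteq> 0" using assms by (cases n) auto
    moreover have "(\<lambda>l. 1 / (real l + 1 / 2) ^ Suc n) sums ((2 ^ Suc n - 1) * zeta (real (Suc n)))"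
      using assms by (intro zeta_half_sums) (cases n, auto)
    ultimately show ?thesis using assms
      by (simp add: Polygamma_def sums_iff inverse_eq_divide add.commute)
  qed
  finally have eq: "fps_nth (fps_tan (1::complex)) n = of_real (2 * (2 ^ Suc n - 1) * zeta (real (Suc n)) / pi ^ Suc n)"
    by simp
  have "1 < real (Suc n)" using assms by (cases n) auto
  from zeta_sums[OF this] have "zeta (real (Suc n)) \<ge> 0"
    by (rule sums_le[OF _ sums_zero, rotated]) auto
  moreover have "(2::real) ^ Suc n - 1 \<ge> 0"
    using one_le_power[of "2::real" "Suc n"] by simp
  ultimately have "2 * (2 ^ Suc n - 1) * zeta (real (Suc n)) / pi ^ Suc n \<ge> 0"
    by (intro divide_nonneg_nonneg mult_nonneg_nonneg) auto
  thus ?thesis unfolding eq norm_of_real by (rule abs_of_nonneg)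
qed

section \<open>The coefficients of tan and tanh in terms of Bernoulli numbers\<close>

definition fps_tanh :: "real fps" where
  "fps_tanh = (fps_exp 2 - 1) / (fps_exp 2 + 1)"

lemma fps_exp_plus_1_nz: "fps_exp (2::real) + 1 \<noteq> 0" "fps_nth (fps_exp (2::real) + 1) 0 \<noteq> 0"
proof -
  show "fps_nth (fps_exp (2::real) + 1) 0 \<noteq> 0" by simp
  thus "fps_exp (2::real) + 1 \<noteq> 0" by (metis fps_zero_nth)
qed

lemma fps_tanh_mult: "(fps_exp 2 + 1) * fps_tanh = fps_exp 2 - 1"
  unfolding fps_tanh_def using fps_exp_plus_1_nz
  by (subst fps_divide_unit) (auto simp: inverse_mult_eq_1' mult_ac)

lemma fps_deriv_tanh: "fps_deriv fps_tanh = 1 - fps_tanh ^ 2"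
proof -
  let ?E = "fps_exp (2::real)" and ?T = fps_tanh
  have "fps_deriv ((?E + 1) * ?T) = fps_deriv (?E - 1)"
    by (simp only: fps_tanh_mult)
  hence "(?E + 1) * fps_deriv ?T = fps_const 2 * ?E * (1 - ?T)"
    by (simp add: algebra_simps)
  hence "(?E + 1) * ((?E + 1) * fps_deriv ?T) = (?E + 1) * (fps_const 2 * ?E * (1 - ?T))"
    by (rule arg_cong)
  also have "\<dots> = fps_const 2 * ?E * ((?E + 1) - (?E + 1) * ?T)"
    by (simp add: algebra_simps)
  also have "\<dots> = fps_const 2 * ?E * 2"
    unfolding fps_tanh_mult by simp
  \<comment> \<open>\<open>2 E\<close> and \<open>2\<close> are the sum and the difference of
    \<open>E + 1\<close> and \<open>E - 1\<close>; then \<open>E - 1\<close> is replaced by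
    \<open>(E + 1) * T\<close>, so that \<open>E + 1\<close> can be cancelled twice.\<close>
  also have "\<dots> = ((?E + 1) + (?E - 1)) * ((?E + 1) - (?E - 1))"
    by (simp add: numeral_fps_const algebra_simps)
  also have "\<dots> = (?E + 1) * ((?E + 1) * (1 - ?T ^ 2))"
    unfolding fps_tanh_mult[symmetric] by (simp add: algebra_simps power2_eq_square)
  finally show ?thesis using fps_exp_plus_1_nz by simp
qed

text \<open>Both series vanish at \<open>0\<close> and solve Riccati equations,
  \<open>T' = 1 + T^2\<close> for tan and \<open>T' = 1 - T^2\<close> for tanh, which determine the
  coefficients recursively. The power of the imaginary unit accounts for the change of sign.\<close>

lemma fps_tan_nth_conv_tanh:
  "fps_nth (fps_tan 1) n = - (\<i> ^ Suc n) * complex_of_real (fps_nth fps_tanh n)"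
proof (induction n rule: less_induct)
  case (less n)
  show ?case
  proof (cases n)
    case 0
    have "fps_nth fps_tanh 0 = 0"
      unfolding fps_tanh_def by (simp add: fps_divide_unit)
    moreover have "fps_nth (fps_tan (1::complex)) 0 = 0"
      by (simp add: fps_tan_def fps_divide_unit)
    ultimately show ?thesis using 0 by simp
  next
    case (Suc m)
    have c: "fps_cos (1::complex) \<noteq> 0" by (metis fps_cos_nth_0 fps_zero_nth zero_neq_one)
    have c0: "fps_nth (fps_cos (1::complex)) 0 \<noteq> 0" by simp
    have "fps_deriv (fps_tan (1::complex)) = 1 + fps_tan 1 ^ 2"
    proof -
      have t: "fps_tan (1::complex) * fps_cos 1 = fps_sin 1"
        unfolding fps_tan_def using c0 by (simp add: fps_divide_unit mult.assoc inverse_mult_eq_1)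
      have "fps_deriv (fps_tan (1::complex)) * (fps_cos 1)^2 = 1"
        unfolding fps_tan_deriv using c0
        by (simp add: fps_divide_unit mult.assoc inverse_mult_eq_1)
      also have "1 = (fps_cos (1::complex))^2 + (fps_sin 1)^2"
        by (simp add: fps_sin_cos_sum_of_squares)
      also have "\<dots> = (1 + fps_tan 1 ^ 2) * (fps_cos 1)^2"
        unfolding t[symmetric] by (simp add: algebra_simps power2_eq_square)
      finally show ?thesis using c by simp
    qed
    hence "fps_nth (fps_deriv (fps_tan (1::complex))) m = fps_nth (1 + fps_tan 1 ^ 2) m"
      by simp
    hence "of_nat (Suc m) * fps_nth (fps_tan (1::complex)) (Suc m) =
        (if m = 0 then 1 else 0) + (\<Sum>i=0..m. fps_nth (fps_tan 1) i * fps_nth (fps_tan 1) (m - i))"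
      by (simp add: power2_eq_square fps_mult_nth)
    also have "(\<Sum>i=0..m. fps_nth (fps_tan 1) i * fps_nth (fps_tan 1) (m - i)) =
        (\<Sum>i=0..m. \<i> ^ (m + 2) * complex_of_real (fps_nth fps_tanh i * fps_nth fps_tanh (m - i)))"
    proof (rule sum.cong)
      fix i assume i: "i \<in> {0..m}"
      have "\<i> ^ (m + 2) = \<i> ^ Suc i * \<i> ^ Suc (m - i)"
        unfolding power_add[symmetric] using i by simp
      thus "fps_nth (fps_tan 1) i * fps_nth (fps_tan 1) (m - i) =
        \<i> ^ (m + 2) * complex_of_real (fps_nth fps_tanh i * fps_nth fps_tanh (m - i))"
        using less.IH[of i] less.IH[of "m - i"] i Suc by (simp add: mult_ac)
    qed simp
    also have "\<dots> = \<i> ^ (m + 2) * complex_of_real (\<Sum>i=0..m. fps_nth fps_tanh i * fps_nth fps_tanh (m - i))"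
      by (simp add: sum_distrib_left)
    also have "(\<Sum>i=0..m. fps_nth fps_tanh i * fps_nth fps_tanh (m - i)) = fps_nth (fps_tanh ^ 2) m"
      by (simp add: power2_eq_square fps_mult_nth)
    also have "fps_nth (fps_tanh ^ 2) m = (if m = 0 then 1 else 0) - real (Suc m) * fps_nth fps_tanh (Suc m)"
      using arg_cong[OF fps_deriv_tanh, of "\<lambda>F. fps_nth F m"] by simp
    also have "(if m = 0 then 1 else 0) + \<i> ^ (m + 2) * complex_of_real ((if m = 0 then 1 else 0) - real (Suc m) * fps_nth fps_tanh (Suc m))
       = of_nat (Suc m) * (- (\<i> ^ Suc (Suc m)) * complex_of_real (fps_nth fps_tanh (Suc m)))"
      by (cases "m = 0") (simp_all add: algebra_simps)
    finally show ?thesis unfolding Suc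
      using of_nat_neq_0[of m, where ?'a = complex] by (simp only: mult_cancel_left simp_thms)
  qed
qed

text \<open>Read off from \<open>x tanh x = x - 2x / (exp (2x) - 1) + 4x / (exp (4x) - 1)\<close>;
  for \<open>n > 0\<close> the linear term does not reach the coefficient of index
  \<open>Suc n\<close>.\<close>

lemma fps_tanh_nth_conv_Bernoulli:
  "n > 0 \<Longrightarrow> fps_nth fps_tanh n = 2 ^ Suc n * (2 ^ Suc n - 1) * Bernoulli (Suc n) / fact (Suc n)"
proof -
  assume n: "n > 0"
  define b where "b = Abs_fps (\<lambda>k. Bernoulli k / fact k)"
  \<comment> \<open>\<open>bb c\<close> is the series of
    \<open>c x / (exp (c x) - 1)\<close>.\<close>
  define bb where "bb c = fps_compose b (fps_const c * fps_X)" for c :: real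
  have bb: "bb c * (fps_exp c - 1) = fps_const c * fps_X" for c
  proof -
    have "fps_compose (b * (fps_exp 1 - 1)) (fps_const c * fps_X) = fps_compose fps_X (fps_const c * fps_X)"
      using Bernoulli_fps by (simp add: b_def)
    thus ?thesis by (simp add: bb_def fps_compose_mult_distrib fps_compose_sub_distrib)
  qed
  have bbn: "fps_nth (bb c) k = c ^ k * (Bernoulli k / fact k)" for c k
    unfolding bb_def fps_compose_linear by (simp add: b_def)
  let ?E = "fps_exp (2::real)"
  have E4: "fps_exp (4::real) = ?E * ?E" by (simp flip: fps_exp_add_mult)
  have "fps_nth (?E - 1) 1 \<noteq> 0" by simp
  hence E1: "?E - 1 \<noteq> 0" by (metis fps_zero_nth)
  have "(?E - 1) * (?E + 1) * (fps_X * fps_tanh) = (?E - 1) * (fps_X * ((?E + 1) * fps_tanh))"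
    by (simp add: mult_ac)
  also have "\<dots> = fps_X * (?E * ?E - 1) - 2 * fps_X * (?E + 1) + 4 * fps_X"
    unfolding fps_tanh_mult by (simp add: algebra_simps)
  also have "4 * fps_X = bb 4 * ((?E - 1) * (?E + 1))"
    using bb[of 4] unfolding E4 by (simp add: numeral_fps_const algebra_simps)
  also have "2 * fps_X = bb 2 * (?E - 1)"
    using bb[of 2] by (simp add: numeral_fps_const)
  also have "fps_X * (?E * ?E - 1) - bb 2 * (?E - 1) * (?E + 1) + bb 4 * ((?E - 1) * (?E + 1)) =
     (?E - 1) * (?E + 1) * (fps_X - bb 2 + bb 4)"
    by (simp add: algebra_simps)
  finally have "fps_X * fps_tanh = fps_X - bb 2 + bb 4"
    using E1 fps_exp_plus_1_nz by simp
  hence "fps_nth (fps_X * fps_tanh) (Suc n) = fps_nth (fps_X - bb 2 + bb 4) (Suc n)" by simp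
  hence eq: "fps_nth fps_tanh n = 4 ^ Suc n * (Bernoulli (Suc n) / fact (Suc n)) - 2 ^ Suc n * (Bernoulli (Suc n) / fact (Suc n))"
    using n by (simp add: bbn del: power_Suc fact_Suc)
  have "(4::real) ^ Suc n = 2 ^ Suc n * 2 ^ Suc n"
    unfolding power_mult_distrib[symmetric] by simp
  thus ?thesis unfolding eq by (simp only: left_diff_distrib right_diff_distrib times_divide_eq_right mult.assoc diff_divide_distrib mult_1_left mult_1_right)
qed

text \<open>Two evaluations of the norm of the same tangent coefficient. Since norms are compared,
  the sign of \<open>Bernoulli (2 * m)\<close> never has to be determined.\<close>

theorem zeta_even_Bernoulli:
  assumes "m > 0"
  shows "(2 ^ (2 * m) - 1) * zeta (real (2 * m)) =
    2 ^ (2 * m) * (2 ^ (2 * m) - 1) * \<bar>Bernoulli (2 * m)\<bar> * pi ^ (2 * m) / (2 * fact (2 * m))"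
proof -
  define n where "n = 2 * m - 1"
  have n: "odd n" "Suc n = 2 * m" "n > 0" using assms by (auto simp: n_def)
  have "2 * (2 ^ Suc n - 1) * zeta (real (Suc n)) / pi ^ Suc n = \<bar>fps_nth fps_tanh n\<bar>"
    unfolding fps_tan_nth_conv_zeta_half[OF n(1), symmetric] fps_tan_nth_conv_tanh
    by (simp add: norm_mult norm_power)
  also have "\<dots> = 2 ^ Suc n * (2 ^ Suc n - 1) * \<bar>Bernoulli (Suc n)\<bar> / fact (Suc n)"
    unfolding fps_tanh_nth_conv_Bernoulli[OF n(3)] by (simp add: abs_mult del: power_Suc fact_Suc)
  finally show ?thesis unfolding n(2) by (simp add: field_simps)
qed

subsection \<open>An upper bound for the least common multiple of 1, ..., n\<close>

lemma multiplicity_conv_sum: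
  fixes p m L :: nat
  assumes "prime p" "0 < m" "m \<le> L"
  shows "multiplicity p m = (\<Sum>e=1..L. if p ^ e dvd m then 1 else 0)"
proof -
  have "multiplicity p m < p ^ multiplicity p m"
    using prime_gt_1_nat[OF assms(1)] by (intro power_gt_expt) auto
  also have "p ^ multiplicity p m \<le> m"
    using assms by (intro dvd_imp_le multiplicity_dvd)
  finally have le: "multiplicity p m \<le> L" using assms by simp
  have "(\<Sum>e=1..L. if p ^ e dvd m then 1 else 0 :: nat) = card {e\<in>{1..L}. p ^ e dvd m}"
    by (subst sum.inter_filter[symmetric]) simp_all
  also have "{e\<in>{1..L}. p ^ e dvd m} = {1..multiplicity p m}"
    using le assms prime_gt_1_nat[OF assms(1)]
    by (subst power_dvd_iff_le_multiplicity) auto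
  finally show ?thesis by simp
qed

text \<open>Legendre's formula. The free cutoff \<open>L\<close> lets factorials of different
  arguments be compared term by term over one common range of \<open>e\<close>.\<close>

lemma multiplicity_fact_nat:
  fixes p n L :: nat
  assumes "prime p" "n \<le> L"
  shows "multiplicity p (fact n :: nat) = (\<Sum>e=1..L. n div p ^ e)"
  using assms(2)
proof (induction n)
  case 0
  then show ?case by simp
next
  case (Suc n)
  have "multiplicity p (fact (Suc n) :: nat) = multiplicity p (Suc n) + multiplicity p (fact n :: nat)"
    unfolding fact_Suc of_nat_id using assms(1)
    by (intro prime_elem_multiplicity_mult_distrib) auto
  also have "\<dots> = (\<Sum>e=1..L. (if p ^ e dvd Suc n then 1 else 0) + n div p ^ e)"
    using Suc multiplicity_conv_sum[OF assms(1), of "Suc n" L] by (simp add: sum.distrib)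
  also have "\<dots> = (\<Sum>e=1..L. Suc n div p ^ e)"
    by (intro sum.cong) (auto simp: div_Suc dvd_eq_mod_eq_0)
  finally show ?case .
qed

definition lcm_upto :: "nat \<Rightarrow> nat" where "lcm_upto n = Lcm {1..n}"

lemma lcm_upto_pos: "0 < lcm_upto n"
  by (auto simp: lcm_upto_def Lcm_0_iff intro!: Nat.gr0I)

lemma dvd_lcm_upto: "0 < m \<Longrightarrow> m \<le> n \<Longrightarrow> m dvd lcm_upto n"
  by (auto simp: lcm_upto_def)

lemma lcm_upto_mono: "m \<le> n \<Longrightarrow> lcm_upto m \<le> lcm_upto n"
  using lcm_upto_pos[of n] unfolding lcm_upto_def
  by (intro dvd_imp_le Lcm_subset) auto

text \<open>The left side is a single term of the binomial expansion of
  \<open>(a + b) ^ (a + b)\<close>.\<close>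

lemma binomial_mult_power_le:
  fixes a b :: nat
  shows "((a + b) choose a) * a ^ a * b ^ b \<le> (a + b) ^ (a + b)"
proof -
  have "((a + b) choose a) * a ^ a * b ^ (a + b - a) \<le> (\<Sum>k\<le>a + b. ((a + b) choose k) * a ^ k * b ^ (a + b - k))"
    by (rule member_le_sum) auto
  also have "\<dots> = (a + b) ^ (a + b)"
    by (simp add: binomial)
  finally show ?thesis by simp
qed

text \<open>Chebyshev's method with \<open>1/2 + 1/3 + 1/7 + 1/42 = 1\<close>: this product of binomials is the multinomial coefficient
  \<open>(42q)! / ((21q)! (14q)! (6q)! q!)\<close>.\<close>
definition cheb_quot :: "nat \<Rightarrow> nat" where
  "cheb_quot q = ((42 * q) choose (21 * q)) * ((21 * q) choose (14 * q)) * ((7 * q) choose (6 * q))"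

lemma cheb_quot_fact:
  "cheb_quot q * (fact (21 * q) * fact (14 * q) * fact (6 * q) * fact q) = fact (42 * q)"
proof -
  have alg: "A * B * C * (x * y * z * w) = u" if "x * x * A = u" "y * v * B = x" "z * w * C = v"
    for A B C x y z w u v :: nat
    unfolding that(1)[symmetric] unfolding that(2)[symmetric] unfolding that(3)[symmetric] by (simp only: mult_ac)
  have "fact (21 * q) * fact (21 * q) * ((42 * q) choose (21 * q)) = (fact (42 * q) :: nat)"
    using binomial_fact_lemma[of "21 * q" "42 * q"] by simp
  moreover have "fact (14 * q) * fact (7 * q) * ((21 * q) choose (14 * q)) = (fact (21 * q) :: nat)"
    using binomial_fact_lemma[of "14 * q" "21 * q"] by simp
  moreover have "fact (6 * q) * fact q * ((7 * q) choose (6 * q)) = (fact (7 * q) :: nat)"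
    using binomial_fact_lemma[of "6 * q" "7 * q"] by simp
  ultimately show ?thesis
    unfolding cheb_quot_def by (rule alg)
qed

text \<open>This is \<open>binomial_mult_power_le\<close> for \<open>a * q\<close> and
  \<open>b * q\<close>; the powers of \<open>q\<close> on the two sides agree and cancel.\<close>

lemma binomial_multiples_le:
  fixes a b q :: nat
  assumes "0 < q"
  shows "(((a + b) * q) choose (a * q)) * (a ^ a * b ^ b) ^ q \<le> ((a + b) ^ (a + b)) ^ q"
proof -
  let ?C = "((a + b) * q) choose (a * q)"
  have *: "(x * q) ^ (y * q) = (x ^ y) ^ q * q ^ (y * q)" for x y
    by (simp add: power_mult_distrib power_mult)
  have "?C * (a * q) ^ (a * q) * (b * q) ^ (b * q) \<le> ((a + b) * q) ^ ((a + b) * q)"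
    using binomial_mult_power_le[of "a * q" "b * q"] by (simp only: add_mult_distrib)
  also have "\<dots> = ((a + b) ^ (a + b)) ^ q * q ^ ((a + b) * q)"
    by (rule *)
  also have "?C * (a * q) ^ (a * q) * (b * q) ^ (b * q) = (?C * (a ^ a * b ^ b) ^ q) * q ^ ((a + b) * q)"
    unfolding *[of a a] *[of b b] add_mult_distrib power_add power_mult_distrib[of "a ^ a"]
    by (simp only: mult_ac)
  finally show ?thesis using assms by (subst (asm) mult_le_cancel2) simp
qed

lemma binomial_multiples_le':
  fixes a b q :: nat and k :: real
  assumes "0 < a" "0 < b" "real ((a + b) ^ (a + b)) = k * real (a ^ a * b ^ b)"
  shows "real (((a + b) * q) choose (a * q)) \<le> k ^ q"
proof (cases "q = 0")
  case False
  let ?C = "((a + b) * q) choose (a * q)" and ?w = "(a ^ a * b ^ b) ^ q"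
  have "real ?C * real ?w = real (?C * ?w)" by (rule of_nat_mult[symmetric])
  also have "\<dots> \<le> real (((a + b) ^ (a + b)) ^ q)"
    using binomial_multiples_le[of q a b] False by (intro of_nat_mono) simp
  also have "\<dots> = (k * real (a ^ a * b ^ b)) ^ q"
    unfolding of_nat_power[of "(a + b) ^ (a + b)"] assms(3) ..
  also have "\<dots> = k ^ q * real ?w"
    unfolding power_mult_distrib[of k] of_nat_power[of "a ^ a * b ^ b"] ..
  finally show ?thesis using assms(1,2) by (subst (asm) mult_le_cancel_right) auto
qed simp

text \<open>The base is \<open>42^42 / (21^21 * 14^14 * 6^6)\<close>, the exponential growth rate of
  the multinomial coefficient, assembled from its three binomial factors.\<close>

lemma cheb_quot_le: "real (cheb_quot q) \<le> (2 ^ 21 * 3 ^ 14 * 7 ^ 6 * 42) ^ q"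
proof -
  have "real ((42 * q) choose (21 * q)) \<le> (2 ^ 42) ^ q"
    using binomial_multiples_le'[of 21 21 "2 ^ 42" q] by simp
  moreover have "real ((21 * q) choose (14 * q)) \<le> (3 ^ 21 / 2 ^ 14) ^ q"
    using binomial_multiples_le'[of 14 7 "3 ^ 21 / 2 ^ 14" q] by simp
  moreover have "real ((7 * q) choose (6 * q)) \<le> (7 ^ 7 / 6 ^ 6) ^ q"
    using binomial_multiples_le'[of 6 1 "7 ^ 7 / 6 ^ 6" q] by simp
  ultimately have "real (cheb_quot q) \<le> (2 ^ 42) ^ q * (3 ^ 21 / 2 ^ 14) ^ q * (7 ^ 7 / 6 ^ 6) ^ q"
    unfolding cheb_quot_def of_nat_mult by (intro mult_mono) auto
  also have "\<dots> = (2 ^ 42 * (3 ^ 21 / 2 ^ 14) * (7 ^ 7 / 6 ^ 6)) ^ q"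
    by (simp only: power_mult_distrib)
  also have "2 ^ 42 * (3 ^ 21 / 2 ^ 14) * (7 ^ 7 / 6 ^ 6) = (2 ^ 21 * 3 ^ 14 * 7 ^ 6 * 42 :: real)"
    by simp
  finally show ?thesis .
qed

text \<open>By Legendre, a prime power \<open>P = p ^ e\<close> contributes
  \<open>u - (u div 2 + u div 3 + u div 7 + u div 42)\<close> to the multiplicity of
  \<open>p\<close> in \<open>cheb_quot q\<close>, where \<open>u = 42 * q div P\<close>. This is
  never negative, and it is at least \<open>1\<close> for \<open>0 < u < 42\<close> because
  \<open>1/2 + 1/3 + 1/7 < 1\<close>. So the powers of \<open>p\<close> between \<open>q\<close> and
  \<open>42 * q\<close> are paid for by \<open>cheb_quot q\<close>, and those up to \<open>q\<close>
  by \<open>lcm_upto q\<close>.\<close>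

lemma lcm_upto_dvd: "lcm_upto (42 * q) dvd lcm_upto q * cheb_quot q"
proof -
  have nz: "cheb_quot q \<noteq> 0"
    using cheb_quot_fact[of q] by (metis fact_nonzero mult_zero_left)
  have "m dvd lcm_upto q * cheb_quot q" if m: "m \<in> {1..42 * q}" for m
  proof (rule multiplicity_le_imp_dvd)
    show "m \<noteq> 0" using m by simp
    fix p :: nat assume p: "prime p"
    define L where "L = 42 * q"
    define i where "i = multiplicity p m"
    have "p ^ i dvd m" by (simp add: i_def multiplicity_dvd)
    hence pi: "p ^ i \<le> 42 * q" using m by (auto dest: dvd_imp_le)
    have "i < p ^ i" using prime_gt_1_nat[OF p] by (intro power_gt_expt) auto
    hence iL: "i \<le> L" using pi L_def by simp
    have p1: "p > 1" using p prime_gt_1_nat by blast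
    \<comment> \<open>\<open>e0\<close> is the largest exponent up to \<open>i\<close> with
      \<open>p ^ e0 \<le> q\<close>; the alternative \<open>e = 0\<close> guarantees that a maximum
      exists also for \<open>q = 0\<close>.\<close>
    have "\<exists>e0. (e0 \<le> i \<and> (p ^ e0 \<le> q \<or> e0 = 0)) \<and> (\<forall>e. e \<le> i \<and> (p ^ e \<le> q \<or> e = 0) \<longrightarrow> e \<le> e0)"
      by (rule ex_has_greatest_nat[where k = 0 and b = "Suc i"]) auto
    then obtain e0 where e0: "e0 \<le> i" "p ^ e0 \<le> q \<or> e0 = 0" "\<And>e. e \<le> i \<Longrightarrow> p ^ e \<le> q \<Longrightarrow> e \<le> e0"
      by blast
    have "p ^ e0 dvd lcm_upto q"
      using e0(2) p1 by (cases "e0 = 0") (auto intro: dvd_lcm_upto)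
    hence A: "e0 \<le> multiplicity p (lcm_upto q)"
      using p1 lcm_upto_pos[of q] by (subst (asm) power_dvd_iff_le_multiplicity) auto
    have "multiplicity p (fact (42 * q) :: nat) = multiplicity p (cheb_quot q) +
       (multiplicity p (fact (21 * q) :: nat) + multiplicity p (fact (14 * q) :: nat) + multiplicity p (fact (6 * q) :: nat) + multiplicity p (fact q :: nat))"
      unfolding cheb_quot_fact[symmetric] using p nz
      by (simp add: prime_elem_multiplicity_mult_distrib)
    hence "(\<Sum>e=1..L. 42 * q div p ^ e) = multiplicity p (cheb_quot q) +
       (\<Sum>e=1..L. 21 * q div p ^ e + 14 * q div p ^ e + 6 * q div p ^ e + q div p ^ e)"
      by (simp add: multiplicity_fact_nat[OF p, where L = L] L_def sum.distrib)
    moreover have "(\<Sum>e=1..L. 42 * q div p ^ e) \<ge> (\<Sum>e=1..L. (if e \<le> i \<and> q < p ^ e then 1 else 0) + (21 * q div p ^ e + 14 * q div p ^ e + 6 * q div p ^ e + q div p ^ e))"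
    proof (rule sum_mono)
      fix e assume "e \<in> {1..L}"
      define P where "P = p ^ e"
      have P: "P > 0" using p1 by (simp add: P_def)
      define u where "u = 42 * q div P"
      have "21 * q div P = u div 2"
        unfolding u_def using div_mult_mult1[of 2 "21 * q" P] by (simp add: div_mult2_eq[symmetric] mult.commute)
      moreover have "14 * q div P = u div 3"
        unfolding u_def using div_mult_mult1[of 3 "14 * q" P] by (simp add: div_mult2_eq[symmetric] mult.commute)
      moreover have "6 * q div P = u div 7"
        unfolding u_def using div_mult_mult1[of 7 "6 * q" P] by (simp add: div_mult2_eq[symmetric] mult.commute)
      moreover have "q div P = u div 42"
        unfolding u_def using div_mult_mult1[of 42 "q" P] by (simp add: div_mult2_eq[symmetric] mult.commute)
      moreover have "u > 0 \<and> q div P = 0" if "e \<le> i" "q < P"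
      proof -
        have "P \<le> p ^ i" unfolding P_def using that p1 by (intro power_increasing) auto
        thus ?thesis using that pi P by (auto simp: u_def div_greater_zero_iff)
      qed
      ultimately show "(if e \<le> i \<and> q < p ^ e then 1 else 0) + (21 * q div p ^ e + 14 * q div p ^ e + 6 * q div p ^ e + q div p ^ e) \<le> 42 * q div p ^ e"
        unfolding P_def[symmetric] u_def[symmetric] by (cases "e \<le> i \<and> q < P") auto
    qed
    ultimately have "(\<Sum>e=1..L. if e \<le> i \<and> q < p ^ e then 1 else 0) \<le> multiplicity p (cheb_quot q)"
      by (simp add: sum.distrib)
    also have "(\<Sum>e=1..L. if e \<le> i \<and> q < p ^ e then 1 else 0) = card {e\<in>{1..L}. e \<le> i \<and> q < p ^ e}"
      by (subst sum.inter_filter[symmetric]) simp_all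
    finally have "card {e\<in>{1..L}. e \<le> i \<and> q < p ^ e} \<le> multiplicity p (cheb_quot q)" .
    moreover have "{Suc e0..i} \<subseteq> {e\<in>{1..L}. e \<le> i \<and> q < p ^ e}"
    proof
      fix x assume x: "x \<in> {Suc e0..i}"
      with e0(3)[of x] have "\<not> p ^ x \<le> q" by auto
      thus "x \<in> {e\<in>{1..L}. e \<le> i \<and> q < p ^ e}" using x iL by auto
    qed
    hence "card {Suc e0..i} \<le> card {e\<in>{1..L}. e \<le> i \<and> q < p ^ e}"
      by (intro card_mono) auto
    ultimately have B: "i \<le> multiplicity p (cheb_quot q) + multiplicity p (lcm_upto q)" using A by simp
    show "multiplicity p m \<le> multiplicity p (lcm_upto q * cheb_quot q)"
      using B p nz lcm_upto_pos[of q]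
      by (simp add: prime_elem_multiplicity_mult_distrib i_def)
  qed
  thus ?thesis unfolding lcm_upto_def[of "42 * q"] by (intro Lcm_least) auto
qed

text \<open>Iterating \<open>lcm_upto_dvd\<close> over \<open>n, n/42, n/42^2, ...\<close> gives the
  rate \<open>M^(1/42 + 1/42^2 + ...) = M^(1/41)\<close>, where \<open>M\<close> is the base in
  \<open>cheb_quot_le\<close>.\<close>

lemma lcm_upto_le:
  obtains A :: real where "A > 0" "\<And>n. real (lcm_upto n) \<le> A * (607 / 200) ^ n"
proof -
  \<comment> \<open>\<open>M^(1/41)\<close> is about \<open>3.0225\<close>. The slightly larger
    \<open>\<kappa>\<close> makes \<open>\<theta> < 1\<close>, which leaves room for
    rounding.\<close>
  define \<kappa> :: real where "\<kappa> = 607 / 200"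
  define M :: real where "M = 2 ^ 21 * 3 ^ 14 * 7 ^ 6 * 42"
  define \<theta> where "\<theta> = M / \<kappa> ^ 41"
  have M: "M = \<theta> * \<kappa> ^ 41" by (simp add: \<theta>_def \<kappa>_def)
  have \<theta>: "0 < \<theta>" "\<theta> < 1" by (simp_all add: \<theta>_def M_def \<kappa>_def power_divide)
  have \<kappa>: "\<kappa> \<ge> 1" by (simp add: \<kappa>_def)
  have "(\<lambda>p. \<kappa> ^ 41 * \<theta> ^ p) \<longlonglongrightarrow> \<kappa> ^ 41 * 0"
    using \<theta> by (intro tendsto_mult tendsto_const LIMSEQ_power_zero) auto
  hence "eventually (\<lambda>p. \<kappa> ^ 41 * \<theta> ^ p < 1) sequentially"
    by (rule order_tendstoD) simp
  then obtain p0 where p0: "\<And>p. p \<ge> p0 \<Longrightarrow> \<kappa> ^ 41 * \<theta> ^ p < 1"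
    by (auto simp: eventually_sequentially)
  define A where "A = real (lcm_upto (42 * p0 + 42))"
  have A: "A > 0" using lcm_upto_pos by (simp add: A_def)
  have "real (lcm_upto n) \<le> A * \<kappa> ^ n" for n
  proof (induction n rule: less_induct)
    case (less n)
    show ?case
    proof (cases "n \<le> 42 * p0 + 42")
      case True
      hence "real (lcm_upto n) \<le> A * 1"
        using lcm_upto_mono by (simp add: A_def)
      also have "\<dots> \<le> A * \<kappa> ^ n"
        using A \<kappa> by (intro mult_left_mono one_le_power) auto
      finally show ?thesis .
    next
      case False
      \<comment> \<open>\<open>p\<close> is \<open>n / 42\<close> rounded up, so
        \<open>42 * p\<close> exceeds \<open>n\<close> by at most \<open>41\<close>. The resulting
        \<open>\<kappa> ^ 41\<close> is absorbed by \<open>\<theta> ^ p\<close> once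
        \<open>p \<ge> p0\<close>.\<close>
      define p where "p = (n + 41) div 42"
      have p: "n \<le> 42 * p" "42 * p \<le> n + 41" "p < n" "p \<ge> p0"
        using False by (auto simp: p_def)
      have "lcm_upto n \<le> lcm_upto (42 * p)" by (rule lcm_upto_mono) (fact p)
      also have "\<dots> \<le> lcm_upto p * cheb_quot p"
        using lcm_upto_pos[of p] cheb_quot_fact[of p]
        by (intro dvd_imp_le lcm_upto_dvd) (auto intro!: Nat.gr0I)
      finally have "real (lcm_upto n) \<le> real (lcm_upto p) * real (cheb_quot p)"
        unfolding of_nat_mult[symmetric] by (rule of_nat_mono)
      also have "\<dots> \<le> (A * \<kappa> ^ p) * M ^ p"
        using less.IH[OF p(3)] cheb_quot_le[of p] A \<kappa> unfolding M_def by (intro mult_mono) auto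
      also have "\<dots> = A * (\<theta> ^ p * \<kappa> ^ (42 * p))"
        unfolding M power_mult_distrib power_mult[symmetric]
        by (simp add: power_add[symmetric] mult_ac)
      also have "\<dots> \<le> A * (\<theta> ^ p * \<kappa> ^ (n + 41))"
        using A \<theta> \<kappa> p by (intro mult_left_mono power_increasing) auto
      also have "\<dots> = (A * \<kappa> ^ n) * (\<kappa> ^ 41 * \<theta> ^ p)"
        by (simp add: power_add mult_ac)
      also have "\<dots> \<le> (A * \<kappa> ^ n) * 1"
        using p0[OF p(4)] A \<kappa> by (intro mult_left_mono) auto
      finally show ?thesis by simp
    qed
  qed
  with A show ?thesis by (intro that) (auto simp: \<kappa>_def)
qed

subsection \<open>Partial fractions with controlled denominators\<close>

text \<open>The exponent \<open>K - k\<close> is the expected loss: splitting a product of poles at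
  \<open>- i\<close> and \<open>- j\<close> lowers the total order by one and divides by
  \<open>i - j\<close>, a divisor of the lcm. Equality is asked off the poles only, as division by
  \<open>0\<close> is meaningless there.\<close>

definition pf_form :: "nat \<Rightarrow> nat \<Rightarrow> (real \<Rightarrow> real) \<Rightarrow> bool" where
  "pf_form n K f \<longleftrightarrow> (\<exists>a :: nat \<Rightarrow> nat \<Rightarrow> real.
     (\<forall>k\<in>{1..K}. \<forall>j\<le>n. real (lcm_upto n) ^ (K - k) * a k j \<in> \<int>) \<and>
     (\<forall>t. (\<forall>j\<le>n. t + real j \<noteq> 0) \<longrightarrow> f t = (\<Sum>k=1..K. \<Sum>j\<le>n. a k j / (t + real j) ^ k)))"

text \<open>The building block with simple poles and integer residues, that is
  \<open>pf_form\<close> with \<open>K = 1\<close>.\<close>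

definition brick :: "nat \<Rightarrow> (real \<Rightarrow> real) \<Rightarrow> bool" where
  "brick n g \<longleftrightarrow> (\<exists>b :: nat \<Rightarrow> real. (\<forall>j\<le>n. b j \<in> \<int>) \<and>
     (\<forall>t. (\<forall>j\<le>n. t + real j \<noteq> 0) \<longrightarrow> g t = (\<Sum>j\<le>n. b j / (t + real j))))"

lemma pf_formI:
  assumes "\<And>k j. k \<in> {1..K} \<Longrightarrow> j \<le> n \<Longrightarrow> real (lcm_upto n) ^ (K - k) * a k j \<in> \<int>"
    "\<And>t. (\<forall>j\<le>n. t + real j \<noteq> 0) \<Longrightarrow> f t = (\<Sum>k=1..K. \<Sum>j\<le>n. a k j / (t + real j) ^ k)"
  shows "pf_form n K f"
  unfolding pf_form_def using assms by (intro exI[of _ a]) blast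

lemma pf_formE:
  assumes "pf_form n K f"
  obtains a where
    "\<And>k j. k \<in> {1..K} \<Longrightarrow> j \<le> n \<Longrightarrow> real (lcm_upto n) ^ (K - k) * a k j \<in> \<int>"
    "\<And>t. (\<forall>j\<le>n. t + real j \<noteq> 0) \<Longrightarrow> f t = (\<Sum>k=1..K. \<Sum>j\<le>n. a k j / (t + real j) ^ k)"
  using assms unfolding pf_form_def by blast

lemma brickE:
  assumes "brick n g"
  obtains b where "\<And>j. j \<le> n \<Longrightarrow> b j \<in> \<int>"
    "\<And>t. (\<forall>j\<le>n. t + real j \<noteq> 0) \<Longrightarrow> g t = (\<Sum>j\<le>n. b j / (t + real j))"
  using assms unfolding brick_def by blast

lemma pf_form_cong:
  assumes "pf_form n K f" "\<And>t. (\<forall>j\<le>n. t + real j \<noteq> 0) \<Longrightarrow> f t = g t"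
  shows "pf_form n K g"
proof -
  obtain a where a: "\<And>k j. k \<in> {1..K} \<Longrightarrow> j \<le> n \<Longrightarrow> real (lcm_upto n) ^ (K - k) * a k j \<in> \<int>"
    "\<And>t. (\<forall>j\<le>n. t + real j \<noteq> 0) \<Longrightarrow> f t = (\<Sum>k=1..K. \<Sum>j\<le>n. a k j / (t + real j) ^ k)"
    using assms(1) by (elim pf_formE) blast
  show ?thesis
  proof (rule pf_formI)
    fix t assume t: "\<forall>j\<le>n. t + real j \<noteq> 0"
    show "g t = (\<Sum>k=1..K. \<Sum>j\<le>n. a k j / (t + real j) ^ k)"
      using assms(2)[OF t] a(2)[OF t] by simp
  qed (rule a(1))
qed

lemma pf_form_0: "pf_form n K (\<lambda>_. 0)"
  by (rule pf_formI[where a = "\<lambda>_ _. 0"]) simp_all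

lemma pf_form_add:
  assumes "pf_form n K f" "pf_form n K g"
  shows "pf_form n K (\<lambda>t. f t + g t)"
proof -
  obtain a where a: "\<And>k j. k \<in> {1..K} \<Longrightarrow> j \<le> n \<Longrightarrow> real (lcm_upto n) ^ (K - k) * a k j \<in> \<int>"
    "\<And>t. (\<forall>j\<le>n. t + real j \<noteq> 0) \<Longrightarrow> f t = (\<Sum>k=1..K. \<Sum>j\<le>n. a k j / (t + real j) ^ k)"
    using assms(1) by (elim pf_formE) blast
  obtain b where b: "\<And>k j. k \<in> {1..K} \<Longrightarrow> j \<le> n \<Longrightarrow> real (lcm_upto n) ^ (K - k) * b k j \<in> \<int>"
    "\<And>t. (\<forall>j\<le>n. t + real j \<noteq> 0) \<Longrightarrow> g t = (\<Sum>k=1..K. \<Sum>j\<le>n. b k j / (t + real j) ^ k)"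
    using assms(2) by (elim pf_formE) blast
  show ?thesis
  proof (rule pf_formI[where a = "\<lambda>k j. a k j + b k j"])
    fix k j assume "k \<in> {1..K}" "j \<le> n"
    thus "real (lcm_upto n) ^ (K - k) * (a k j + b k j) \<in> \<int>"
      unfolding ring_distribs by (intro Ints_add a(1) b(1))
  next
    fix t assume t: "\<forall>j\<le>n. t + real j \<noteq> 0"
    show "f t + g t = (\<Sum>k=1..K. \<Sum>j\<le>n. (a k j + b k j) / (t + real j) ^ k)"
      unfolding a(2)[OF t] b(2)[OF t] add_divide_distrib sum.distrib ..
  qed
qed

lemma pf_form_sum:
  assumes "finite A" "\<And>x. x \<in> A \<Longrightarrow> pf_form n K (f x)"
  shows "pf_form n K (\<lambda>t. \<Sum>x\<in>A. f x t)"
  using assms by (induction A rule: finite_induct) (auto intro: pf_form_0 pf_form_add)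

lemma pf_form_single:
  assumes "1 \<le> k" "k \<le> K" "j \<le> n" "real (lcm_upto n) ^ (K - k) * c \<in> \<int>"
  shows "pf_form n K (\<lambda>t. c / (t + real j) ^ k)"
proof (rule pf_formI[where a = "\<lambda>k' j'. if k' = k then if j' = j then c else 0 else 0"])
  fix t assume "\<forall>j\<le>n. t + real j \<noteq> 0"
  have "(\<Sum>j'\<le>n. (if j' = j then c else 0) / (t + real j') ^ k) = (\<Sum>j'\<le>n. if j' = j then c / (t + real j) ^ k else 0)"
    by (intro sum.cong) auto
  hence inner: "(\<Sum>j'\<le>n. (if j' = j then c else 0) / (t + real j') ^ k) = c / (t + real j) ^ k"
    using assms by simp
  have "(\<Sum>k'=1..K. \<Sum>j'\<le>n. (if k' = k then if j' = j then c else 0 else 0) / (t + real j') ^ k')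
      = (\<Sum>k'=1..K. if k' = k then c / (t + real j) ^ k else 0)"
    by (intro sum.cong) (auto simp: inner)
  also have "\<dots> = c / (t + real j) ^ k"
    using assms by simp
  finally show "c / (t + real j) ^ k = (\<Sum>k'=1..K. \<Sum>j'\<le>n. (if k' = k then if j' = j then c else 0 else 0) / (t + real j') ^ k')" ..
qed (use assms in auto)

lemma lcm_upto_div_diff_Ints:
  assumes "i \<le> n" "j \<le> n" "i \<noteq> j"
  shows "real (lcm_upto n) / (real i - real j) \<in> \<int>"
proof -
  have "int i - int j dvd int (lcm_upto n)"
  proof -
    have "nat \<bar>int i - int j\<bar> dvd lcm_upto n"
      using assms by (intro dvd_lcm_upto) auto
    hence "\<bar>int i - int j\<bar> dvd int (lcm_upto n)"
      by (subst (asm) int_dvd_int_iff[symmetric]) simp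
    thus ?thesis by simp
  qed
  then obtain c where c: "int (lcm_upto n) = (int i - int j) * c" by (elim dvdE)
  have "real (lcm_upto n) = of_int (int (lcm_upto n))" by simp
  also have "\<dots> = (real i - real j) * of_int c" unfolding c by simp
  finally show ?thesis using assms by simp
qed

text \<open>With \<open>u = t + i\<close> and \<open>v = t + j\<close>, the identity
  \<open>1 / (v^(k+1) * u) = (1 / v^(k+1) - 1 / (v^k * u)) / (u - v)\<close> lowers \<open>k\<close>
  at the price of one division by \<open>u - v = i - j\<close>.\<close>

lemma pf_form_term:
  assumes "i \<le> n" "j \<le> n" "i \<noteq> j" "k \<le> K" "real (lcm_upto n) ^ (K - k) * c \<in> \<int>"
  shows "pf_form n (Suc K) (\<lambda>t. c / ((t + real j) ^ k * (t + real i)))"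
  using assms(4,5)
proof (induction k arbitrary: c)
  case 0
  thus ?case using pf_form_single[of 1 "Suc K" i n c] assms by simp
next
  case (Suc k)
  define c' where "c' = c / (real i - real j)"
  have "real (lcm_upto n) ^ (K - k) * c' = (real (lcm_upto n) ^ (K - Suc k) * c) * (real (lcm_upto n) / (real i - real j))"
    using Suc.prems(1) by (simp add: c'_def Suc_diff_Suc[symmetric] mult_ac flip: power_Suc)
  also have "\<dots> \<in> \<int>"
    using assms by (intro Ints_mult Suc.prems lcm_upto_div_diff_Ints)
  finally have c': "real (lcm_upto n) ^ (K - k) * c' \<in> \<int>" .
  have "pf_form n (Suc K) (\<lambda>t. c' / (t + real j) ^ Suc k + (- c') / ((t + real j) ^ k * (t + real i)))"
    using c' assms Suc.prems by (intro pf_form_add pf_form_single Suc.IH) auto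
  thus ?case
  proof (rule pf_form_cong)
    fix t assume "\<forall>j\<le>n. t + real j \<noteq> 0"
    hence "t + real i \<noteq> 0" "t + real j \<noteq> 0" "real i - real j \<noteq> 0" using assms by auto
    moreover have "x / (u - v) / (v ^ k * v) + (- (x / (u - v))) / (v ^ k * u) = x / (v ^ k * v * u)"
      if "u \<noteq> 0" "v \<noteq> 0" "u - v \<noteq> 0" for x u v :: real
      using that by (simp add: divide_simps) (simp add: algebra_simps)
    from this[of "t + real i" "t + real j"] show "c' / (t + real j) ^ Suc k + (- c') / ((t + real j) ^ k * (t + real i)) =
        c / ((t + real j) ^ Suc k * (t + real i))"
      using calculation by (simp add: c'_def mult_ac)
  qed
qed

text \<open>A product of two poles at the same point raises the order by one and leaves
  \<open>K - k\<close> unchanged; at different points \<open>pf_form_term\<close> applies.\<close>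

lemma pf_form_mult_brick:
  assumes "pf_form n K f" "brick n g"
  shows "pf_form n (Suc K) (\<lambda>t. f t * g t)"
proof -
  obtain a where a:
    "\<And>k j. k \<in> {1..K} \<Longrightarrow> j \<le> n \<Longrightarrow> real (lcm_upto n) ^ (K - k) * a k j \<in> \<int>"
    "\<And>t. (\<forall>j\<le>n. t + real j \<noteq> 0) \<Longrightarrow> f t = (\<Sum>k=1..K. \<Sum>j\<le>n. a k j / (t + real j) ^ k)"
    using assms(1) by (elim pf_formE) blast
  obtain b where b:
    "\<And>j. j \<le> n \<Longrightarrow> b j \<in> \<int>"
    "\<And>t. (\<forall>j\<le>n. t + real j \<noteq> 0) \<Longrightarrow> g t = (\<Sum>j\<le>n. b j / (t + real j))"
    using assms(2) by (elim brickE) blast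
  have "pf_form n (Suc K) (\<lambda>t. \<Sum>k=1..K. \<Sum>j\<le>n. \<Sum>i\<le>n. a k j * b i / ((t + real j) ^ k * (t + real i)))"
  proof (intro pf_form_sum finite_atMost finite_atLeastAtMost)
    fix k j i assume k: "k \<in> {1..K}" and j: "j \<in> {..n}" and i: "i \<in> {..n}"
    have int: "real (lcm_upto n) ^ (K - k) * (a k j * b i) \<in> \<int>"
      using Ints_mult[OF a(1)[OF k, of j] b(1)[of i]] i j by (simp add: mult_ac)
    show "pf_form n (Suc K) (\<lambda>t. a k j * b i / ((t + real j) ^ k * (t + real i)))"
    proof (cases "i = j")
      case True
      thus ?thesis using pf_form_single[of "Suc k" "Suc K" j n "a k j * b i"] int k j by (simp add: mult_ac)
    next
      case False
      thus ?thesis using int i j k by (intro pf_form_term) auto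
    qed
  qed
  thus ?thesis
  proof (rule pf_form_cong)
    fix t assume t: "\<forall>j\<le>n. t + real j \<noteq> 0"
    show "(\<Sum>k=1..K. \<Sum>j\<le>n. \<Sum>i\<le>n. a k j * b i / ((t + real j) ^ k * (t + real i))) = f t * g t"
      unfolding a(2)[OF t] b(2)[OF t] sum_distrib_right unfolding sum_distrib_left
      by (intro sum.cong refl) simp
  qed
qed

lemma brick_imp_pf_form: "brick n g \<Longrightarrow> pf_form n 1 g"
  unfolding brick_def pf_form_def by (elim exE, rule_tac x = "\<lambda>_. b" in exI) simp

lemma pf_form_brick_prod:
  assumes "finite A" "A \<noteq> {}" "\<And>x. x \<in> A \<Longrightarrow> brick n (g x)"
  shows "pf_form n (card A) (\<lambda>t. \<Prod>x\<in>A. g x t)"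
  using assms
proof (induction A rule: finite_ne_induct)
  case (singleton x)
  thus ?case using brick_imp_pf_form[of n "g x"] by simp
next
  case (insert x A)
  have "pf_form n (Suc (card A)) (\<lambda>t. (\<Prod>x\<in>A. g x t) * g x t)"
    using insert by (intro pf_form_mult_brick) auto
  thus ?case using insert by (simp add: mult.commute)
qed

section \<open>Integrality of the building blocks\<close>

lemma prod_shift_ne:
  assumes "j \<le> n"
  shows "(\<Prod>i\<in>{..n}-{j}. real i - real j) = (-1) ^ j * fact j * fact (n - j)"
proof -
  have "{..n} - {j} = {..<j} \<union> {Suc j..n}" using assms by auto
  hence "(\<Prod>i\<in>{..n}-{j}. real i - real j) = (\<Prod>i\<in>{..<j} \<union> {Suc j..n}. real i - real j)"
    by simp
  also have "\<dots> = (\<Prod>i<j. real i - real j) * (\<Prod>i=Suc j..n. real i - real j)"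
    by (rule prod.union_disjoint) auto
  also have "(\<Prod>i<j. real i - real j) = (\<Prod>i<j. - real (Suc i))"
    by (rule prod.reindex_bij_witness[of _ "\<lambda>i. j - Suc i" "\<lambda>i. j - Suc i"]) auto
  also have "\<dots> = (-1) ^ j * fact j"
    by (simp add: prod_uminus fact_prod_Suc atLeast0LessThan del: of_nat_Suc)
  also have "(\<Prod>i=Suc j..n. real i - real j) = (\<Prod>i=1..n-j. real i)"
    using assms by (intro prod.reindex_bij_witness[of _ "\<lambda>i. i + j" "\<lambda>i. i - j"]) auto
  also have "\<dots> = fact (n - j)" by (simp add: fact_prod)
  finally show ?thesis by simp
qed

text \<open>Lagrange interpolation of \<open>p\<close> at \<open>0, -1, ..., -n\<close>: the degree
  bound excludes a polynomial part, and the residue at \<open>- j\<close> is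
  \<open>(-1)^j * (n choose j) * p (- j)\<close>.\<close>

lemma brick_poly:
  fixes p :: "real poly"
  assumes "degree p \<le> n" "\<And>j. j \<le> n \<Longrightarrow> poly p (- real j) \<in> \<int>"
  shows "brick n (\<lambda>t. fact n * poly p t / (\<Prod>j\<le>n. t + real j))"
  unfolding brick_def
proof (intro exI[of _ "\<lambda>j. (-1) ^ j * real (n choose j) * poly p (- real j)"] conjI allI impI)
  fix j assume "j \<le> n"
  thus "(-1) ^ j * real (n choose j) * poly p (- real j) \<in> \<int>"
    using assms(2)[of j] by (auto intro!: Ints_mult Ints_power)
next
  fix t :: real assume t: "\<forall>j\<le>n. t + real j \<noteq> 0"
  define b where "b j = (-1) ^ j * real (n choose j) * poly p (- real j)" for j
  define L where "L j = (\<Prod>i\<in>{..n}-{j}. [:real i, 1:])" for j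
  \<comment> \<open>The Lagrange interpolant; it agrees with \<open>p\<close> at
    \<open>n + 1\<close> points.\<close>
  define q where "q = (\<Sum>j\<le>n. smult (b j / fact n) (L j))"
  have degL: "degree (L j) \<le> n" if "j \<le> n" for j
  proof -
    have "degree (L j) \<le> (\<Sum>i\<in>{..n}-{j}. degree [:real i, 1:])"
      unfolding L_def using degree_prod_sum_le[of "{..n}-{j}" "\<lambda>i. [:real i, 1:]"] by (simp add: o_def)
    thus ?thesis using that by simp
  qed
  have "degree q \<le> n" unfolding q_def
    by (intro degree_sum_le) (auto intro: order.trans[OF degree_smult_le] degL)
  moreover have "inj_on (\<lambda>j. - real j) {..n}" by (auto intro: inj_onI)
  hence "card ((\<lambda>j. - real j) ` {..n}) = Suc n" by (simp add: card_image)
  moreover have "poly p x = poly q x" if "x \<in> (\<lambda>j. - real j) ` {..n}" for x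
  proof -
    from that obtain l where l: "l \<le> n" "x = - real l" by auto
    have "poly q x = (\<Sum>j\<le>n. if j = l then poly p x else 0)"
      unfolding q_def poly_sum
    proof (rule sum.cong)
      fix j assume "j \<in> {..n}"
      show "poly (smult (b j / fact n) (L j)) x = (if j = l then poly p x else 0)"
      proof (cases "j = l")
        case True
        have "poly (L l) x = (-1) ^ l * fact l * fact (n - l)"
          unfolding prod_shift_ne[OF l(1), symmetric] L_def poly_prod l(2) by simp
        moreover have "real (n choose l) = fact n / (fact l * fact (n - l))"
          using l(1) by (rule binomial_fact)
        ultimately show ?thesis using True by (simp add: b_def l(2) flip: power_mult_distrib)
      next
        case False
        have "poly (L j) x = 0" unfolding L_def poly_prod using l False by (intro prod_zero) auto
        thus ?thesis using False by simp
      qed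
    qed simp
    thus ?thesis using l by simp
  qed
  ultimately have "p = q" using assms(1) by (intro poly_eqI_degree[of "(\<lambda>j. - real j) ` {..n}"]) auto
  hence "fact n * poly p t / (\<Prod>j\<le>n. t + real j) = (\<Sum>j\<le>n. b j * poly (L j) t / (\<Prod>j\<le>n. t + real j))"
    by (simp add: q_def poly_sum sum_distrib_left sum_divide_distrib mult_ac)
  also have "\<dots> = (\<Sum>j\<le>n. b j / (t + real j))"
  proof (rule sum.cong)
    fix j assume j: "j \<in> {..n}"
    have "(\<Prod>j\<le>n. t + real j) = (t + real j) * poly (L j) t"
      unfolding L_def poly_prod using j by (subst prod.remove[of _ j]) (auto simp: add.commute)
    moreover have "(\<Prod>j\<le>n. t + real j) \<noteq> 0" using t by simp
    ultimately show "b j * poly (L j) t / (\<Prod>j\<le>n. t + real j) = b j / (t + real j)" by simp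
  qed simp
  finally show "fact n * poly p t / (\<Prod>j\<le>n. t + real j) = (\<Sum>j\<le>n. ((-1) ^ j * real (n choose j) * poly p (- real j)) / (t + real j))"
    by (simp add: b_def)
qed

lemma four_power_gbinomial_minus_half:
  "4 ^ k * ((-1/2 :: real) gchoose k) = (-1) ^ k * real ((2 * k) choose k)"
proof (induction k)
  case (Suc k)
  have "real (Suc k) * ((-1/2 :: real) gchoose Suc k) = (-1/2 - real k) * ((-1/2) gchoose k)"
    using gbinomial_mult_1[of "-1/2 :: real" k] by (simp add: algebra_simps)
  hence "4 ^ Suc k * (real (Suc k) * ((-1/2 :: real) gchoose Suc k)) = 4 ^ Suc k * ((-1/2 - real k) * ((-1/2) gchoose k))"
    by (rule arg_cong)
  hence "real (Suc k) * (4 ^ Suc k * ((-1/2 :: real) gchoose Suc k)) = - (2 * (2 * real k + 1)) * (4 ^ k * ((-1/2) gchoose k))"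
    by (simp add: algebra_simps)
  also have "\<dots> = real (Suc k) * ((-1) ^ Suc k * real ((2 * Suc k) choose Suc k))"
  proof -
    have "real ((2 * k) choose k) = fact (2 * k) / (fact k * fact k)"
      by (subst binomial_fact) auto
    moreover have "real ((2 * Suc k) choose Suc k) = fact (2 * Suc k) / (fact (Suc k) * fact (Suc k))"
      by (subst binomial_fact) auto
    moreover have "fact (2 * Suc k) = (2 * real k + 2) * (2 * real k + 1) * (fact (2 * k) :: real)"
      by (simp add: algebra_simps)
    moreover have "fact (Suc k) = (real k + 1) * (fact k :: real)" by (simp add: algebra_simps)
    moreover have "- (2 * (2 * x + 1)) * (e * (F / (f * f))) = (x + 1) * (- e * ((2 * x + 2) * (2 * x + 1) * F / ((x + 1) * f * ((x + 1) * f))))"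
      if "f \<noteq> 0" "x + 1 \<noteq> 0" for x e F f :: real
      using that by (simp add: divide_simps) (simp add: algebra_simps)
    from this[of "fact k" "real k" "(-1) ^ k" "fact (2 * k)"]
    have "- (2 * (2 * real k + 1)) * ((-1) ^ k * (fact (2 * k) / (fact k * fact k))) = (real k + 1) * (- ((-1) ^ k) * ((2 * real k + 2) * (2 * real k + 1) * fact (2 * k) / ((real k + 1) * fact k * ((real k + 1) * fact k))))"
      by simp
    ultimately show ?thesis unfolding Suc.IH by (simp only: of_nat_Suc power_Suc mult_minus1 add.commute[of 1])
  qed
  finally show ?case by (subst (asm) mult_left_cancel) auto
qed simp

lemma gbinomial_of_int_Ints: "(of_int m :: real) gchoose k \<in> \<int>"
proof (cases "m \<ge> 0")
  case True
  thus ?thesis using binomial_gbinomial[of "nat m" k, where ?'a = real] by (metis Ints_of_nat of_int_of_nat_eq of_nat_nat)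
next
  case False
  have "(of_int m :: real) gchoose k = (-1) ^ k * ((of_nat (nat (int k - m - 1))) gchoose k)"
    using False by (subst gbinomial_negated_upper) simp
  thus ?thesis by (simp flip: binomial_gbinomial)
qed

text \<open>Vandermonde's identity splits \<open>m - 1/2\<close> into \<open>-1/2\<close> and
  \<open>m\<close>. The binomials over \<open>-1/2\<close> are central binomial coefficients divided
  by a power of \<open>-4\<close>, those over \<open>m\<close> are integers.\<close>

lemma four_power_gbinomial_half_Ints:
  fixes m :: int
  shows "4 ^ n * ((of_int m - 1 / 2 :: real) gchoose n) \<in> \<int>"
proof -
  have "4 ^ n * ((of_int m - 1 / 2 :: real) gchoose n) =
      4 ^ n * (\<Sum>k=0..n. ((-1/2) gchoose k) * (of_int m gchoose (n - k)))"
    using gbinomial_Vandermonde[of "-1/2 :: real" "of_int m" n] by simp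
  also have "\<dots> = (\<Sum>k=0..n. (4 ^ k * ((-1/2) gchoose k)) * (4 ^ (n - k) * (of_int m gchoose (n - k))))"
    unfolding sum_distrib_left
  proof (rule sum.cong)
    fix k assume "k \<in> {0..n}"
    hence "(4::real) ^ n = 4 ^ k * 4 ^ (n - k)" by (simp flip: power_add)
    thus "4 ^ n * (((-1/2 :: real) gchoose k) * (of_int m gchoose (n - k))) = (4 ^ k * ((-1/2) gchoose k)) * (4 ^ (n - k) * (of_int m gchoose (n - k)))"
      by simp
  qed simp
  also have "\<dots> \<in> \<int>"
    unfolding four_power_gbinomial_minus_half by (intro Ints_sum Ints_mult Ints_power gbinomial_of_int_Ints) auto
  finally show ?thesis .
qed

text \<open>At \<open>- j\<close> the numerator divided by \<open>n!\<close> is a binomial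
  coefficient with half-integral upper argument; the factor \<open>4 ^ n\<close> clears its
  denominator.\<close>

lemma brick_half:
  "brick n (\<lambda>t. 4 ^ n * (\<Prod>i=1..n. t + of_int c + real i - 1 / 2) / (\<Prod>j\<le>n. t + real j))"
proof -
  define p :: "real poly" where "p = smult (4 ^ n / fact n) (\<Prod>i=1..n. [:of_int c + real i - 1 / 2, 1:])"
  have p: "poly p t = 4 ^ n / fact n * (\<Prod>i=1..n. t + of_int c + real i - 1 / 2)" for t
    unfolding p_def poly_smult poly_prod by (intro arg_cong2[of _ _ _ _ "(*)"] prod.cong) auto
  have "poly p (- real j) = 4 ^ n * ((of_int (c + int n - int j) - 1 / 2) gchoose n)" for j
  proof -
    have "(\<Prod>i=1..n. - real j + of_int c + real i - 1 / 2) = (\<Prod>i<n. of_int (c + int n - int j) - 1 / 2 - real i)"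
      by (rule prod.reindex_bij_witness[of _ "\<lambda>i. n - i" "\<lambda>i. n - i"]) auto
    thus ?thesis unfolding p gbinomial_prod_rev by (simp add: atLeast0LessThan)
  qed
  moreover have "degree p \<le> n"
  proof -
    have "degree (\<Prod>i=1..n. [:of_int c + real i - 1 / 2, 1:]) \<le> (\<Sum>i=1..n. degree [:of_int c + real i - 1 / 2, 1:])"
      using degree_prod_sum_le[of "{1..n}" "\<lambda>i. [:of_int c + real i - 1 / 2, 1:]"] by (simp add: o_def)
    thus ?thesis unfolding p_def by (intro order.trans[OF degree_smult_le]) simp
  qed
  ultimately have "brick n (\<lambda>t. fact n * poly p t / (\<Prod>j\<le>n. t + real j))"
    using four_power_gbinomial_half_Ints[of n] by (intro brick_poly) (simp_all only:)
  thus ?thesis unfolding p by simp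
qed

lemma brick_const: "brick n (\<lambda>t. fact n / (\<Prod>j\<le>n. t + real j))"
  using brick_poly[of 1 n] by simp

text \<open>Uniqueness of partial fractions would make the coefficients symmetric. Averaging a given
  expansion with its reflection avoids a uniqueness proof and costs only a factor \<open>2\<close>
  in the denominators.\<close>

lemma pf_form_symmetrize:
  assumes "pf_form n K f" "\<And>t. (\<forall>j\<le>n. t + real j \<noteq> 0) \<Longrightarrow> f (- real n - t) = (-1) ^ s * f t"
  obtains a where
    "\<And>k j. k \<in> {1..K} \<Longrightarrow> j \<le> n \<Longrightarrow> 2 * real (lcm_upto n) ^ (K - k) * a k j \<in> \<int>"
    "\<And>k j. j \<le> n \<Longrightarrow> a k (n - j) = (-1) ^ (s + k) * a k j"
    "\<And>t. (\<forall>j\<le>n. t + real j \<noteq> 0) \<Longrightarrow> f t = (\<Sum>k=1..K. \<Sum>j\<le>n. a k j / (t + real j) ^ k)"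
proof -
  obtain a where a:
    "\<And>k j. k \<in> {1..K} \<Longrightarrow> j \<le> n \<Longrightarrow> real (lcm_upto n) ^ (K - k) * a k j \<in> \<int>"
    "\<And>t. (\<forall>j\<le>n. t + real j \<noteq> 0) \<Longrightarrow> f t = (\<Sum>k=1..K. \<Sum>j\<le>n. a k j / (t + real j) ^ k)"
    using assms(1) by (elim pf_formE) blast
  define a' where "a' k j = (a k j + (-1) ^ (s + k) * a k (n - j)) / 2" for k j
  show thesis
  proof (rule that[of a'])
    fix k j assume "k \<in> {1..K}" "j \<le> n"
    hence "real (lcm_upto n) ^ (K - k) * a k j + (-1) ^ (s + k) * (real (lcm_upto n) ^ (K - k) * a k (n - j)) \<in> \<int>"
      by (intro Ints_add Ints_mult a Ints_power) auto
    also have "real (lcm_upto n) ^ (K - k) * a k j + (-1) ^ (s + k) * (real (lcm_upto n) ^ (K - k) * a k (n - j)) = 2 * real (lcm_upto n) ^ (K - k) * a' k j"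
      by (simp add: a'_def field_simps)
    finally show "2 * real (lcm_upto n) ^ (K - k) * a' k j \<in> \<int>" .
  next
    fix k j assume "j \<le> n"
    thus "a' k (n - j) = (-1) ^ (s + k) * a' k j"
      by (simp add: a'_def algebra_simps flip: power_mult_distrib mult.assoc)
  next
    fix t :: real assume t: "\<forall>j\<le>n. t + real j \<noteq> 0"
    have t': "\<forall>j\<le>n. (- real n - t) + real j \<noteq> 0"
    proof (intro allI impI)
      fix j assume "j \<le> n"
      have "t + real (n - j) \<noteq> 0" using t[rule_format, of "n - j"] by simp
      thus "(- real n - t) + real j \<noteq> 0" using \<open>j \<le> n\<close> by (auto simp: of_nat_diff)
    qed
    have "f t = (f t + (-1) ^ s * f (- real n - t)) / 2"
      unfolding assms(2)[OF t] by (simp flip: mult.assoc power_mult_distrib)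
    also have "f (- real n - t) = (\<Sum>k=1..K. \<Sum>j\<le>n. a k j / ((- real n - t) + real j) ^ k)"
      by (rule a(2)[OF t'])
    also have "\<dots> = (\<Sum>k=1..K. \<Sum>j\<le>n. (-1) ^ k * a k (n - j) / (t + real j) ^ k)"
    proof (rule sum.cong[OF refl])
      fix k
      have "(\<Sum>j\<le>n. a k j / ((- real n - t) + real j) ^ k) = (\<Sum>j\<le>n. a k (n - j) / ((- real n - t) + real (n - j)) ^ k)"
        by (rule sum.reindex_bij_witness[of _ "\<lambda>j. n - j" "\<lambda>j. n - j"]) auto
      also have "\<dots> = (\<Sum>j\<le>n. (-1) ^ k * a k (n - j) / (t + real j) ^ k)"
      proof (rule sum.cong[OF refl])
        fix j assume "j \<in> {..n}"
        hence "(- real n - t) + real (n - j) = (-1) * (t + real j)" by (simp add: of_nat_diff)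
        hence "((- real n - t) + real (n - j)) ^ k = (-1) ^ k * (t + real j) ^ k" by (simp only: power_mult_distrib)
        moreover have "x / ((-1) ^ k * y) = (-1) ^ k * x / y" for x y :: real by (cases "even k") auto
        ultimately show "a k (n - j) / ((- real n - t) + real (n - j)) ^ k = (-1) ^ k * a k (n - j) / (t + real j) ^ k"
          by simp
      qed
      finally show "(\<Sum>j\<le>n. a k j / ((- real n - t) + real j) ^ k) = (\<Sum>j\<le>n. (-1) ^ k * a k (n - j) / (t + real j) ^ k)" .
    qed
    also have "(f t + (-1) ^ s * (\<Sum>k=1..K. \<Sum>j\<le>n. (-1) ^ k * a k (n - j) / (t + real j) ^ k)) / 2 =
        (\<Sum>k=1..K. \<Sum>j\<le>n. a' k j / (t + real j) ^ k)"
      unfolding a(2)[OF t] a'_def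
      by (simp add: sum_distrib_left sum_divide_distrib sum.distrib[symmetric] power_add mult_ac add_divide_distrib)
    finally show "f t = (\<Sum>k=1..K. \<Sum>j\<le>n. a' k j / (t + real j) ^ k)" .
  qed
qed

subsection \<open>Elementary estimates\<close>

text \<open>For \<open>r = u^2\<close> with \<open>u \<ge> 1\<close> this is the square of
  \<open>2 * ln u \<le> u - 1 / u\<close>; both sides are invariant under
  \<open>r -> 1 / r\<close>.\<close>

lemma ln_squared_le:
  fixes r :: real
  assumes "r > 0"
  shows "(ln r) ^ 2 \<le> r + 1 / r - 2"
proof -
  have main: "(ln r) ^ 2 \<le> r + 1 / r - 2" if "r \<ge> 1" for r :: real
  proof -
    define u where "u = sqrt r"
    have u: "u \<ge> 1" "r = u ^ 2" using that by (auto simp: u_def)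
    have "(\<lambda>x. x - 1 / x - 2 * ln x) 1 \<le> (\<lambda>x. x - 1 / x - 2 * ln x) u"
    proof (rule DERIV_nonneg_imp_nondecreasing[OF u(1)])
      fix x :: real assume x: "1 \<le> x" "x \<le> u"
      have "((\<lambda>x. x - 1 / x - 2 * ln x) has_real_derivative (1 - 1 / x) ^ 2) (at x)"
        using x by (auto intro!: derivative_eq_intros simp: field_simps power2_eq_square)
      thus "\<exists>y. ((\<lambda>x. x - 1 / x - 2 * ln x) has_real_derivative y) (at x) \<and> 0 \<le> y"
        by (intro exI[of _ "(1 - 1 / x) ^ 2"]) auto
    qed
    hence "2 * ln u \<le> u - 1 / u" by simp
    moreover have "0 \<le> 2 * ln u" using u by simp
    ultimately have "(2 * ln u) ^ 2 \<le> (u - 1 / u) ^ 2" by (intro power_mono)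
    also have "(u - 1 / u) ^ 2 = r + 1 / r - 2"
      using u by (simp add: power2_eq_square field_simps)
    also have "2 * ln u = ln r" using u by (simp add: ln_realpow)
    finally show ?thesis .
  qed
  show ?thesis
  proof (cases "r \<ge> 1")
    case False
    hence "1 / r \<ge> 1" using assms by simp
    from main[OF this] show ?thesis using assms by (simp add: ln_div)
  qed (use main in auto)
qed

text \<open>Put \<open>\<rho> m = w (Suc m) / w m = 1 / \<sigma> m\<close>. Summation by parts turns \<open>\<Sum>m. w m * (\<rho> m + 1 / \<rho> m - 2)\<close>, which
  dominates \<open>\<Sum>m. w m * (ln (\<rho> m))^2\<close>, into a sum over the small increments of \<open>\<sigma>\<close>.\<close>
lemma suminf_log_deriv_small:
  fixes w q :: "nat \<Rightarrow> real" and c B \<delta> :: real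
  defines "\<sigma> \<equiv> \<lambda>m. w m / w (Suc m)"
  assumes w: "\<And>m. w m > 0" and sm: "summable w"
    and \<sigma>: "\<And>m. \<sigma> m \<le> B" "\<sigma> 0 \<le> c" "\<And>m. \<sigma> (Suc m) - \<sigma> m \<le> c"
    and q: "\<And>m. \<bar>q m - ln (w (Suc m) / w m)\<bar> \<le> c * (1 + w (Suc m) / w m)"
    and \<delta>: "\<delta> > 0"
  shows "summable (\<lambda>m. w m * q m)"
    and "\<bar>\<Sum>m. w m * q m\<bar> \<le> (\<delta> + c / \<delta> + 2 * c) * suminf w"
proof -
  have \<sigma>pos: "\<sigma> m > 0" for m using w by (simp add: \<sigma>_def)
  have c: "c > 0" using \<sigma>pos[of 0] \<sigma>(2) by simp
  have smS: "summable (\<lambda>m. w (Suc m))" using sm by (simp add: summable_Suc_iff)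
  have sms: "summable (\<lambda>m. w m * \<sigma> m)"
  proof (rule summable_comparison_test)
    show "\<exists>N. \<forall>n\<ge>N. norm (w n * \<sigma> n) \<le> w n * B"
      using w \<sigma>pos \<sigma>(1) by (auto simp: abs_mult less_imp_le intro!: mult_left_mono)
    show "summable (\<lambda>n. w n * B)" using sm by (rule summable_mult2)
  qed
  have smsS: "summable (\<lambda>m. w (Suc m) * \<sigma> (Suc m))" using sms by (simp add: summable_Suc_iff[of "\<lambda>m. w m * \<sigma> m"])
  have wS: "w (Suc m) * \<sigma> m = w m" for m using w[of "Suc m"] by (simp add: \<sigma>_def)
  have Sw: "(\<Sum>m. w (Suc m)) = suminf w - w 0" using suminf_split_head[OF sm] by simp
  \<comment> \<open>Because \<open>w (Suc m) * \<sigma> m = w m\<close>, replacing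
    \<open>\<sigma> (Suc m)\<close> by \<open>\<sigma> m + c\<close> turns the shifted sum into that
    of \<open>w\<close>, with an error of \<open>c\<close> times it. Hence the terms
    \<open>w m * (r + 1 / r - 2)\<close> add up to at most \<open>c * suminf w\<close>.\<close>
  have Sws: "(\<Sum>m. w m * \<sigma> m) \<le> suminf w + c * suminf w"
  proof -
    have "(\<Sum>m. w m * \<sigma> m) = w 0 * \<sigma> 0 + (\<Sum>m. w (Suc m) * \<sigma> (Suc m))"
      using suminf_split_head[OF sms] by simp
    also have "(\<Sum>m. w (Suc m) * \<sigma> (Suc m)) \<le> (\<Sum>m. w m + c * w (Suc m))"
    proof (rule suminf_le)
      fix m
      have "w (Suc m) * \<sigma> (Suc m) \<le> w (Suc m) * (\<sigma> m + c)"
        using \<sigma>(3)[of m] w[of "Suc m"] by (intro mult_left_mono) auto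
      thus "w (Suc m) * \<sigma> (Suc m) \<le> w m + c * w (Suc m)" using wS[of m] by (simp add: algebra_simps)
    qed (intro smsS summable_add sm summable_mult smS)+
    also have "(\<Sum>m. w m + c * w (Suc m)) = suminf w + c * (suminf w - w 0)"
      unfolding Sw[symmetric] by (simp add: suminf_add[symmetric] suminf_mult sm smS summable_mult)
    also have "w 0 * \<sigma> 0 \<le> w 0 * c" using w[of 0] \<sigma>(2) by (intro mult_left_mono) auto
    finally show ?thesis by (simp add: algebra_simps)
  qed
  \<comment> \<open>The majorant comes from
    \<open>\<bar>x\<bar> \<le> \<delta> + x^2 / \<delta>\<close> for
    \<open>x = ln (w (Suc m) / w m)\<close> together with \<open>ln_squared_le\<close>; the last
    summand is the error allowed for \<open>q m\<close>.\<close>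
  define h where "h m = (\<delta> * w m + 1 / \<delta> * (w (Suc m) + w m * \<sigma> m - 2 * w m)) + c * (w m + w (Suc m))" for m
  have h: "\<bar>w m * q m\<bar> \<le> h m" for m
  proof -
    let ?r = "w (Suc m) / w m"
    have r: "?r > 0" using w by simp
    have "2 * \<bar>ln ?r\<bar> * \<delta> \<le> \<delta> ^ 2 + (ln ?r) ^ 2"
      using sum_squares_bound[of "\<bar>ln ?r\<bar>" \<delta>] by simp
    also have "\<dots> \<le> 2 * (\<delta> ^ 2 + (ln ?r) ^ 2)" by simp
    also have "(ln ?r) ^ 2 \<le> ?r + 1 / ?r - 2" by (rule ln_squared_le[OF r])
    finally have "\<bar>ln ?r\<bar> * \<delta> \<le> \<delta> ^ 2 + (?r + 1 / ?r - 2)" by simp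
    hence "\<bar>ln ?r\<bar> \<le> \<delta> + 1 / \<delta> * (?r + 1 / ?r - 2)"
      using \<delta> by (simp add: field_simps power2_eq_square)
    hence "\<bar>q m\<bar> \<le> \<delta> + 1 / \<delta> * (?r + 1 / ?r - 2) + c * (1 + ?r)"
      using q[of m] by linarith
    hence "w m * \<bar>q m\<bar> \<le> w m * (\<delta> + 1 / \<delta> * (?r + 1 / ?r - 2) + c * (1 + ?r))"
      using w[of m] by (intro mult_left_mono) auto
    also have "\<dots> = h m"
    proof -
      have *: "w m * ?r = w (Suc m)" using w[of m] by simp
      have "1 / ?r = \<sigma> m" by (simp add: \<sigma>_def)
      moreover have "w m * (\<delta> + 1 / \<delta> * (r + s - 2) + c * (1 + r)) =
          \<delta> * w m + 1 / \<delta> * (w m * r + w m * s - 2 * w m) + c * (w m + w m * r)" for r s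
        by (simp add: algebra_simps add_divide_distrib)
      ultimately show ?thesis unfolding h_def by (simp only: *)
    qed
    finally show ?thesis using w[of m] by (simp add: abs_mult)
  qed
  have smh: "summable h"
    unfolding h_def by (intro summable_add summable_diff summable_mult sm smS sms)
  have abs: "summable (\<lambda>m. \<bar>w m * q m\<bar>)"
    by (rule summable_comparison_test[OF _ smh]) (use h in auto)
  thus "summable (\<lambda>m. w m * q m)" by (rule summable_rabs_cancel)
  have "\<bar>\<Sum>m. w m * q m\<bar> \<le> (\<Sum>m. \<bar>w m * q m\<bar>)" by (rule summable_rabs[OF abs])
  also have "\<dots> \<le> suminf h" by (rule suminf_le[OF h abs smh])
  also have "suminf h = (\<delta> * suminf w + 1 / \<delta> * ((suminf w - w 0) + (\<Sum>m. w m * \<sigma> m) - 2 * suminf w)) + c * (suminf w + (suminf w - w 0))"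
    unfolding h_def Sw[symmetric]
    by (simp only: suminf_add[symmetric] suminf_diff[symmetric] suminf_mult summable_add summable_diff summable_mult sm smS sms)
  also have "\<dots> \<le> (\<delta> * suminf w + 1 / \<delta> * (c * suminf w)) + c * (suminf w + suminf w)"
    using Sws w[of 0] \<delta> c by (intro add_mono mult_left_mono order.refl) auto
  finally show "\<bar>\<Sum>m. w m * q m\<bar> \<le> (\<delta> + c / \<delta> + 2 * c) * suminf w"
    by (simp add: algebra_simps)
qed

lemma ln_ratio_Suc_bounds:
  fixes x :: real
  assumes "x > 0"
  shows "ln ((x + 1) / x) \<le> 1 / x" "1 / (x + 1) \<le> ln ((x + 1) / x)"
proof -
  have "ln ((x + 1) / x) \<le> (x + 1) / x - 1" using assms by (intro ln_le_minus_one) auto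
  also have "\<dots> = 1 / x" using assms by (simp add: field_simps)
  finally show "ln ((x + 1) / x) \<le> 1 / x" .
  have "ln (x / (x + 1)) \<le> x / (x + 1) - 1" using assms by (intro ln_le_minus_one) auto
  also have "\<dots> = - (1 / (x + 1))" using assms by (simp add: field_simps)
  finally show "1 / (x + 1) \<le> ln ((x + 1) / x)" using assms by (simp add: ln_div)
qed

lemma sum_inverse_bounds:
  fixes x :: real
  assumes "x > 0"
  shows "ln ((x + real N + 1) / x) \<le> (\<Sum>i\<le>N. 1 / (x + real i))"
    and "(\<Sum>i\<le>N. 1 / (x + real i)) \<le> ln ((x + real N) / x) + 1 / x"
proof (induction N)
  case 0
  case 1
  show ?case using ln_ratio_Suc_bounds(1)[OF assms] by simp
  case 2
  show ?case using assms by simp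
next
  case (Suc N)
  have p: "x + real N > 0" "x + real N + 1 > 0" using assms by auto
  case 1
  show ?case using Suc(1) ln_ratio_Suc_bounds(1)[OF p(2)] assms p by (simp add: ln_div add_ac)
  case 2
  show ?case using Suc(2) ln_ratio_Suc_bounds(2)[OF p(1)] assms p by (simp add: ln_div add_ac)
qed

text \<open>The induction step is the inequality
  \<open>(1 + 1 / n)^(n + 1) \<ge> exp 1\<close>.\<close>

lemma fact_le_Stirling:
  assumes "n > 0"
  shows "fact n \<le> exp 1 * real n * (real n / exp 1) ^ n"
  using assms
proof (induction n rule: nat_induct_non_zero)
  case 1
  show ?case by simp
next
  case (Suc n)
  have n: "real n > 0" using Suc by simp
  have "exp 1 * real n ^ Suc n \<le> real (Suc n) ^ Suc n"
  proof -
    have "1 \<le> real (Suc n) * ln ((real n + 1) / real n)"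
      using ln_ratio_Suc_bounds(2)[OF n] n by (simp add: field_simps)
    hence "exp 1 \<le> exp (real (Suc n) * ln ((real n + 1) / real n))" by simp
    also have "\<dots> = ((real n + 1) / real n) ^ Suc n"
      using n by (simp only: exp_of_nat_mult) simp
    finally show ?thesis using n by (simp add: power_divide field_simps)
  qed
  hence *: "exp 1 * real n * real n ^ n \<le> real (Suc n) ^ Suc n" by (simp add: mult_ac)
  have "fact (Suc n) = real (Suc n) * fact n" by simp
  also have "\<dots> \<le> real (Suc n) * (exp 1 * real n * (real n / exp 1) ^ n)"
    using Suc by (intro mult_left_mono) auto
  also have "\<dots> = real (Suc n) * (exp 1 * real n * real n ^ n) / exp 1 ^ n"
    by (simp add: power_divide)
  also have "\<dots> \<le> real (Suc n) * real (Suc n) ^ Suc n / exp 1 ^ n"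
    using * by (intro divide_right_mono mult_left_mono) auto
  also have "\<dots> = exp 1 * real (Suc n) * (real (Suc n) / exp 1) ^ Suc n"
    by (simp add: power_divide)
  finally show ?case .
qed

lemma exp_1_ge: "exp 1 \<ge> (27 / 10 :: real)"
proof -
  \<comment> \<open>These five terms add up to \<open>65 / 24\<close>.\<close>
  have "(\<Sum>k<5. 1 / fact k :: real) \<le> (\<Sum>k. 1 / fact k)"
    using exp_converges[of "1::real"] by (intro sum_le_suminf) (auto simp: sums_iff divide_inverse)
  also have "\<dots> = exp 1" using exp_converges[of "1::real"] by (simp add: sums_iff divide_inverse)
  finally show ?thesis by (simp add: numeral_eq_Suc fact_numeral)
qed

lemma fact_div_power_le:
  assumes "n > 0"
  shows "fact n / real n ^ n \<le> 3 * real n * (10 / 27) ^ n"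
proof -
  have "fact n / real n ^ n \<le> exp 1 * real n * (real n / exp 1) ^ n / real n ^ n"
    using fact_le_Stirling[OF assms] by (intro divide_right_mono) auto
  also have "\<dots> = exp 1 * real n * (1 / exp 1) ^ n"
    using assms by (simp add: power_divide)
  also have "\<dots> \<le> 3 * real n * (10 / 27) ^ n"
  proof (intro mult_mono power_mono)
    show "1 / exp 1 \<le> (10 / 27 :: real)" using exp_1_ge by (simp add: field_simps)
  qed (use exp_le in auto)
  finally show ?thesis .
qed

text \<open>Consecutive coefficients have a ratio of at least \<open>27/4 * n / (n + 1)\<close>, and
  the factors \<open>n / (n + 1)\<close> telescope to \<open>1 / n\<close>. The constant
  \<open>4/9\<close> gives equality at \<open>n = 1\<close>.\<close>

lemma central_trinomial_ge:
  assumes "n > 0"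
  shows "(27 / 4) ^ n * 4 / (9 * real n) \<le> real ((3 * n) choose n)"
  using assms
proof (induction n rule: nat_induct_non_zero)
  case 1
  show ?case by simp
next
  case (Suc n)
  define x where "x = real n"
  have x: "x \<ge> 1" using Suc by (simp add: x_def)
  define C where "C n = real ((3 * n) choose n)" for n
  have C: "C n = fact (3 * n) / (fact n * fact (2 * n))" for n
    unfolding C_def by (subst binomial_fact) auto
  have f3: "fact (3 * Suc n) = (3 * x + 3) * (3 * x + 2) * (3 * x + 1) * (fact (3 * n) :: real)"
    by (simp add: x_def numeral_3_eq_3 algebra_simps)
  have f2: "fact (2 * Suc n) = (2 * x + 2) * (2 * x + 1) * (fact (2 * n) :: real)"
    by (simp add: x_def algebra_simps)
  have f1: "fact (Suc n) = (x + 1) * (fact n :: real)" by (simp add: x_def algebra_simps)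
  have "C (Suc n) * ((x + 1) * ((2 * x + 2) * (2 * x + 1))) = C n * ((3 * x + 3) * (3 * x + 2) * (3 * x + 1))"
  proof -
    have "(A * F3) / (B * F1 * (D * F2)) * (B * D) = F3 / (F1 * F2) * A"
      if "B > 0" "D > 0" "F1 > 0" "F2 > 0" for A B D F1 F2 F3 :: real
      using that by (simp add: field_simps)
    thus ?thesis unfolding C f1 f2 f3 using x by simp
  qed
  hence "(x + 1) * (C (Suc n) * (2 * (x + 1) * (2 * x + 1))) = (x + 1) * (C n * (3 * (3 * x + 2) * (3 * x + 1)))"
    by (simp add: algebra_simps)
  hence "C (Suc n) * (2 * (x + 1) * (2 * x + 1)) = C n * (3 * (3 * x + 2) * (3 * x + 1))"
    using x by (subst (asm) mult_left_cancel) auto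
  hence rec: "C (Suc n) = C n * (3 * (3 * x + 2) * (3 * x + 1) / (2 * (x + 1) * (2 * x + 1)))"
    using x by (simp add: eq_divide_eq)
  have "27 / 4 * (x / (x + 1)) \<le> 3 * (3 * x + 2) * (3 * x + 1) / (2 * (x + 1) * (2 * x + 1))"
    using x by (simp add: divide_simps) (simp add: algebra_simps)
  hence "(27 / 4) ^ n * 4 / (9 * x) * (27 / 4 * (x / (x + 1))) \<le> C (Suc n)"
    unfolding rec using Suc.IH x by (intro mult_mono) (auto simp: C_def x_def)
  also have "(27 / 4) ^ n * 4 / (9 * x) * (27 / 4 * (x / (x + 1))) = (27 / 4) ^ Suc n * 4 / (9 * real (Suc n))"
  proof -
    have "p * 4 / (9 * x) * (27 / 4 * (x / (x + 1))) = 27 / 4 * p * 4 / (9 * (x + 1))" for p :: real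
      using x by (simp add: field_simps)
    thus ?thesis by (simp add: x_def add.commute)
  qed
  finally show ?case by (simp only: C_def)
qed

text \<open>With \<open>b = (a / n)^2\<close> this is \<open>(b - 1) (b - 4) \<le> C b^3\<close>; the optimal \<open>C = 0.05496...\<close> is attained at
  \<open>b = 5 + sqrt 13\<close>.\<close>
lemma block_factor_le:
  fixes a n :: real
  assumes "a \<ge> 2 * n" "n > 0"
  shows "(a - 2 * n) * (a - n) * a * (a + n) * (a + 2 * n) \<le> 11 / 200 * a ^ 7 / n ^ 2"
proof -
  define b where "b = (a / n) ^ 2"
  have "a / n \<ge> 2" using assms by (simp add: field_simps)
  hence "(a / n) ^ 2 \<ge> 2 ^ 2" by (intro power_mono) auto
  hence b: "b \<ge> 4" by (simp add: b_def)
  \<comment> \<open>\<open>43/5\<close> is a rational approximation of the critical point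
    \<open>5 + sqrt 13\<close>; what remains besides the square term is linear and positive for
    \<open>b \<ge> 4\<close>.\<close>
  have "11 / 200 * b ^ 3 - (b - 1) * (b - 4) = 11 / 200 * (b - 43 / 5) ^ 2 * (b - 54 / 55) + (17 / 5000 * b - 77 / 12500)"
    by (simp add: power2_eq_square power3_eq_cube field_simps)
  also have "\<dots> \<ge> 0" using b by (intro add_nonneg_nonneg mult_nonneg_nonneg) auto
  finally have *: "(b - 1) * (b - 4) \<le> 11 / 200 * b ^ 3" by simp
  have "(a - 2 * n) * (a - n) * a * (a + n) * (a + 2 * n) = a * n ^ 4 * ((b - 1) * (b - 4))"
    using assms by (simp add: b_def power_divide field_simps) (simp add: eval_nat_numeral algebra_simps)
  also have "\<dots> \<le> a * n ^ 4 * (11 / 200 * b ^ 3)"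
    using * assms by (intro mult_left_mono) auto
  also have "\<dots> = 11 / 200 * a ^ 7 / n ^ 2"
    using assms by (simp add: b_def power_divide field_simps) (simp add: eval_nat_numeral algebra_simps)
  finally show ?thesis .
qed

subsection \<open>The rational function\<close>

text \<open>The ten factors \<open>4^n \<Prod>(t + c + i - 1/2)\<close> contained in the squared numerator are each paired with one of the
  \<^term>\<open>s\<close> factors \<open>\<Prod>(t + j)\<close> of the denominator, which leaves only integral simple poles.\<close>
definition Rnum :: "nat \<Rightarrow> real \<Rightarrow> real" where
  "Rnum n t = (\<Prod>i=1..5*n. t - 2 * real n - 1 / 2 + real i)"

definition Rden :: "nat \<Rightarrow> real \<Rightarrow> real" where
  "Rden n t = (\<Prod>j\<le>n. t + real j)"

definition Rfun :: "nat \<Rightarrow> nat \<Rightarrow> real \<Rightarrow> real" where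
  "Rfun s n t = (4 ^ (5 * n) * Rnum n t / fact n ^ 5) ^ 2 * (fact n / Rden n t) ^ s"

lemma prod_blocks:
  fixes f :: "nat \<Rightarrow> 'a :: comm_monoid_mult"
  shows "(\<Prod>i=1..k*n. f i) = (\<Prod>b<k. \<Prod>i=1..n. f (b * n + i))"
proof -
  have "(\<Prod>i=1..k*n. f i) = (\<Prod>i<k*n. f (Suc i))"
    by (rule prod.reindex_bij_witness[of _ Suc "\<lambda>i. i - 1"]) auto
  also have "\<dots> = (\<Prod>b<k. \<Prod>i\<in>{b*n..<b*n+n}. f (Suc i))"
    by (rule prod.nat_group[symmetric])
  also have "\<dots> = (\<Prod>b<k. \<Prod>i=1..n. f (b * n + i))"
  proof (rule prod.cong[OF refl])
    fix b
    show "(\<Prod>i\<in>{b*n..<b*n+n}. f (Suc i)) = (\<Prod>i=1..n. f (b * n + i))"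
      by (rule prod.reindex_bij_witness[of _ "\<lambda>i. b * n + i - 1" "\<lambda>i. Suc i - b * n"]) auto
  qed
  finally show ?thesis .
qed

lemma pf_form_Rfun:
  assumes "s \<ge> 10"
  shows "pf_form n s (Rfun s n)"
proof -
  define H where "H b t = 4 ^ n * (\<Prod>i=1..n. t + of_int (int (b * n) - 2 * int n) + real i - 1 / 2) / Rden n t" for b :: nat and t :: real
  \<comment> \<open>\<open>x div 2\<close> runs twice through the five blocks, which accounts for
    the square of the numerator; the remaining factors have numerator \<open>n!\<close>.\<close>
  define g where "g x = (if x < 10 then H (x div 2) else (\<lambda>t. fact n / Rden n t))" for x :: nat
  have "brick n (g x)" for x
    using brick_half[of n "int ((x div 2) * n) - 2 * int n"] brick_const[of n]
    unfolding g_def H_def Rden_def by simp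
  hence "pf_form n (card {..<s}) (\<lambda>t. \<Prod>x<s. g x t)"
    using assms by (intro pf_form_brick_prod) (auto simp: lessThan_empty_iff)
  moreover have "(\<Prod>x<s. g x t) = Rfun s n t" for t
  proof -
    have "{..<s} = {..<10} \<union> {10..<s}" using assms by auto
    hence "(\<Prod>x<s. g x t) = (\<Prod>x\<in>{..<10} \<union> {10..<s}. g x t)" by simp
    also have "\<dots> = (\<Prod>x<10. g x t) * (\<Prod>x=10..<s. g x t)"
      by (rule prod.union_disjoint) auto
    also have "(\<Prod>x<10. g x t) = (\<Prod>x<10. H (x div 2) t)"
      by (intro prod.cong) (auto simp: g_def)
    also have "\<dots> = (\<Prod>b<5. H b t) ^ 2"
    proof -
      have "(\<Prod>x<10. H (x div 2) t) = (\<Prod>b<5. \<Prod>x\<in>{b*2..<b*2+2}. H (x div 2) t)"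
        using prod.nat_group[of "\<lambda>x. H (x div 2) t" 2 5] by simp
      also have "\<dots> = (\<Prod>b<5. H b t * H b t)"
      proof (rule prod.cong[OF refl])
        fix b :: nat
        have "{b*2..<b*2+2} = {b * 2, b * 2 + 1}" by auto
        thus "(\<Prod>x\<in>{b*2..<b*2+2}. H (x div 2) t) = H b t * H b t" by simp
      qed
      finally show ?thesis by (simp add: prod.distrib power2_eq_square)
    qed
    also have "(\<Prod>x=10..<s. g x t) = (fact n / Rden n t) ^ (s - 10)"
      by (simp add: g_def)
    also have "(\<Prod>b<5. H b t) = (4 ^ n) ^ 5 * (\<Prod>b<5. \<Prod>i=1..n. t + of_int (int (b * n) - 2 * int n) + real i - 1 / 2) / Rden n t ^ 5"
      unfolding H_def prod_dividef prod.distrib by simp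
    also have "(\<Prod>b<5. \<Prod>i=1..n. t + of_int (int (b * n) - 2 * int n) + real i - 1 / 2) = Rnum n t"
      unfolding Rnum_def prod_blocks by (intro prod.cong refl) simp
    also have "((4 ^ n) ^ 5 * Rnum n t / Rden n t ^ 5) ^ 2 * (fact n / Rden n t) ^ (s - 10) = Rfun s n t"
    proof -
      have "s = 10 + (s - 10)" using assms by simp
      hence "(fact n / Rden n t) ^ s = (fact n / Rden n t) ^ 10 * (fact n / Rden n t) ^ (s - 10)"
        by (metis power_add)
      moreover have "(4 ^ (5 * n) * Rnum n t / fact n ^ 5) ^ 2 * (fact n / Rden n t) ^ 10 = (4 ^ (5 * n) * Rnum n t / Rden n t ^ 5) ^ 2"
        by (simp add: power_divide field_simps flip: power_mult)
      moreover have "((4::real) ^ n) ^ 5 = 4 ^ (5 * n)" by (simp add: mult.commute flip: power_mult)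
      ultimately show ?thesis unfolding Rfun_def by (simp only: mult.assoc[symmetric])
    qed
    finally show ?thesis .
  qed
  ultimately show ?thesis by simp
qed

lemma Rnum_reflect: "Rnum n (- real n - t) = (-1) ^ (5 * n) * Rnum n t"
proof -
  have "Rnum n (- real n - t) = (\<Prod>i=1..5*n. (-1) * (t - 2 * real n - 1 / 2 + real i))"
    unfolding Rnum_def by (rule prod.reindex_bij_witness[of _ "\<lambda>i. Suc (5 * n) - i" "\<lambda>i. Suc (5 * n) - i"]) auto
  thus ?thesis by (simp only: prod.distrib Rnum_def) simp
qed

lemma Rden_reflect: "Rden n (- real n - t) = (-1) ^ Suc n * Rden n t"
proof -
  have "Rden n (- real n - t) = (\<Prod>i\<le>n. (-1) * (t + real i))"
    unfolding Rden_def by (rule prod.reindex_bij_witness[of _ "\<lambda>i. n - i" "\<lambda>i. n - i"]) auto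
  thus ?thesis by (simp only: prod.distrib Rden_def) simp
qed

lemma Rfun_reflect:
  assumes "even n"
  shows "Rfun s n (- real n - t) = (-1) ^ s * Rfun s n t"
proof -
  have "fact n / (- Rden n t) = (-1) * (fact n / Rden n t)" by simp
  hence "(fact n / (- Rden n t)) ^ s = (-1) ^ s * (fact n / Rden n t) ^ s"
    by (simp only: power_mult_distrib)
  thus ?thesis
    unfolding Rfun_def Rnum_reflect Rden_reflect using assms by simp
qed

lemma Rnum_half: "Rnum n (2 * real n + real m + 1 / 2) = (\<Prod>i=1..5*n. real m + real i)"
  unfolding Rnum_def by (intro prod.cong) auto

lemma Rnum_pos: "Rnum n (2 * real n + real m + 1 / 2) > 0"
  unfolding Rnum_half by (intro prod_pos) auto

lemma Rden_pos: "t > 0 \<Longrightarrow> Rden n t > 0"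
  unfolding Rden_def by (intro prod_pos) auto

lemma Rfun_pos: "Rfun s n (2 * real n + real m + 1 / 2) > 0"
  unfolding Rfun_def by (intro mult_pos_pos zero_less_power divide_pos_pos Rnum_pos Rden_pos) auto

lemma Rden_shift: "Rden n (t + 1) * t = Rden n t * (t + real n + 1)"
proof (induction n)
  case (Suc n)
  have "Rden (Suc n) (t + 1) * t = (Rden n (t + 1) * t) * (t + real (Suc n) + 1)"
    by (simp add: Rden_def algebra_simps)
  also have "\<dots> = (Rden n t * (t + real (Suc n))) * (t + real (Suc n) + 1)"
    unfolding Suc.IH by (simp add: algebra_simps)
  finally show ?case by (simp add: Rden_def)
qed (simp add: Rden_def algebra_simps)

lemma Rnum_shift:
  "Rnum n (2 * real n + real (Suc m) + 1 / 2) * (real m + 1) = Rnum n (2 * real n + real m + 1 / 2) * (real m + 5 * real n + 1)"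
proof -
  have "(\<Prod>i=1..N. real (Suc m) + real i) * (real m + 1) = (\<Prod>i=1..N. real m + real i) * (real m + real N + 1)" for N
    by (induction N) (auto simp: algebra_simps)
  from this[of "5 * n"] show ?thesis unfolding Rnum_half by simp
qed

lemma Rfun_ratio:
  fixes n m s :: nat
  defines "t \<equiv> 2 * real n + real m + 1 / 2"
  shows "Rfun s n (2 * real n + real (Suc m) + 1 / 2) =
    Rfun s n t * (((real m + 5 * real n + 1) / (real m + 1)) ^ 2 * (t / (t + real n + 1)) ^ s)"
proof -
  have t: "t > 0" by (simp add: t_def add_nonneg_pos)
  have t1: "2 * real n + real (Suc m) + 1 / 2 = t + 1" by (simp add: t_def)
  have N: "Rnum n (t + 1) = Rnum n t * ((real m + 5 * real n + 1) / (real m + 1))"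
    using Rnum_shift[of n m] unfolding t1 t_def[symmetric] by (simp add: field_simps)
  have D: "Rden n (t + 1) = Rden n t * (t + real n + 1) / t"
    using Rden_shift[of n t] t by (simp add: field_simps)
  have D': "fact n / Rden n (t + 1) = fact n / Rden n t * (t / (t + real n + 1))"
    unfolding D by simp
  show ?thesis unfolding t1 Rfun_def N D' power_mult_distrib power_divide by (simp add: mult_ac)
qed

section \<open>The derivative of the rational function\<close>

lemma DERIV_prod_linear:
  fixes c :: "'b \<Rightarrow> real"
  assumes "finite A" "\<And>i. i \<in> A \<Longrightarrow> t + c i \<noteq> 0"
  shows "((\<lambda>t. \<Prod>i\<in>A. t + c i) has_real_derivative (\<Prod>i\<in>A. t + c i) * (\<Sum>i\<in>A. 1 / (t + c i))) (at t)"
  using assms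
proof (induction A rule: finite_induct)
  case (insert x A)
  have "((\<lambda>t. (t + c x) * (\<Prod>i\<in>A. t + c i)) has_real_derivative
     1 * (\<Prod>i\<in>A. t + c i) + (\<Prod>i\<in>A. t + c i) * (\<Sum>i\<in>A. 1 / (t + c i)) * (t + c x)) (at t)"
    by (intro DERIV_mult insert.IH insert.prems) (auto intro!: derivative_eq_intros)
  also have "1 * (\<Prod>i\<in>A. t + c i) + (\<Prod>i\<in>A. t + c i) * (\<Sum>i\<in>A. 1 / (t + c i)) * (t + c x) =
     (t + c x) * (\<Prod>i\<in>A. t + c i) * (1 / (t + c x) + (\<Sum>i\<in>A. 1 / (t + c i)))"
    using insert.prems[of x] by (simp add: field_simps)
  finally show ?case using insert by simp
qed simp

lemma differentiable_prod_linear: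
  fixes c :: "'b \<Rightarrow> real"
  assumes "finite A"
  shows "(\<lambda>t. \<Prod>i\<in>A. t + c i) differentiable (at t)"
  using assms by (induction A rule: finite_induct) (auto intro!: differentiable_mult differentiable_add)

text \<open>The logarithmic derivative of \<open>Rfun s n\<close> at
  \<open>2 * n + m + 1/2\<close>.\<close>

definition Rlog :: "nat \<Rightarrow> nat \<Rightarrow> nat \<Rightarrow> real" where
  "Rlog s n m = 2 * (\<Sum>i=1..5*n. 1 / (real m + real i)) - real s * (\<Sum>j\<le>n. 1 / (2 * real n + real m + 1 / 2 + real j))"

lemma DERIV_power2_mult_power:
  fixes u v :: "real \<Rightarrow> real"
  assumes "(u has_real_derivative U) (at t)" "(v has_real_derivative V) (at t)"
  shows "((\<lambda>t. u t ^ 2 * v t ^ s) has_real_derivative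
     u t ^ 2 * (real s * (v t ^ (s - 1) * V)) + 2 * (u t * U) * v t ^ s) (at t)"
  by (auto intro!: derivative_eq_intros assms simp: algebra_simps)

lemma DERIV_Rfun:
  fixes n m s :: nat
  defines "t \<equiv> 2 * real n + real m + 1 / 2"
  assumes "s > 0"
  shows "(Rfun s n has_real_derivative Rfun s n t * Rlog s n m) (at t)"
proof -
  have t: "t > 0" by (simp add: t_def add_nonneg_pos)
  have "((\<lambda>t. \<Prod>i\<in>{1..5*n}. t + (real i - 2 * real n - 1 / 2)) has_real_derivative
     (\<Prod>i\<in>{1..5*n}. t + (real i - 2 * real n - 1 / 2)) * (\<Sum>i\<in>{1..5*n}. 1 / (t + (real i - 2 * real n - 1 / 2)))) (at t)"
    by (intro DERIV_prod_linear) (auto simp: t_def)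
  also have "(\<lambda>t. \<Prod>i\<in>{1..5*n}. t + (real i - 2 * real n - 1 / 2)) = Rnum n"
    unfolding Rnum_def by (intro ext prod.cong) auto
  also have "(\<Sum>i\<in>{1..5*n}. 1 / (t + (real i - 2 * real n - 1 / 2))) = (\<Sum>i=1..5*n. 1 / (real m + real i))"
    by (intro sum.cong) (auto simp: t_def)
  finally have N: "(Rnum n has_real_derivative Rnum n t * (\<Sum>i=1..5*n. 1 / (real m + real i))) (at t)" .
  have D: "(Rden n has_real_derivative Rden n t * (\<Sum>j\<le>n. 1 / (t + real j))) (at t)"
    unfolding Rden_def[abs_def] using t by (intro DERIV_prod_linear) auto
  have nz: "Rden n t \<noteq> 0" using Rden_pos[OF t, of n] by simp
  define a where "a = (4 ^ (5 * n) / fact n ^ 5 :: real)"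
  define S where "S = (\<Sum>i=1..5*n. 1 / (real m + real i))"
  define T where "T = (\<Sum>j\<le>n. 1 / (t + real j))"
  have u: "((\<lambda>t. a * Rnum n t) has_real_derivative (a * Rnum n t) * S) (at t)"
    using DERIV_cmult[OF N, of a] by (simp add: S_def mult.assoc)
  have "fact n * (- (Rden n t * T * inverse (Rden n t ^ Suc (Suc 0)))) = (fact n / Rden n t) * (- T)"
    using nz by (simp add: field_simps)
  with DERIV_cmult[OF DERIV_inverse_fun[OF D[folded T_def] nz], of "fact n"]
  have v: "((\<lambda>t. fact n / Rden n t) has_real_derivative (fact n / Rden n t) * (- T)) (at t)"
    by (simp only: divide_inverse)
  have "((\<lambda>t. (a * Rnum n t) ^ 2 * (fact n / Rden n t) ^ s) has_real_derivative
      (a * Rnum n t) ^ 2 * (real s * ((fact n / Rden n t) ^ (s - 1) * ((fact n / Rden n t) * (- T)))) +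
      2 * (a * Rnum n t * (a * Rnum n t * S)) * (fact n / Rden n t) ^ s) (at t)"
    by (rule DERIV_power2_mult_power[OF u v])
  also have "(a * Rnum n t) ^ 2 * (real s * ((fact n / Rden n t) ^ (s - 1) * ((fact n / Rden n t) * (- T)))) +
      2 * (a * Rnum n t * (a * Rnum n t * S)) * (fact n / Rden n t) ^ s
     = (a * Rnum n t) ^ 2 * (fact n / Rden n t) ^ s * (2 * S - real s * T)"
  proof -
    have pw: "(fact n / Rden n t) ^ s = (fact n / Rden n t) ^ (s - 1) * (fact n / Rden n t)"
      using assms by (cases s) auto
    have "x ^ 2 * (r * (Y * (y * (- T)))) + 2 * (x * (x * S)) * Z = x ^ 2 * Z * (2 * S - r * T)"
      if "Z = Y * y" for x y Y Z r :: real
      unfolding that by (simp add: power2_eq_square algebra_simps)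
    from this[OF pw] show ?thesis .
  qed
  also have "(\<lambda>t. (a * Rnum n t) ^ 2 * (fact n / Rden n t) ^ s) = Rfun s n"
    by (intro ext) (simp add: Rfun_def a_def)
  also have "2 * S - real s * T = Rlog s n m" by (simp add: Rlog_def S_def T_def t_def)
  finally show ?thesis .
qed

lemma Rfun_zero:
  assumes "i \<in> {1..5*n}" "t = 2 * real n + 1 / 2 - real i" "Rden n t \<noteq> 0"
  shows "Rfun s n t = 0" "(Rfun s n has_real_derivative 0) (at t)"
proof -
  have z: "Rnum n t = 0"
    unfolding Rnum_def using assms(1,2) by (intro prod_zero) auto
  thus "Rfun s n t = 0" by (simp add: Rfun_def)
  have "Rnum n differentiable (at t)" "Rden n differentiable (at t)"
    using differentiable_prod_linear[of "{1..5*n}" "\<lambda>i. - 2 * real n - 1 / 2 + real i" t]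
      differentiable_prod_linear[of "{..n}" real t]
    unfolding Rnum_def[abs_def] Rden_def[abs_def] by (simp_all add: algebra_simps)
  then obtain N D where N: "(Rnum n has_real_derivative N) (at t)" and D: "(Rden n has_real_derivative D) (at t)"
    by (auto simp: real_differentiable_def)
  have u: "((\<lambda>t. 4 ^ (5 * n) / fact n ^ 5 * Rnum n t) has_real_derivative 4 ^ (5 * n) / fact n ^ 5 * N) (at t)"
    by (rule DERIV_cmult[OF N])
  have v: "((\<lambda>t. fact n * inverse (Rden n t)) has_real_derivative fact n * (- (D * inverse (Rden n t ^ Suc (Suc 0))))) (at t)"
    by (rule DERIV_cmult[OF DERIV_inverse_fun[OF D assms(3)], THEN DERIV_cong]) (simp add: power2_eq_square)
  have "((\<lambda>t. (4 ^ (5 * n) / fact n ^ 5 * Rnum n t) ^ 2 * (fact n * inverse (Rden n t)) ^ s) has_real_derivative 0) (at t)"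
    using DERIV_power2_mult_power[OF u v, of s] by (simp add: z)
  also have "(\<lambda>t. (4 ^ (5 * n) / fact n ^ 5 * Rnum n t) ^ 2 * (fact n * inverse (Rden n t)) ^ s) = Rfun s n"
    by (intro ext) (simp add: Rfun_def divide_inverse mult_ac)
  finally show "(Rfun s n has_real_derivative 0) (at t)" .
qed

section \<open>Ratios of consecutive terms and the size of the two sums\<close>

abbreviation Rterm :: "nat \<Rightarrow> nat \<Rightarrow> nat \<Rightarrow> real" where
  "Rterm s n m \<equiv> Rfun s n (2 * real n + real m + 1 / 2)"

lemma Rterm_Suc_div:
  "Rterm s n (Suc m) / Rterm s n m = ((real m + 5 * real n + 1) / (real m + 1)) ^ 2 *
     ((2 * real n + real m + 1 / 2) / (2 * real n + real m + 1 / 2 + real n + 1)) ^ s"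
  unfolding Rfun_ratio[of s n m] using Rfun_pos[of s n m] by simp

lemma Rterm_div_Suc:
  "Rterm s n m / Rterm s n (Suc m) = ((real m + 1) / (real m + 5 * real n + 1)) ^ 2 *
     (1 + (real n + 1) / (2 * real n + real m + 1 / 2)) ^ s"
proof -
  define t where "t = 2 * real n + real m + 1 / 2"
  have "t > 0" by (simp add: t_def add_nonneg_pos)
  hence "(t + real n + 1) / t = 1 + (real n + 1) / t" by (simp add: field_simps)
  hence e: "t / (t + real n + 1) = 1 / (1 + (real n + 1) / t)" by (metis inverse_divide inverse_eq_divide)
  have "Rterm s n m / Rterm s n (Suc m) = 1 / (Rterm s n (Suc m) / Rterm s n m)" by simp
  also have "\<dots> = ((real m + 1) / (real m + 5 * real n + 1)) ^ 2 * (1 + (real n + 1) / t) ^ s"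
    unfolding Rterm_Suc_div unfolding t_def[symmetric] e by (simp add: power_divide)
  finally show ?thesis by (simp only: t_def)
qed

text \<open>Harmonic sums are compared with logarithms, with an error of at most
  \<open>2 / (m + 1) + s / t\<close>. For small \<open>m\<close> the first summand is not of order
  \<open>1 / n\<close>, but there the ratio of consecutive terms is of order
  \<open>(n / (m + 1))^2\<close>; this is why the bound contains that ratio.\<close>

lemma Rlog_bound:
  assumes "n \<ge> 1"
  shows "\<bar>Rlog s n m - ln (Rterm s n (Suc m) / Rterm s n m)\<bar> \<le>
     (2 ^ s + real s) / real n * (1 + Rterm s n (Suc m) / Rterm s n m)"
proof -
  define t where "t = 2 * real n + real m + 1 / 2"
  define \<alpha> where "\<alpha> = (real m + 5 * real n + 1) / (real m + 1)"
  define \<beta> where "\<beta> = (t + real n + 1) / t"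
  define \<rho> where "\<rho> = Rterm s n (Suc m) / Rterm s n m"
  define A where "A = (\<Sum>i=1..5*n. 1 / (real m + real i))"
  define B where "B = (\<Sum>j\<le>n. 1 / (t + real j))"
  have n: "real n \<ge> 1" using assms by simp
  have t: "t > 0" "t \<ge> n" "t + real n + 1 \<le> 2 * t" using n by (auto simp: t_def)
  have \<alpha>: "\<alpha> > 0" by (auto simp: \<alpha>_def intro!: divide_pos_pos)
  have \<beta>: "\<beta> > 0" "1 / \<beta> \<ge> 1 / 2" using t by (auto simp: \<beta>_def field_simps)
  have \<rho>: "\<rho> = \<alpha> ^ 2 * (1 / \<beta>) ^ s"
    unfolding \<rho>_def Rterm_Suc_div \<alpha>_def \<beta>_def t_def by simp
  have \<rho>0: "\<rho> > 0" unfolding \<rho>_def by (intro divide_pos_pos Rfun_pos)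
  have ln\<rho>: "ln \<rho> = 2 * ln \<alpha> - real s * ln \<beta>"
    unfolding \<rho> using \<alpha> \<beta> by (simp add: ln_mult ln_realpow ln_div)
  have A: "A = (\<Sum>i\<le>5*n-1. 1 / ((real m + 1) + real i))"
    unfolding A_def using assms by (intro sum.reindex_bij_witness[of _ Suc "\<lambda>i. i - 1"]) (auto simp: of_nat_diff)
  have r: "real (5 * n - 1) = 5 * real n - 1" using assms by (simp add: of_nat_diff)
  have A1: "ln \<alpha> \<le> A"
    using sum_inverse_bounds(1)[of "real m + 1" "5 * n - 1"] unfolding A r \<alpha>_def by (simp add: add_ac)
  have "A \<le> ln ((real m + 1 + (5 * real n - 1)) / (real m + 1)) + 1 / (real m + 1)"
    using sum_inverse_bounds(2)[of "real m + 1" "5 * n - 1"] unfolding A r by simp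
  also have "ln ((real m + 1 + (5 * real n - 1)) / (real m + 1)) \<le> ln \<alpha>"
    unfolding \<alpha>_def using n by (subst ln_le_cancel_iff) (auto simp: field_simps intro!: divide_pos_pos)
  finally have A2: "A \<le> ln \<alpha> + 1 / (real m + 1)" by simp
  have B1: "ln \<beta> \<le> B"
    using sum_inverse_bounds(1)[OF t(1), of n] unfolding B_def \<beta>_def by simp
  have "B \<le> ln ((t + real n) / t) + 1 / t"
    using sum_inverse_bounds(2)[OF t(1), of n] unfolding B_def by simp
  also have "ln ((t + real n) / t) \<le> ln \<beta>"
    unfolding \<beta>_def using t by (subst ln_le_cancel_iff) (auto simp: field_simps intro!: divide_pos_pos)
  finally have B2: "B \<le> ln \<beta> + 1 / t" by simp
  have sB1: "real s * ln \<beta> \<le> real s * B" using B1 by (intro mult_left_mono) auto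
  have "real s * B \<le> real s * (ln \<beta> + 1 / t)" using B2 by (intro mult_left_mono) auto
  hence sB2: "real s * B \<le> real s * ln \<beta> + real s / t" by (simp add: algebra_simps)
  have "Rlog s n m - ln \<rho> = 2 * (A - ln \<alpha>) - (real s * B - real s * ln \<beta>)"
    unfolding ln\<rho> Rlog_def A_def B_def t_def by simp
  hence *: "\<bar>Rlog s n m - ln \<rho>\<bar> \<le> 2 / (real m + 1) + real s / t"
    using A1 A2 sB1 sB2 t(1) by (auto simp: abs_le_iff)
  \<comment> \<open>\<open>\<alpha> = 1 + x\<close> and \<open>\<beta> \<le> 2\<close> give
    \<open>x^2 \<le> 2 ^ s * \<rho>\<close>, and \<open>2 * x \<le> 1 + x^2\<close> then pays for
    \<open>2 / (m + 1)\<close>.\<close>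
  define x where "x = 5 * real n / (real m + 1)"
  have x: "x > 0" using n by (auto simp: x_def)
  have "x ^ 2 * (1 / 2) ^ s \<le> \<rho>"
    unfolding \<rho> using \<beta> x by (intro mult_mono power_mono) (auto simp: x_def \<alpha>_def divide_right_mono)
  hence "x ^ 2 \<le> 2 ^ s * \<rho>" by (simp add: power_divide field_simps)
  moreover have "2 * x \<le> 1 + x ^ 2" using sum_squares_bound[of x 1] by simp
  moreover have "(1::real) \<le> 2 ^ s" by simp
  ultimately have "2 * x \<le> 2 ^ s * (1 + \<rho>)" unfolding ring_distribs by linarith
  moreover have "2 * x / real n = 10 / (real m + 1)" using n by (simp add: x_def)
  hence "2 / (real m + 1) \<le> 2 * x / real n" by (simp add: divide_right_mono)
  ultimately have "2 / (real m + 1) \<le> 2 ^ s * (1 + \<rho>) / real n"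
    using n by (meson divide_right_mono order.trans of_nat_0_le_iff)
  moreover have "real s / t \<le> real s * (1 + \<rho>) / real n"
  proof -
    have "real s / t \<le> real s / real n" using t n by (intro divide_left_mono) auto
    also have "\<dots> \<le> real s * (1 + \<rho>) / real n"
      using \<rho>0 by (intro divide_right_mono) (auto simp: algebra_simps)
    finally show ?thesis .
  qed
  ultimately have "\<bar>Rlog s n m - ln \<rho>\<bar> \<le> 2 ^ s * (1 + \<rho>) / real n + real s * (1 + \<rho>) / real n"
    using * by linarith
  thus ?thesis unfolding \<rho>_def[symmetric] by (simp add: algebra_simps add_divide_distrib)
qed

text \<open>These are the bounds on \<open>\<sigma>\<close> required by
  \<open>suminf_log_deriv_small\<close>. The quotient is \<open>a m ^ 2 * \<beta> m ^ s\<close>,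
  where \<open>a\<close> stays below \<open>1\<close> and increases in steps of at most
  \<open>1 / (5 * n)\<close>, while \<open>\<beta>\<close> decreases inside
  \<open>[1, 2]\<close>.\<close>

lemma Rterm_sigma:
  assumes "n \<ge> 1"
  shows "Rterm s n m / Rterm s n (Suc m) \<le> 2 ^ s"
    and "Rterm s n 0 / Rterm s n (Suc 0) \<le> 2 ^ s / real n"
    and "Rterm s n (Suc m) / Rterm s n (Suc (Suc m)) - Rterm s n m / Rterm s n (Suc m) \<le> 2 ^ s / real n"
proof -
  have n: "real n \<ge> 1" using assms by simp
  define \<beta> where "\<beta> m = 1 + (real n + 1) / (2 * real n + real m + 1 / 2)" for m
  define a where "a m = (real m + 1) / (real m + 5 * real n + 1)" for m
  have \<sigma>: "Rterm s n m / Rterm s n (Suc m) = a m ^ 2 * \<beta> m ^ s" for m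
    unfolding Rterm_div_Suc a_def \<beta>_def ..
  have \<beta>: "\<beta> m \<ge> 1" "\<beta> m \<le> 2" for m
  proof -
    have "2 * real n + real m + 1 / 2 > 0" by (simp add: add_nonneg_pos)
    thus "\<beta> m \<ge> 1" "\<beta> m \<le> 2" using n by (auto simp: \<beta>_def)
  qed
  have \<beta>s: "\<beta> m ^ s \<le> 2 ^ s" "\<beta> m ^ s > 0" for m
    using \<beta>[of m] by (auto intro!: power_mono)
  have a: "a m \<ge> 0" "a m \<le> 1" for m using n by (auto simp: a_def)
  show "Rterm s n m / Rterm s n (Suc m) \<le> 2 ^ s"
  proof -
    have "a m ^ 2 * \<beta> m ^ s \<le> 1 * 2 ^ s"
      using a[of m] \<beta>s[of m] by (intro mult_mono power_le_one) auto
    thus ?thesis unfolding \<sigma> by simp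
  qed
  show "Rterm s n 0 / Rterm s n (Suc 0) \<le> 2 ^ s / real n"
  proof -
    have "a 0 ^ 2 \<le> a 0" using a[of 0] by (simp add: power2_eq_square mult_left_le)
    also have "\<dots> \<le> 1 / real n" using n by (simp add: a_def field_simps)
    finally have "a 0 ^ 2 * \<beta> 0 ^ s \<le> 1 / real n * 2 ^ s"
      using \<beta>s[of 0] by (intro mult_mono) auto
    thus ?thesis unfolding \<sigma> by simp
  qed
  show "Rterm s n (Suc m) / Rterm s n (Suc (Suc m)) - Rterm s n m / Rterm s n (Suc m) \<le> 2 ^ s / real n"
  proof -
    have "\<beta> (Suc m) \<le> \<beta> m"
      unfolding \<beta>_def by (intro add_left_mono divide_left_mono) (auto intro!: mult_pos_pos add_nonneg_pos)
    hence "\<beta> (Suc m) ^ s \<le> \<beta> m ^ s" using \<beta>[of "Suc m"] by (intro power_mono) auto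
    hence "a m ^ 2 * \<beta> (Suc m) ^ s \<le> a m ^ 2 * \<beta> m ^ s" by (intro mult_left_mono) auto
    hence "a (Suc m) ^ 2 * \<beta> (Suc m) ^ s - a m ^ 2 * \<beta> m ^ s \<le> (a (Suc m) ^ 2 - a m ^ 2) * \<beta> (Suc m) ^ s"
      by (simp add: algebra_simps)
    also have "\<dots> \<le> 1 / real n * 2 ^ s"
    proof (intro mult_mono)
      define x where "x = real m"
      have x: "x \<ge> 0" by (simp add: x_def)
      have ax: "a (Suc m) - a m = 5 * real n / ((x + 5 * real n + 2) * (x + 5 * real n + 1))"
      proof -
        have "(x + 2) / (x + 5 * y + 2) - (x + 1) / (x + 5 * y + 1) = 5 * y / ((x + 5 * y + 2) * (x + 5 * y + 1))"
          if "y > 0" for y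
          using x that by (simp add: divide_simps) (simp add: algebra_simps)
        from this[of "real n"] show ?thesis using n by (simp add: a_def x_def add_ac)
      qed
      have "5 * real n / ((x + 5 * real n + 2) * (x + 5 * real n + 1)) \<le> 5 * real n / (5 * real n * (5 * real n))"
        using x n by (intro divide_left_mono mult_mono mult_pos_pos) auto
      also have "\<dots> = 1 / (5 * real n)" using n by simp
      finally have d: "a (Suc m) - a m \<le> 1 / (5 * real n)" unfolding ax .
      have "a (Suc m) ^ 2 - a m ^ 2 = (a (Suc m) + a m) * (a (Suc m) - a m)"
        by (simp add: power2_eq_square algebra_simps)
      also have "\<dots> \<le> 2 * (1 / (5 * real n))"
        using a[of m] a[of "Suc m"] d n x by (intro mult_mono) (auto simp: ax)
      also have "\<dots> \<le> 1 / real n" using n by (simp add: field_simps)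
      finally show "a (Suc m) ^ 2 - a m ^ 2 \<le> 1 / real n" .
    qed (use \<beta>s[of "Suc m"] in auto)
    finally show ?thesis unfolding \<sigma> by simp
  qed
qed

text \<open>By \<open>block_factor_le\<close>, the five numerator factors with equal
  \<open>i\<close> are bounded through the seventh power of the middle one, so the squared numerator
  is bounded through \<open>A ^ 14\<close>, where \<open>A\<close> is the product of the middle
  block. This cancels \<open>14\<close> of the \<open>s\<close> copies of \<open>A\<close> in the
  denominator. The other \<open>s - 14\<close> use \<open>A \<ge> n! * ((3 * n) choose n)\<close>,
  and four factors \<open>n!\<close> are left to be set against \<open>n ^ n\<close>.\<close>

lemma Rterm_upper:
  assumes n: "n \<ge> 1" and s: "s \<ge> 14"
  shows "Rterm s n m \<le> (3 * real n) ^ 4 * (9 * real n / 4) ^ (s - 14) *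
    (4 ^ 10 * (11 / 200) ^ 2 * (10 / 27) ^ 4 * (4 / 27) ^ (s - 14)) ^ n * (1 / (real m + 1) ^ 2)"
proof -
  define A where "A = (\<Prod>i=1..n. real m + 2 * real n + real i)"
  define t where "t = 2 * real n + real m + 1 / 2"
  have n': "real n \<ge> 1" using n by simp
  have A0: "A > 0" unfolding A_def by (intro prod_pos) (auto intro!: add_nonneg_pos)
  have num: "Rnum n t \<le> (11 / 200) ^ n * A ^ 7 / (real n ^ n) ^ 2"
  proof -
    have "Rnum n t = (\<Prod>i=1..n. \<Prod>b<5. real m + real (b * n + i))"
      unfolding t_def Rnum_half prod_blocks by (rule prod.swap)
    also have "\<dots> \<le> (\<Prod>i=1..n. 11 / 200 * (real m + 2 * real n + real i) ^ 7 / real n ^ 2)"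
    proof (rule prod_mono)
      fix i assume "i \<in> {1..n}"
      define a where "a = real m + 2 * real n + real i"
      have "(\<Prod>b<5. real m + real (b * n + i)) = (a - 2 * real n) * (a - real n) * a * (a + real n) * (a + 2 * real n)"
        by (simp add: eval_nat_numeral lessThan_Suc a_def algebra_simps)
      also have "\<dots> \<le> 11 / 200 * a ^ 7 / real n ^ 2"
        using n' by (intro block_factor_le) (auto simp: a_def)
      finally show "0 \<le> (\<Prod>b<5. real m + real (b * n + i)) \<and> (\<Prod>b<5. real m + real (b * n + i)) \<le> 11 / 200 * (real m + 2 * real n + real i) ^ 7 / real n ^ 2"
        by (auto simp: a_def intro!: prod_nonneg)
    qed
    also have "\<dots> = (11 / 200) ^ n * A ^ 7 / (real n ^ n) ^ 2"
      by (simp add: A_def prod_dividef prod.distrib prod_power_distrib power_divide mult.commute flip: power_mult)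
    finally show ?thesis .
  qed
  \<comment> \<open>The denominator has \<open>n + 1\<close> factors; the additional one is at least
    \<open>m + 1\<close> and makes the bound summable over \<open>m\<close>.\<close>
  have den: "(real m + 1) * A \<le> Rden n t"
  proof -
    have "Rden n t = t * (\<Prod>i=1..n. t + real i)"
      unfolding Rden_def atMost_atLeast0 by (subst prod.atLeast_Suc_atMost) auto
    moreover have "A \<le> (\<Prod>i=1..n. t + real i)"
      unfolding A_def t_def by (intro prod_mono) auto
    ultimately show ?thesis using n' A0 by (auto simp: t_def intro!: mult_mono)
  qed
  have A1: "fact n / A \<le> 9 * real n / 4 * (4 / 27) ^ n"
  proof -
    have "fact (2 * n) * (\<Prod>i=1..n. 2 * real n + real i) = fact (3 * n)"
    proof -
      have "fact k * (\<Prod>i=1..N. real k + real i) = fact (k + N)" for k N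
      proof (induction N)
        case (Suc N)
        have "fact k * (\<Prod>i=1..Suc N. real k + real i) = (fact k * (\<Prod>i=1..N. real k + real i)) * (real k + real N + 1)"
          by (simp add: mult_ac add_ac)
        also have "\<dots> = fact (k + Suc N)" unfolding Suc.IH by (simp add: algebra_simps)
        finally show ?case .
      qed simp
      from this[of "2 * n" n] show ?thesis by simp
    qed
    moreover have "real ((3 * n) choose n) = fact (3 * n) / (fact n * fact (2 * n))"
      by (subst binomial_fact) auto
    ultimately have "fact (2 * n) * (fact n * real ((3 * n) choose n)) = fact (2 * n) * (\<Prod>i=1..n. 2 * real n + real i)"
      by simp
    hence "fact n * real ((3 * n) choose n) = (\<Prod>i=1..n. 2 * real n + real i)"
      by (subst (asm) mult_left_cancel) auto
    also have "\<dots> \<le> A" unfolding A_def by (intro prod_mono) auto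
    finally have "fact n * ((27 / 4) ^ n * 4 / (9 * real n)) \<le> A"
      using mult_left_mono[OF central_trinomial_ge[of n], of "fact n"] n by simp
    moreover have "(27 / 4) ^ n * 4 / (9 * real n) > 0" using n' by simp
    ultimately have "fact n / A \<le> fact n / (fact n * ((27 / 4) ^ n * 4 / (9 * real n)))"
      using A0 by (intro divide_left_mono mult_pos_pos) auto
    also have "\<dots> = 9 * real n / 4 * (4 / 27) ^ n" using n' by (simp add: power_divide mult_ac)
    finally show ?thesis .
  qed
  define y where "y = fact n / A"
  have y0: "y \<ge> 0" using A0 by (simp add: y_def)
  have R0: "Rden n t > 0" by (rule less_le_trans[OF _ den]) (use A0 in auto)
  have N0: "Rnum n t \<ge> 0" using Rnum_pos[of n m] by (simp add: t_def)
  have "Rterm s n m = (4 ^ (5 * n) * Rnum n t / fact n ^ 5) ^ 2 * (fact n / Rden n t) ^ s"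
    by (simp add: Rfun_def t_def)
  also have "\<dots> \<le> (4 ^ (5 * n) * ((11 / 200) ^ n * A ^ 7 / (real n ^ n) ^ 2) / fact n ^ 5) ^ 2 * (fact n / ((real m + 1) * A)) ^ s"
    using num den A0 N0 R0 by (intro mult_mono power_mono divide_right_mono mult_left_mono divide_left_mono) auto
  also have "\<dots> = (4 ^ (5 * n) * (11 / 200) ^ n) ^ 2 * (fact n / real n ^ n) ^ 4 * y ^ (s - 14) * (1 / (real m + 1)) ^ s"
  proof -
    have s': "x ^ s = x ^ 14 * x ^ (s - 14)" for x :: real
      using s by (simp flip: power_add)
    have e: "fact n / ((real m + 1) * A) = y * (1 / (real m + 1))" by (simp add: y_def)
    have "(P * (Q * A ^ 7 / N ^ 2) / F ^ 5) ^ 2 * (F / A) ^ 14 = (P * Q) ^ 2 * (F / N) ^ 4"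
      if "F > 0" "N > 0" for P Q N F :: real
      using that A0 by (simp add: power_divide power_mult_distrib field_simps flip: power_mult power_add)
    from this[of "fact n" "real n ^ n" "4 ^ (5 * n)" "(11 / 200) ^ n"]
    have "(4 ^ (5 * n) * ((11 / 200) ^ n * A ^ 7 / (real n ^ n) ^ 2) / fact n ^ 5) ^ 2 * y ^ 14 = (4 ^ (5 * n) * (11 / 200) ^ n) ^ 2 * (fact n / real n ^ n) ^ 4"
      using n' by (simp add: y_def)
    thus ?thesis unfolding e power_mult_distrib[of y] s'[of y] by (simp only: mult.assoc[symmetric])
  qed
  also have "\<dots> \<le> (4 ^ (5 * n) * (11 / 200) ^ n) ^ 2 * (3 * real n * (10 / 27) ^ n) ^ 4 * (9 * real n / 4 * (4 / 27) ^ n) ^ (s - 14) * (1 / (real m + 1)) ^ 2"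
    using fact_div_power_le[of n] n A1 y0 s unfolding y_def[symmetric]
    by (intro mult_mono power_mono power_decreasing mult_nonneg_nonneg zero_le_power order.refl) auto
  also have "\<dots> = (3 * real n) ^ 4 * (9 * real n / 4) ^ (s - 14) *
    (4 ^ 10 * (11 / 200) ^ 2 * (10 / 27) ^ 4 * (4 / 27) ^ (s - 14)) ^ n * (1 / (real m + 1) ^ 2)"
  proof -
    have sw: "(x ^ n) ^ k = (x ^ k) ^ n" for x :: real and k by (simp add: mult.commute flip: power_mult)
    have "(4::real) ^ (5 * n) = (4 ^ 5) ^ n" by (simp only: power_mult)
    thus ?thesis
      by (simp only: power_mult_distrib sw power_one_over power_mult[symmetric]) (simp add: mult_ac)
  qed
  finally show ?thesis .
qed

lemma summable_Rterm:
  assumes "n \<ge> 1" "s \<ge> 14"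
  shows "summable (Rterm s n)"
    and "suminf (Rterm s n) \<le> (3 * real n) ^ 4 * (9 * real n / 4) ^ (s - 14) *
    (4 ^ 10 * (11 / 200) ^ 2 * (10 / 27) ^ 4 * (4 / 27) ^ (s - 14)) ^ n * (pi ^ 2 / 6)"
proof -
  let ?B = "(3 * real n) ^ 4 * (9 * real n / 4) ^ (s - 14) *
    (4 ^ 10 * (11 / 200) ^ 2 * (10 / 27) ^ 4 * (4 / 27) ^ (s - 14)) ^ n :: real"
  have "(\<lambda>m. 1 / (real m + 1) ^ 2) sums (pi ^ 2 / 6)"
    using inverse_squares_sums by (simp add: add_ac)
  hence B: "(\<lambda>m. ?B * (1 / (real m + 1) ^ 2)) sums (?B * (pi ^ 2 / 6))" by (rule sums_mult)
  show sm: "summable (Rterm s n)"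
  proof (rule summable_comparison_test)
    show "\<exists>N. \<forall>m\<ge>N. norm (Rterm s n m) \<le> ?B * (1 / (real m + 1) ^ 2)"
      using Rterm_upper[OF assms] Rfun_pos[of s n] by (auto simp: less_imp_le)
    show "summable (\<lambda>m. ?B * (1 / (real m + 1) ^ 2))" using B by (rule sums_summable)
  qed
  show "suminf (Rterm s n) \<le> ?B * (pi ^ 2 / 6)"
    using suminf_le[OF Rterm_upper[OF assms] sm sums_summable[OF B]] B by (simp add: sums_iff)
qed

lemma summable_Rterm_deriv:
  assumes "n \<ge> 1" "s \<ge> 14"
  shows "summable (\<lambda>m. Rterm s n m * Rlog s n m)"
proof -
  have n: "real n \<ge> 1" using assms by simp
  show ?thesis
  proof (rule suminf_log_deriv_small(1)[where B = "2 ^ s" and c = "(2 ^ s + real s) / real n" and \<delta> = 1])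
    show "Rterm s n 0 / Rterm s n (Suc 0) \<le> (2 ^ s + real s) / real n"
      by (rule order.trans[OF Rterm_sigma(2)]) (use assms in \<open>auto intro!: divide_right_mono\<close>)
    show "Rterm s n (Suc m) / Rterm s n (Suc (Suc m)) - Rterm s n m / Rterm s n (Suc m) \<le> (2 ^ s + real s) / real n" for m
      by (rule order.trans[OF Rterm_sigma(3)]) (use assms in \<open>auto intro!: divide_right_mono\<close>)
  qed (use assms Rterm_sigma(1)[OF assms(1)] Rlog_bound[OF assms(1)] Rfun_pos summable_Rterm(1)[OF assms] in auto)
qed

lemma suminf_Rterm_deriv_small:
  assumes "s \<ge> 14" "\<epsilon> > 0"
  shows "eventually (\<lambda>n. \<bar>\<Sum>m. Rterm s n m * Rlog s n m\<bar> \<le> \<epsilon> * suminf (Rterm s n)) sequentially"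
proof -
  define \<delta> where "\<delta> = \<epsilon> / 2"
  have \<delta>: "\<delta> > 0" using assms by (simp add: \<delta>_def)
  define c where "c n = (2 ^ s + real s) / real n" for n
  have "(\<lambda>n. \<delta> + c n / \<delta> + 2 * c n) \<longlonglongrightarrow> \<delta> + 0 / \<delta> + 2 * 0"
    unfolding c_def by (intro tendsto_intros lim_const_over_n) (use \<delta> in auto)
  hence "eventually (\<lambda>n. \<delta> + c n / \<delta> + 2 * c n < \<epsilon>) sequentially"
    by (rule order_tendstoD) (use assms in \<open>simp add: \<delta>_def\<close>)
  with eventually_ge_at_top[of 1] show ?thesis
  proof eventually_elim
    case (elim n)
    have "\<bar>\<Sum>m. Rterm s n m * Rlog s n m\<bar> \<le> (\<delta> + c n / \<delta> + 2 * c n) * suminf (Rterm s n)"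
    proof (rule suminf_log_deriv_small(2)[where B = "2 ^ s"])
      show "Rterm s n 0 / Rterm s n (Suc 0) \<le> c n"
        unfolding c_def by (rule order.trans[OF Rterm_sigma(2)]) (use elim in \<open>auto intro!: divide_right_mono\<close>)
      show "Rterm s n (Suc m) / Rterm s n (Suc (Suc m)) - Rterm s n m / Rterm s n (Suc m) \<le> c n" for m
        unfolding c_def by (rule order.trans[OF Rterm_sigma(3)]) (use elim in \<open>auto intro!: divide_right_mono\<close>)
    qed (use elim \<delta> Rterm_sigma(1)[OF elim(1)] Rlog_bound[OF elim(1)] Rfun_pos summable_Rterm(1)[OF elim(1) assms(1)] in \<open>auto simp: c_def\<close>)
    also have "\<dots> \<le> \<epsilon> * suminf (Rterm s n)"
      using elim(2) suminf_nonneg[OF summable_Rterm(1)[OF elim(1) assms(1)]] Rfun_pos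
      by (intro mult_right_mono) (auto simp: less_imp_le)
    finally show ?case .
  qed
qed

subsection \<open>Linear forms in zeta values\<close>

text \<open>Telescoping. The function lives on the integers because shifts to the left reach
  negative arguments.\<close>

lemma sums_shift_diff:
  fixes f :: "int \<Rightarrow> real"
  assumes "(\<lambda>l. f (int l)) \<longlonglongrightarrow> 0"
  shows "(\<lambda>l. f (int l + int e) - f (int l)) sums (- (\<Sum>i<e. f (int i)))"
    and "(\<lambda>l. f (int l - int e) - f (int l)) sums (\<Sum>i<e. f (- 1 - int i))"
proof -
  have lim: "(\<lambda>l. f (int l + c)) \<longlonglongrightarrow> 0" for c
  proof -
    have nat: "filterlim (\<lambda>l. nat (int l + c)) at_top sequentially"
      unfolding filterlim_at_top
    proof
      fix Z
      show "eventually (\<lambda>l. Z \<le> nat (int l + c)) sequentially"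
        by (rule eventually_sequentiallyI[of "Z + nat (- c)"]) auto
    qed
    have "(\<lambda>l. f (int (nat (int l + c)))) \<longlonglongrightarrow> 0"
      by (rule filterlim_compose[OF assms nat])
    moreover have "eventually (\<lambda>l. f (int (nat (int l + c))) = f (int l + c)) sequentially"
      using eventually_ge_at_top[of "nat (- c)"] by eventually_elim auto
    ultimately show ?thesis by (simp add: tendsto_cong)
  qed
  have tel: "(\<lambda>l. f (int l + c + 1) - f (int l + c)) sums (- f c)" for c
    using telescope_sums[OF lim[of c]] by (simp add: add_ac)
  show "(\<lambda>l. f (int l + int e) - f (int l)) sums (- (\<Sum>i<e. f (int i)))"
  proof (induction e)
    case (Suc e)
    from sums_add[OF Suc.IH tel[of "int e"]] show ?case by (simp add: algebra_simps)
  qed simp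
  show "(\<lambda>l. f (int l - int e) - f (int l)) sums (\<Sum>i<e. f (- 1 - int i))"
  proof (induction e)
    case (Suc e)
    from sums_diff[OF Suc.IH tel[of "- 1 - int e"]] show ?case by (simp add: algebra_simps)
  qed simp
qed

definition half_harm :: "nat \<Rightarrow> nat \<Rightarrow> real" where
  "half_harm k e = (\<Sum>i<e. 1 / (real i + 1 / 2) ^ k)"

text \<open>The shift by the integer \<open>j - N\<close> changes \<open>\<Sum>l. 1 / (l + 1/2)^k\<close> by this rational number.\<close>
definition tail_corr :: "nat \<Rightarrow> nat \<Rightarrow> nat \<Rightarrow> real" where
  "tail_corr N k j = (if N \<le> j then - half_harm k (j - N) else (-1) ^ k * half_harm k (N - j))"

lemma tail_corr_sums:
  assumes "k \<ge> 1"
  shows "(\<lambda>l. 1 / (real l + 1 / 2 - real N + real j) ^ k - 1 / (real l + 1 / 2) ^ k) sums tail_corr N k j"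
proof -
  define f :: "int \<Rightarrow> real" where "f x = 1 / (of_int x + 1 / 2) ^ k" for x
  have "(\<lambda>l. inverse (real l + 1 / 2) ^ k) \<longlonglongrightarrow> 0 ^ k"
    by (intro tendsto_power tendsto_inverse_0_at_top filterlim_at_top_mono[OF filterlim_real_sequentially]) auto
  hence lim: "(\<lambda>l. f (int l)) \<longlonglongrightarrow> 0"
    using assms by (simp add: f_def power_one_over inverse_eq_divide zero_power)
  show ?thesis
  proof (cases "N \<le> j")
    case True
    from sums_shift_diff(1)[OF lim, of "j - N"] True show ?thesis
      by (simp add: f_def tail_corr_def half_harm_def of_nat_diff algebra_simps)
  next
    case False
    have "f (- 1 - int i) = (-1) ^ k * (1 / (real i + 1 / 2) ^ k)" for i
    proof -
      have "real_of_int (- 1 - int i) + 1 / 2 = (-1) * (real i + 1 / 2)" by simp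
      hence "(real_of_int (- 1 - int i) + 1 / 2) ^ k = (-1) ^ k * (real i + 1 / 2) ^ k" by (simp only: power_mult_distrib)
      moreover have "1 / ((-1) ^ k * y) = (-1) ^ k * (1 / y)" for y :: real by (cases "even k") auto
      ultimately show ?thesis by (simp only: f_def)
    qed
    hence "(\<Sum>i<N-j. f (- 1 - int i)) = tail_corr N k j"
      using False by (simp add: tail_corr_def half_harm_def sum_distrib_left)
    moreover have "f (int l - int (N - j)) - f (int l) = 1 / (real l + 1 / 2 - real N + real j) ^ k - 1 / (real l + 1 / 2) ^ k" for l
      using False by (simp add: f_def of_nat_diff algebra_simps)
    ultimately show ?thesis using sums_shift_diff(2)[OF lim, of "N - j"] by simp
  qed
qed

text \<open>The half-integers are symmetric about \<open>0\<close>, so shifts by opposite integers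
  collect the same terms up to sign. This is what makes \<open>q\<close> or \<open>q'\<close> vanish
  later.\<close>

lemma tail_corr_reflect:
  assumes "j \<le> 2 * N"
  shows "tail_corr N k (2 * N - j) = - ((-1) ^ k) * tail_corr N k j"
proof (cases j N rule: linorder_cases)
  case less
  have "2 * N - j - N = N - j" "N \<le> 2 * N - j" using less by simp_all
  moreover have "(-1) ^ k * ((-1) ^ k * x) = x" for x :: real by (simp flip: mult.assoc power_mult_distrib)
  ultimately show ?thesis using less by (simp add: tail_corr_def)
next
  case equal
  thus ?thesis by (simp add: tail_corr_def half_harm_def)
next
  case greater
  have "N - (2 * N - j) = j - N" using greater assms by simp
  thus ?thesis using greater assms by (simp add: tail_corr_def)
qed

text \<open>The shift \<open>j - N\<close> is at most \<open>N\<close> in absolute value, so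
  \<open>1 / (i + 1/2) = 2 / (2 * i + 1)\<close> occurs only with
  \<open>2 * i + 1 < 2 * N\<close>.\<close>

lemma tail_corr_Ints:
  assumes "j \<le> 2 * N"
  shows "real (lcm_upto (2 * N)) ^ k * tail_corr N k j \<in> \<int>"
proof -
  have H: "real (lcm_upto (2 * N)) ^ k * half_harm k e \<in> \<int>" if "e \<le> N" for e
  proof -
    have "real (lcm_upto (2 * N)) ^ k * half_harm k e = (\<Sum>i<e. (2 * (real (lcm_upto (2 * N)) / real (2 * i + 1))) ^ k)"
      unfolding half_harm_def sum_distrib_left
    proof (rule sum.cong[OF refl])
      fix i
      have "2 * (real (lcm_upto (2 * N)) / real (2 * i + 1)) = real (lcm_upto (2 * N)) * (1 / (real i + 1 / 2))"
        by (simp add: field_simps)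
      thus "real (lcm_upto (2 * N)) ^ k * (1 / (real i + 1 / 2) ^ k) = (2 * (real (lcm_upto (2 * N)) / real (2 * i + 1))) ^ k"
        by (simp only: power_mult_distrib power_one_over)
    qed
    also have "\<dots> \<in> \<int>"
    proof (intro Ints_sum Ints_power Ints_mult)
      fix i assume "i \<in> {..<e}"
      hence "(2 * i + 1) dvd lcm_upto (2 * N)" using that by (intro dvd_lcm_upto) auto
      thus "real (lcm_upto (2 * N)) / real (2 * i + 1) \<in> \<int>"
        by (metis Ints_of_nat real_of_nat_div)
    qed auto
    finally show ?thesis .
  qed
  show ?thesis
  proof (cases "N \<le> j")
    case True
    thus ?thesis using H[of "j - N"] assms by (simp add: tail_corr_def Ints_minus)
  next
    case False
    have "(-1) ^ k * (real (lcm_upto (2 * N)) ^ k * half_harm k (N - j)) \<in> \<int>"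
      by (intro Ints_mult Ints_power H) auto
    thus ?thesis using False by (simp add: tail_corr_def mult_ac)
  qed
qed

text \<open>The poles of order \<open>1\<close> may contribute a divergent harmonic series.
  Subtracting \<open>\<rho> 1 / (l + 1/2)\<close> gives a convergent statement before
  \<open>\<rho> 1 = 0\<close> is known.\<close>

lemma pf_sums:
  fixes b :: "nat \<Rightarrow> nat \<Rightarrow> real" and n K N :: nat
  defines "\<rho> \<equiv> \<lambda>k. \<Sum>j\<le>n. b k j"
  assumes "K \<ge> 1"
  shows "(\<lambda>l. (\<Sum>k=1..K. \<Sum>j\<le>n. b k j / (real l + 1 / 2 - real N + real j) ^ k) - \<rho> 1 / (real l + 1 / 2)) sums
     ((\<Sum>k=2..K. \<rho> k * ((2 ^ k - 1) * zeta (real k))) + (\<Sum>k=1..K. \<Sum>j\<le>n. b k j * tail_corr N k j))"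
proof -
  have "(\<lambda>l. (\<Sum>k=2..K. \<rho> k * (1 / (real l + 1 / 2) ^ k)) +
      (\<Sum>k=1..K. \<Sum>j\<le>n. b k j * (1 / (real l + 1 / 2 - real N + real j) ^ k - 1 / (real l + 1 / 2) ^ k))) sums
     ((\<Sum>k=2..K. \<rho> k * ((2 ^ k - 1) * zeta (real k))) + (\<Sum>k=1..K. \<Sum>j\<le>n. b k j * tail_corr N k j))"
    by (intro sums_add sums_sum sums_mult zeta_half_sums tail_corr_sums) auto
  also have "(\<lambda>l. (\<Sum>k=2..K. \<rho> k * (1 / (real l + 1 / 2) ^ k)) +
      (\<Sum>k=1..K. \<Sum>j\<le>n. b k j * (1 / (real l + 1 / 2 - real N + real j) ^ k - 1 / (real l + 1 / 2) ^ k))) =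
      (\<lambda>l. (\<Sum>k=1..K. \<Sum>j\<le>n. b k j / (real l + 1 / 2 - real N + real j) ^ k) - \<rho> 1 / (real l + 1 / 2))"
  proof
    fix l
    define x where "x = 1 / (real l + 1 / 2)"
    have "(\<Sum>k=1..K. \<Sum>j\<le>n. b k j * (1 / (real l + 1 / 2) ^ k)) = (\<Sum>k=1..K. \<rho> k * (1 / (real l + 1 / 2) ^ k))"
      by (simp add: \<rho>_def sum_distrib_right sum_divide_distrib)
    also have "\<dots> = \<rho> 1 * (1 / (real l + 1 / 2)) + (\<Sum>k=2..K. \<rho> k * (1 / (real l + 1 / 2) ^ k))"
      using assms(2) by (subst sum.atLeast_Suc_atMost) (auto simp: numeral_2_eq_2)
    finally show "(\<Sum>k=2..K. \<rho> k * (1 / (real l + 1 / 2) ^ k)) +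
      (\<Sum>k=1..K. \<Sum>j\<le>n. b k j * (1 / (real l + 1 / 2 - real N + real j) ^ k - 1 / (real l + 1 / 2) ^ k)) =
      (\<Sum>k=1..K. \<Sum>j\<le>n. b k j / (real l + 1 / 2 - real N + real j) ^ k) - \<rho> 1 / (real l + 1 / 2)"
      by (simp add: right_diff_distrib sum_subtractf)
  qed
  finally show ?thesis .
qed

lemma sum_antisym_zero:
  fixes f :: "nat \<Rightarrow> real"
  assumes "\<And>j. j \<le> n \<Longrightarrow> f (n - j) = - f j"
  shows "(\<Sum>j\<le>n. f j) = 0"
proof -
  have "(\<Sum>j\<le>n. f j) = (\<Sum>j\<le>n. f (n - j))"
    by (rule sum.reindex_bij_witness[of _ "\<lambda>j. n - j" "\<lambda>j. n - j"]) auto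
  also have "\<dots> = - (\<Sum>j\<le>n. f j)" using assms by (simp add: sum_negf)
  finally show ?thesis by simp
qed

lemma DERIV_divide_power:
  fixes a c x :: real
  assumes "x + c \<noteq> 0" "k \<ge> 1"
  shows "((\<lambda>t. a / (t + c) ^ k) has_real_derivative - real k * a / (x + c) ^ Suc k) (at x)"
proof -
  obtain k' where k: "k = Suc k'" using assms(2) by (cases k) auto
  have "((\<lambda>t. t + c) has_real_derivative 1) (at x)"
    by (auto intro!: derivative_eq_intros)
  from DERIV_power[OF this, of k]
  have "((\<lambda>t. (t + c) ^ k) has_real_derivative real k * (x + c) ^ k') (at x)"
    by (simp add: k)
  hence "((\<lambda>t. a / (t + c) ^ k) has_real_derivative (0 * (x + c) ^ k - a * (real k * (x + c) ^ k')) / ((x + c) ^ k * (x + c) ^ k)) (at x)"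
    using assms by (intro DERIV_divide DERIV_const) auto
  also have "(0 * (x + c) ^ k - a * (real k * (x + c) ^ k')) / ((x + c) ^ k * (x + c) ^ k) = - real k * a / (x + c) ^ Suc k"
    using assms unfolding k by (simp add: divide_simps) (simp add: algebra_simps)
  finally show ?thesis .
qed

lemma half_harmonic_not_summable:
  assumes "summable (\<lambda>l. c / (real l + 1 / 2))"
  shows "c = 0"
proof (rule ccontr)
  assume c: "c \<noteq> 0"
  have "summable (\<lambda>l. 1 / c * (c / (real l + 1 / 2)))" using assms by (rule summable_mult)
  hence "summable (\<lambda>l. 1 / (real l + 1 / 2))" using c by simp
  hence "summable (\<lambda>l. inverse (real (Suc l)))"
    by (rule summable_comparison_test[rotated]) (auto simp: field_simps)
  thus False using not_summable_harmonic[where ?'a = real] summable_Suc_iff[of "\<lambda>l. inverse (real l)"] by simp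
qed

context
  fixes n N s :: nat
  assumes N: "n = 2 * N" "N \<ge> 1" and s: "s \<ge> 14"
begin

text \<open>The half-integers beyond the centre \<open>- n / 2 = - N\<close>. The first
  \<open>5 * N\<close> of them are zeros of \<open>Rnum n\<close>, and \<open>tp (5 * N)\<close> is
  the first point beyond \<open>2 * n\<close>.\<close>

private abbreviation "tp l \<equiv> real l + 1 / 2 - real N"

private lemma tp_nz: "\<forall>j\<le>n. tp l + real j \<noteq> 0"
proof (intro allI impI notI)
  fix j assume "tp l + real j = 0"
  hence "real (2 * l + 1 + 2 * j) = real (2 * N)" by (simp add: field_simps)
  hence "2 * l + 1 + 2 * j = 2 * N" by (simp only: of_nat_eq_iff)
  thus False by presburger
qed

private lemma tp_Rden: "Rden n (tp l) \<noteq> 0"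
  using tp_nz unfolding Rden_def by auto

private lemma tp_shift: "tp (m + 5 * N) = 2 * real n + real m + 1 / 2"
  using N by simp

lemma sums_from_5N:
  fixes f g :: "nat \<Rightarrow> real"
  assumes "\<And>l. l < 5 * N \<Longrightarrow> f l = 0" "\<And>m. f (m + 5 * N) = g m" "summable g"
  shows "f sums suminf g"
proof -
  have "(\<lambda>m. f (m + 5 * N)) sums suminf g" unfolding assms(2) using assms(3) by (rule summable_sums)
  hence "f sums (suminf g + (\<Sum>l<5*N. f l))" by (simp add: sums_iff_shift)
  thus ?thesis using assms(1) by simp
qed

lemma Rfun_sums: "(\<lambda>l. Rfun s n (tp l)) sums suminf (Rterm s n)"
proof (rule sums_from_5N)
  fix l assume "l < 5 * N"
  thus "Rfun s n (tp l) = 0"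
    using N tp_Rden by (intro Rfun_zero(1)[of "5 * N - l"]) (auto simp: of_nat_diff)
next
  fix m show "Rfun s n (tp (m + 5 * N)) = Rterm s n m" by (simp only: tp_shift)
next
  show "summable (Rterm s n)" by (rule summable_Rterm(1)) (use N s in auto)
qed

lemma deriv_Rfun_sums:
  assumes "\<And>l. (Rfun s n has_real_derivative F l) (at (tp l))"
  shows "F sums (\<Sum>m. Rterm s n m * Rlog s n m)"
proof (rule sums_from_5N)
  fix l assume "l < 5 * N"
  hence "(Rfun s n has_real_derivative 0) (at (tp l))"
    using N tp_Rden by (intro Rfun_zero(2)[of "5 * N - l"]) (auto simp: of_nat_diff)
  thus "F l = 0" using assms DERIV_unique by blast
next
  fix m
  have "(Rfun s n has_real_derivative Rterm s n m * Rlog s n m) (at (tp (m + 5 * N)))"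
    unfolding tp_shift using s by (intro DERIV_Rfun) simp
  thus "F (m + 5 * N) = Rterm s n m * Rlog s n m" using assms DERIV_unique by blast
next
  show "summable (\<lambda>m. Rterm s n m * Rlog s n m)" by (rule summable_Rterm_deriv) (use N s in auto)
qed

text \<open>Under \<open>j -> n - j\<close> the coefficient \<open>a k j\<close> acquires the sign
  \<open>(-1)^(s + k)\<close> and \<open>tail_corr N k j\<close> the sign \<open>- (-1)^k\<close>,
  so the terms of \<open>q\<close> cancel for even \<open>s\<close>. In \<open>q'\<close> the order
  of the poles is one higher: its terms cancel for odd \<open>s\<close>, and one more lcm factor is
  needed. The factors \<open>2\<close> stem from \<open>pf_form_symmetrize\<close>.\<close>

lemma linear_forms:
  obtains \<rho> q q' where
    "\<And>k. k \<in> {1..s} \<Longrightarrow> 2 * real (lcm_upto n) ^ s * \<rho> k \<in> \<int>"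
    "2 * real (lcm_upto n) ^ s * q \<in> \<int>" "2 * real (lcm_upto n) ^ Suc s * q' \<in> \<int>"
    "\<And>k. odd (s + k) \<Longrightarrow> \<rho> k = 0" "\<rho> 1 = 0"
    "even s \<Longrightarrow> q = 0" "odd s \<Longrightarrow> q' = 0"
    "suminf (Rterm s n) = (\<Sum>k=2..s. \<rho> k * ((2 ^ k - 1) * zeta (real k))) + q"
    "(\<Sum>m. Rterm s n m * Rlog s n m) = - (\<Sum>k=1..s. real k * \<rho> k * ((2 ^ Suc k - 1) * zeta (real (Suc k)))) - q'"
proof -
  have ev: "even n" using N by simp
  obtain a where a:
    "\<And>k j. k \<in> {1..s} \<Longrightarrow> j \<le> n \<Longrightarrow> 2 * real (lcm_upto n) ^ (s - k) * a k j \<in> \<int>"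
    "\<And>k j. j \<le> n \<Longrightarrow> a k (n - j) = (-1) ^ (s + k) * a k j"
    "\<And>t. (\<forall>j\<le>n. t + real j \<noteq> 0) \<Longrightarrow> Rfun s n t = (\<Sum>k=1..s. \<Sum>j\<le>n. a k j / (t + real j) ^ k)"
    by (rule pf_form_symmetrize[OF pf_form_Rfun[of s n] Rfun_reflect[OF ev, of s]]) (use s in auto)
  define \<rho> where "\<rho> k = (\<Sum>j\<le>n. a k j)" for k
  define q where "q = (\<Sum>k=1..s. \<Sum>j\<le>n. a k j * tail_corr N k j)"
  define q' where "q' = (\<Sum>k=1..s. \<Sum>j\<le>n. real k * a k j * tail_corr N (Suc k) j)"
  define d where "d = real (lcm_upto n)"
  have s1: "s \<ge> 1" using s by simp
  have aZ: "2 * d ^ (s - k) * a k j \<in> \<int>" if "k \<in> {1..s}" "j \<in> {..n}" for k j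
    using a(1)[of k j] that by (simp add: d_def)
  have dZ: "d \<in> \<int>" by (simp add: d_def)
  have dk: "d ^ s = d ^ (s - k) * d ^ k" "d ^ Suc s = d ^ (s - k) * d ^ Suc k" if "k \<in> {1..s}" for k
    using that by (simp_all flip: power_add)
  have tc: "d ^ k * tail_corr N k j \<in> \<int>" if "j \<in> {..n}" for k j
    using tail_corr_Ints[of j N k] that N by (simp add: d_def)
  have \<rho>Z: "2 * d ^ s * \<rho> k \<in> \<int>" if k: "k \<in> {1..s}" for k
  proof -
    have "2 * d ^ s * \<rho> k = (\<Sum>j\<le>n. (2 * d ^ (s - k) * a k j) * d ^ k)"
      unfolding dk(1)[OF k] \<rho>_def sum_distrib_left by (simp add: mult_ac)
    also have "\<dots> \<in> \<int>"
      by (intro Ints_sum Ints_mult[OF aZ[OF k]] Ints_power dZ) auto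
    finally show ?thesis .
  qed
  have qZ: "2 * d ^ s * q \<in> \<int>"
  proof -
    have "2 * d ^ s * q = (\<Sum>k=1..s. \<Sum>j\<le>n. (2 * d ^ (s - k) * a k j) * (d ^ k * tail_corr N k j))"
      unfolding q_def sum_distrib_left by (intro sum.cong refl) (simp add: dk(1) mult_ac)
    also have "\<dots> \<in> \<int>" by (intro Ints_sum Ints_mult[OF aZ tc]) auto
    finally show ?thesis .
  qed
  have q'Z: "2 * d ^ Suc s * q' \<in> \<int>"
  proof -
    have "2 * d ^ Suc s * q' = (\<Sum>k=1..s. \<Sum>j\<le>n. real k * ((2 * d ^ (s - k) * a k j) * (d ^ Suc k * tail_corr N (Suc k) j)))"
      unfolding q'_def sum_distrib_left
    proof (intro sum.cong refl)
      fix k j assume "k \<in> {1..s}"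
      note dk(2)[OF this]
      thus "2 * d ^ Suc s * (real k * a k j * tail_corr N (Suc k) j) = real k * ((2 * d ^ (s - k) * a k j) * (d ^ Suc k * tail_corr N (Suc k) j))"
        by (simp only: mult_ac)
    qed
    also have "\<dots> \<in> \<int>"
      by (intro Ints_sum Ints_mult[OF Ints_of_nat Ints_mult[OF aZ tc]]) auto
    finally show ?thesis .
  qed
  have \<rho>0: "\<rho> k = 0" if "odd (s + k)" for k
    unfolding \<rho>_def by (rule sum_antisym_zero) (use a(2) that in simp)
  have sgn: "(-1) ^ k * ((-1) ^ k * x) = x" for x :: real and k
    by (simp flip: mult.assoc power_mult_distrib)
  have q0: "q = 0" if "even s"
  proof -
    have "(\<Sum>j\<le>n. a k j * tail_corr N k j) = 0" for k
    proof (rule sum_antisym_zero)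
      fix j assume j: "j \<le> n"
      show "a k (n - j) * tail_corr N k (n - j) = - (a k j * tail_corr N k j)"
        using a(2)[OF j, of k] tail_corr_reflect[of j N k] N j that sgn[of k] by (simp add: power_add mult_ac)
    qed
    thus ?thesis by (simp add: q_def)
  qed
  have q'0: "q' = 0" if "odd s"
  proof -
    have "(\<Sum>j\<le>n. real k * a k j * tail_corr N (Suc k) j) = 0" for k
    proof (rule sum_antisym_zero)
      fix j assume j: "j \<le> n"
      show "real k * a k (n - j) * tail_corr N (Suc k) (n - j) = - (real k * a k j * tail_corr N (Suc k) j)"
        using a(2)[OF j, of k] tail_corr_reflect[of j N "Suc k"] N j that sgn[of k] by (simp add: power_add mult_ac)
    qed
    thus ?thesis by (simp add: q'_def)
  qed
  have U1: "(\<lambda>l. Rfun s n (tp l) - \<rho> 1 / (real l + 1 / 2)) sums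
     ((\<Sum>k=2..s. \<rho> k * ((2 ^ k - 1) * zeta (real k))) + q)"
    using pf_sums[OF s1, where b = a and n = n and N = N] a(3)[OF tp_nz] by (simp add: \<rho>_def q_def)
  \<comment> \<open>For odd \<open>s\<close> parity says nothing about \<open>\<rho> 1\<close>;
    convergence of the sum of \<open>Rfun\<close> excludes a harmonic part.\<close>
  have \<rho>1: "\<rho> 1 = 0"
  proof -
    have "summable (\<lambda>l. Rfun s n (tp l) - (Rfun s n (tp l) - \<rho> 1 / (real l + 1 / 2)))"
      by (rule summable_diff[OF sums_summable[OF Rfun_sums] sums_summable[OF U1]])
    thus ?thesis by (intro half_harmonic_not_summable) simp
  qed
  have U: "suminf (Rterm s n) = (\<Sum>k=2..s. \<rho> k * ((2 ^ k - 1) * zeta (real k))) + q"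
    using U1 Rfun_sums unfolding \<rho>1 by (simp add: sums_unique2)
  \<comment> \<open>The partial fraction coefficients of the derivative: every pole moves up by one
    order, so \<open>b 1\<close> vanishes.\<close>
  define b where "b k j = (if k = 0 then 0 else - real (k - 1) * a (k - 1) j)" for k j
  define F where "F l = (\<Sum>k=1..Suc s. \<Sum>j\<le>n. b k j / (tp l + real j) ^ k)" for l
  have shift: "(\<Sum>k=1..Suc s. g k) = g 1 + (\<Sum>k=1..s. g (Suc k))" for g :: "nat \<Rightarrow> real"
    using sum.atLeast_Suc_atMost[of 1 "Suc s" g] sum.shift_bounds_cl_Suc_ivl[of g 1 s]
    by (simp del: sum.cl_ivl_Suc)
  have "(Rfun s n has_real_derivative F l) (at (tp l))" for l
  proof -
    have "((\<lambda>t. \<Sum>k=1..s. \<Sum>j\<le>n. a k j / (t + real j) ^ k) has_real_derivative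
       (\<Sum>k=1..s. \<Sum>j\<le>n. - real k * a k j / (tp l + real j) ^ Suc k)) (at (tp l))"
    proof (intro DERIV_sum)
      fix k j assume k: "k \<in> {1..s}" and j: "j \<in> {..n}"
      show "((\<lambda>t. a k j / (t + real j) ^ k) has_real_derivative - real k * a k j / (tp l + real j) ^ Suc k) (at (tp l))"
        using tp_nz j k by (intro DERIV_divide_power) auto
    qed
    also have "(\<Sum>k=1..s. \<Sum>j\<le>n. - real k * a k j / (tp l + real j) ^ Suc k) = F l"
      unfolding F_def shift by (simp add: b_def)
    finally have D: "((\<lambda>t. \<Sum>k=1..s. \<Sum>j\<le>n. a k j / (t + real j) ^ k) has_real_derivative F l) (at (tp l))" .
    \<comment> \<open>The expansion holds off the poles only; as this set is open, the derivative
      carries over to \<open>Rfun\<close>.\<close>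
    define S where "S = (\<Inter>j\<le>n. - {- real j})"
    have S: "t \<in> S \<longleftrightarrow> (\<forall>j\<le>n. t + real j \<noteq> 0)" for t
      unfolding S_def by (auto simp: add_eq_0_iff2)
    have "open S" unfolding S_def by (intro open_INT) auto
    moreover have "tp l \<in> S" using tp_nz S by blast
    ultimately show ?thesis
      by (rule has_field_derivative_transform_within_open[OF D]) (use S a(3) in auto)
  qed
  hence "F sums (\<Sum>m. Rterm s n m * Rlog s n m)" by (rule deriv_Rfun_sums)
  moreover have "F sums ((\<Sum>k=2..Suc s. (\<Sum>j\<le>n. b k j) * ((2 ^ k - 1) * zeta (real k))) + (\<Sum>k=1..Suc s. \<Sum>j\<le>n. b k j * tail_corr N k j))"
  proof -
    have "(\<Sum>j\<le>n. b 1 j) = 0" by (simp add: b_def)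
    thus ?thesis
      using pf_sums[where b = b and n = n and K = "Suc s" and N = N]
      by (simp add: F_def[abs_def] del: sum.cl_ivl_Suc power_Suc of_nat_Suc)
  qed
  ultimately have "(\<Sum>m. Rterm s n m * Rlog s n m) = (\<Sum>k=2..Suc s. (\<Sum>j\<le>n. b k j) * ((2 ^ k - 1) * zeta (real k))) + (\<Sum>k=1..Suc s. \<Sum>j\<le>n. b k j * tail_corr N k j)"
    by (rule sums_unique2)
  also have "(\<Sum>k=1..Suc s. \<Sum>j\<le>n. b k j * tail_corr N k j) = - q'"
    unfolding shift q'_def by (simp add: b_def sum_negf)
  also have "(\<Sum>k=2..Suc s. (\<Sum>j\<le>n. b k j) * ((2 ^ k - 1) * zeta (real k))) = (\<Sum>k=1..s. (\<Sum>j\<le>n. b (Suc k) j) * ((2 ^ Suc k - 1) * zeta (real (Suc k))))"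
    by (rule sum.reindex_bij_witness[of _ Suc "\<lambda>k. k - 1"]) auto
  also have "\<dots> = - (\<Sum>k=1..s. real k * \<rho> k * ((2 ^ Suc k - 1) * zeta (real (Suc k))))"
    by (simp add: b_def \<rho>_def sum_negf sum_distrib_left[symmetric] del: power_Suc of_nat_Suc)
  finally have V: "(\<Sum>m. Rterm s n m * Rlog s n m) = - (\<Sum>k=1..s. real k * \<rho> k * ((2 ^ Suc k - 1) * zeta (real (Suc k)))) - q'"
    by simp
  show thesis
    by (rule that[of \<rho> q q']) (use \<rho>Z qZ q'Z \<rho>0 \<rho>1 q0 q'0 U V in \<open>auto simp: d_def simp del: power_Suc\<close>)
qed

end

subsection \<open>Irrationality\<close>

lemma tendsto_power_times_power:
  fixes x :: real
  assumes "0 < x" "x < 1"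
  shows "(\<lambda>n. real n ^ k * x ^ n) \<longlonglongrightarrow> 0"
proof (cases "k = 0")
  case True
  thus ?thesis using assms by (simp add: LIMSEQ_power_zero)
next
  case False
  define y where "y = root k x"
  have y: "0 < y" "y < 1" "y ^ k = x" using assms False by (auto simp: y_def)
  have "(\<lambda>n. (real n * y ^ n) ^ k) \<longlonglongrightarrow> 0 ^ k"
    using y by (intro tendsto_power powser_times_n_limit_0) auto
  also have "(\<lambda>n. (real n * y ^ n) ^ k) = (\<lambda>n. real n ^ k * x ^ n)"
    unfolding y(3)[symmetric] power_mult_distrib by (simp add: mult.commute flip: power_mult)
  finally show ?thesis using False by (simp add: zero_power)
qed

text \<open>For large \<open>n\<close>, \<open>\<bar>\<beta> * V n\<bar>\<close> is at most half of
  \<open>\<bar>\<alpha>\<bar> * U n\<close>, so the form is nonzero and at most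
  \<open>2 * \<bar>\<alpha>\<bar> * U n\<close>. By \<open>small\<close>, the decay of
  \<open>U\<close> beats the growth of the lcm power, and one large even \<open>n\<close> yields a
  nonzero integer of absolute value below \<open>1\<close>.\<close>

lemma integral_forms_contradiction:
  fixes \<alpha> \<beta> M :: real and s e :: nat
  assumes s: "s \<ge> 14" and M: "M > 0" and \<alpha>: "\<alpha> \<noteq> 0"
    and small: "(607 / 200) ^ e * (4 ^ 10 * (11 / 200) ^ 2 * (10 / 27) ^ 4 * (4 / 27) ^ (s - 14)) < (1::real)"
    and int: "\<And>n. even n \<Longrightarrow> n \<ge> 2 \<Longrightarrow> M * real (lcm_upto n) ^ e *
        (\<alpha> * suminf (Rterm s n) + \<beta> * (\<Sum>m. Rterm s n m * Rlog s n m)) \<in> \<int>"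
  shows False
proof -
  define \<eta> :: real where "\<eta> = 4 ^ 10 * (11 / 200) ^ 2 * (10 / 27) ^ 4 * (4 / 27) ^ (s - 14)"
  define \<theta> where "\<theta> = (607 / 200) ^ e * \<eta>"
  have \<eta>: "\<eta> > 0" by (simp add: \<eta>_def)
  have \<theta>: "0 < \<theta>" "\<theta> < 1" using \<eta> small by (auto simp: \<theta>_def \<eta>_def)
  obtain A :: real where A: "A > 0" "\<And>n. real (lcm_upto n) \<le> A * (607 / 200) ^ n"
    using lcm_upto_le by blast
  define U where "U n = suminf (Rterm s n)" for n
  define V where "V n = (\<Sum>m. Rterm s n m * Rlog s n m)" for n
  \<comment> \<open>The summand \<open>1\<close> keeps the denominator positive for
    \<open>\<beta> = 0\<close>.\<close>
  define \<epsilon> where "\<epsilon> = \<bar>\<alpha>\<bar> / (2 * (\<bar>\<beta>\<bar> + 1))"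
  have \<epsilon>: "\<epsilon> > 0" using \<alpha> by (simp add: \<epsilon>_def)
  have \<beta>\<epsilon>: "\<bar>\<beta>\<bar> * \<epsilon> \<le> \<bar>\<alpha>\<bar> / 2"
  proof -
    have "\<bar>\<beta>\<bar> * \<epsilon> \<le> (\<bar>\<beta>\<bar> + 1) * \<epsilon>" using \<epsilon> by simp
    also have "\<dots> = \<bar>\<alpha>\<bar> / 2" by (simp add: \<epsilon>_def field_simps)
    finally show ?thesis .
  qed
  define C where "C = M * A ^ e * (2 * \<bar>\<alpha>\<bar>) * (3 ^ 4 * (9 / 4) ^ (s - 14) * (pi ^ 2 / 6))"
  have "(\<lambda>n. C * (real n ^ (4 + (s - 14)) * \<theta> ^ n)) \<longlonglongrightarrow> C * 0"
    by (intro tendsto_mult tendsto_const tendsto_power_times_power \<theta>)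
  hence "eventually (\<lambda>n. C * (real n ^ (4 + (s - 14)) * \<theta> ^ n) < 1) sequentially"
    by (rule order_tendstoD) simp
  moreover have "eventually (\<lambda>n. \<bar>V n\<bar> \<le> \<epsilon> * U n) sequentially"
    unfolding U_def V_def by (rule suminf_Rterm_deriv_small[OF s \<epsilon>])
  ultimately have "eventually (\<lambda>n. C * (real n ^ (4 + (s - 14)) * \<theta> ^ n) < 1 \<and> \<bar>V n\<bar> \<le> \<epsilon> * U n) sequentially"
    by (rule eventually_conj)
  then obtain n0 where n0: "\<And>n. n \<ge> n0 \<Longrightarrow> C * (real n ^ (4 + (s - 14)) * \<theta> ^ n) < 1 \<and> \<bar>V n\<bar> \<le> \<epsilon> * U n"
    by (auto simp: eventually_sequentially)
  define n where "n = 2 * (n0 + 1)"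
  have n: "even n" "n \<ge> 2" "n \<ge> 1" "n \<ge> n0" by (auto simp: n_def)
  have sm: "C * (real n ^ (4 + (s - 14)) * \<theta> ^ n) < 1" and VU: "\<bar>V n\<bar> \<le> \<epsilon> * U n" using n0[OF n(4)] by auto
  have U0: "U n > 0" unfolding U_def using summable_Rterm(1)[OF n(3) s] Rfun_pos by (rule suminf_pos)
  have \<beta>V: "\<bar>\<beta> * V n\<bar> \<le> \<bar>\<alpha>\<bar> / 2 * U n"
  proof -
    have "\<bar>\<beta> * V n\<bar> \<le> \<bar>\<beta>\<bar> * (\<epsilon> * U n)" unfolding abs_mult using VU by (intro mult_left_mono) auto
    also have "\<dots> \<le> \<bar>\<alpha>\<bar> / 2 * U n" using \<beta>\<epsilon> U0 mult_right_mono[of "\<bar>\<beta>\<bar> * \<epsilon>" "\<bar>\<alpha>\<bar> / 2" "U n"] by (simp add: mult.assoc)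
    finally show ?thesis .
  qed
  have \<alpha>U: "\<bar>\<alpha> * U n\<bar> = \<bar>\<alpha>\<bar> * U n" using U0 by (simp add: abs_mult)
  have \<alpha>U0: "\<bar>\<alpha>\<bar> * U n > 0" using \<alpha> U0 by simp
  define L where "L = \<alpha> * U n + \<beta> * V n"
  have L: "L \<noteq> 0" "\<bar>L\<bar> \<le> 2 * \<bar>\<alpha>\<bar> * U n"
    using \<beta>V \<alpha>U \<alpha>U0 unfolding L_def by (auto simp: abs_if split: if_splits)
  have d0: "real (lcm_upto n) > 0" using lcm_upto_pos[of n] by simp
  have "M * real (lcm_upto n) ^ e * L \<in> \<int>" unfolding L_def U_def V_def by (rule int[OF n(1,2)])
  moreover have "M * real (lcm_upto n) ^ e * L \<noteq> 0" using M d0 L by simp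
  ultimately have "1 \<le> \<bar>M * real (lcm_upto n) ^ e * L\<bar>" by (rule Ints_nonzero_abs_ge1)
  also have "\<dots> = M * real (lcm_upto n) ^ e * \<bar>L\<bar>" using M by (simp add: abs_mult)
  also have "\<dots> \<le> M * (A * (607 / 200) ^ n) ^ e * (2 * \<bar>\<alpha>\<bar> * ((3 * real n) ^ 4 * (9 * real n / 4) ^ (s - 14) * \<eta> ^ n * (pi ^ 2 / 6)))"
  proof (intro mult_mono power_mono A order.refl)
    have "2 * \<bar>\<alpha>\<bar> * U n \<le> 2 * \<bar>\<alpha>\<bar> * ((3 * real n) ^ 4 * (9 * real n / 4) ^ (s - 14) * \<eta> ^ n * (pi ^ 2 / 6))"
      unfolding U_def \<eta>_def using summable_Rterm(2)[OF n(3) s] by (intro mult_left_mono) auto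
    thus "\<bar>L\<bar> \<le> 2 * \<bar>\<alpha>\<bar> * ((3 * real n) ^ 4 * (9 * real n / 4) ^ (s - 14) * \<eta> ^ n * (pi ^ 2 / 6))"
      using L(2) by linarith
  qed (use M A(1) in auto)
  also have "\<dots> = C * (real n ^ (4 + (s - 14)) * \<theta> ^ n)"
  proof -
    have "(9 * real n / 4) ^ (s - 14) = (9 / 4) ^ (s - 14) * real n ^ (s - 14)"
      by (simp flip: power_mult_distrib)
    moreover have "(A * (607 / 200) ^ n) ^ e = A ^ e * ((607 / 200) ^ e) ^ n"
      unfolding power_mult_distrib by (simp add: mult.commute flip: power_mult)
    ultimately show ?thesis
      unfolding C_def \<theta>_def power_add power_mult_distrib[of "3::real"] power_mult_distrib[of "(607 / 200) ^ e" \<eta>] by (simp only: mult_ac)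
  qed
  finally show False using sm by simp
qed

section \<open>The two collections\<close>

lemma common_denominator:
  fixes y :: "'a \<Rightarrow> real"
  assumes "finite A" "\<And>k. k \<in> A \<Longrightarrow> y k \<in> \<rat>"
  obtains M :: nat where "M > 0" "\<And>k. k \<in> A \<Longrightarrow> real M * y k \<in> \<int>"
proof -
  have "\<exists>M::nat. M > 0 \<and> (\<forall>k\<in>A. real M * y k \<in> \<int>)"
    using assms
  proof (induction A rule: finite_induct)
    case (insert x A)
    then obtain M :: nat where M: "M > 0" "\<And>k. k \<in> A \<Longrightarrow> real M * y k \<in> \<int>" by auto
    from insert.prems[of x] obtain a b where ab: "b > 0" "y x = of_int a / of_int b"
      by (auto elim: Rats_cases')
    have "real (M * nat b) * y k \<in> \<int>" if "k \<in> insert x A" for k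
    proof (cases "k = x")
      case True
      have "real (nat b) * y x = of_int a" using ab by (simp add: of_nat_nat)
      hence "real (M * nat b) * y x = real M * of_int a" by (simp add: mult.assoc)
      also have "\<dots> \<in> \<int>" by (intro Ints_mult) auto
      finally show ?thesis using True by simp
    next
      case False
      hence "real (nat b) * (real M * y k) \<in> \<int>" using that by (intro Ints_mult M) auto
      thus ?thesis by (simp add: mult_ac)
    qed
    thus ?case using M ab by (intro exI[of _ "M * nat b"]) auto
  qed (auto intro: exI[of _ 1])
  thus ?thesis using that by blast
qed

definition S_half :: "nat \<Rightarrow> real" where "S_half k = (2 ^ k - 1) * zeta (real k)"

text \<open>For \<open>s = 39\<close>, parity and \<open>\<rho> 1 = 0\<close> leave
  \<open>k = 3, 5, ..., 39\<close>, that is \<open>k = 2 * m + 1\<close> for \<open>m\<close> up to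
  \<open>19\<close>. Since \<open>q' = 0\<close>, the lcm exponent is \<open>s\<close>
  itself.\<close>

lemma not_all_rational_odd:
  fixes c :: real
  assumes "\<And>m. m \<in> {1..19} \<Longrightarrow> S_half (2 * m + 1) - c * real (2 * m + 1) * S_half (2 * m + 2) \<in> \<rat>"
  shows False
proof -
  define y where "y k = S_half k - c * real k * S_half (Suc k)" for k
  have "y k \<in> \<rat>" if "k \<in> {k\<in>{2..39}. odd k}" for k
  proof -
    from that obtain m where m: "k = 2 * m + 1" by (auto elim: oddE)
    thus ?thesis using assms[of m] that by (auto simp: y_def)
  qed
  then obtain M :: nat where M: "M > 0" "\<And>k. k \<in> {k\<in>{2..39}. odd k} \<Longrightarrow> real M * y k \<in> \<int>"
    using common_denominator[of "{k\<in>{2..39}. odd k}" y] by auto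
  show False
  proof (rule integral_forms_contradiction[where s = 39 and e = 39 and \<alpha> = 1 and \<beta> = c and M = "real M * 2"])
    show "(607 / 200) ^ 39 * (4 ^ 10 * (11 / 200) ^ 2 * (10 / 27) ^ 4 * (4 / 27) ^ (39 - 14)) < (1::real)"
      by (simp add: power_divide)
    fix n :: nat assume n: "even n" "n \<ge> 2"
    define N where "N = n div 2"
    have N: "n = 2 * N" "N \<ge> 1" using n by (auto simp: N_def)
    define D where "D = 2 * real (lcm_upto n) ^ 39"
    obtain \<rho> q q' where lf:
      "\<And>k. k \<in> {1..39} \<Longrightarrow> D * \<rho> k \<in> \<int>" "D * q \<in> \<int>"
      "\<And>k. odd (39 + k) \<Longrightarrow> \<rho> k = 0" "\<rho> 1 = 0" "q' = 0"
      "suminf (Rterm 39 n) = (\<Sum>k=2..39. \<rho> k * S_half k) + q"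
      "(\<Sum>m. Rterm 39 n m * Rlog 39 n m) = - (\<Sum>k=1..39. real k * \<rho> k * S_half (Suc k)) - q'"
      unfolding D_def S_half_def by (rule linear_forms[OF N, of 39]) auto
    have "(\<Sum>k=1..39. real k * \<rho> k * S_half (Suc k)) = real 1 * \<rho> 1 * S_half (Suc 1) + (\<Sum>k=Suc 1..39. real k * \<rho> k * S_half (Suc k))"
      by (rule sum.atLeast_Suc_atMost) simp
    hence V: "(\<Sum>m. Rterm 39 n m * Rlog 39 n m) = - (\<Sum>k=2..39. real k * \<rho> k * S_half (Suc k))"
      unfolding lf(4,5,7) by (simp add: numeral_2_eq_2)
    have "1 * suminf (Rterm 39 n) + c * (\<Sum>m. Rterm 39 n m * Rlog 39 n m) = (\<Sum>k=2..39. \<rho> k * y k) + q"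
      unfolding V lf(6) y_def by (simp add: sum_distrib_left sum_subtractf algebra_simps del: sum.cl_ivl_Suc)
    hence "real M * 2 * real (lcm_upto n) ^ 39 * (1 * suminf (Rterm 39 n) + c * (\<Sum>m. Rterm 39 n m * Rlog 39 n m))
      = (\<Sum>k=2..39. (D * \<rho> k) * (real M * y k)) + real M * (D * q)"
      unfolding D_def by (simp add: sum_distrib_left algebra_simps del: sum.cl_ivl_Suc)
    also have "\<dots> \<in> \<int>"
    proof (intro Ints_add Ints_sum)
      fix k :: nat assume k: "k \<in> {2..39}"
      show "(D * \<rho> k) * (real M * y k) \<in> \<int>"
      proof (cases "odd k")
        case True
        thus ?thesis using k by (intro Ints_mult lf M) auto
      next
        case False
        hence "\<rho> k = 0" by (intro lf) auto
        thus ?thesis by simp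
      qed
    qed (intro Ints_mult lf Ints_of_nat)
    finally show "real M * 2 * real (lcm_upto n) ^ 39 * (1 * suminf (Rterm 39 n) + c * (\<Sum>m. Rterm 39 n m * Rlog 39 n m)) \<in> \<int>" .
  qed (use M in auto)
qed

text \<open>For \<open>s = 40\<close>, parity leaves \<open>k = 2, 4, ..., 40\<close>. Now
  \<open>q = 0\<close> while \<open>q'\<close> stays, which raises the lcm exponent to
  \<open>41\<close>. \<open>U\<close> enters with the coefficient \<open>c\<close>, which must not
  vanish if \<open>U\<close> is to dominate.\<close>

lemma not_all_rational_even:
  fixes c :: real
  assumes "c \<noteq> 0" "\<And>m. m \<in> {1..20} \<Longrightarrow> real (2 * m) * S_half (2 * m + 1) - c * S_half (2 * m) \<in> \<rat>"
  shows False
proof -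
  define y where "y k = real k * S_half (Suc k) - c * S_half k" for k
  have "y k \<in> \<rat>" if "k \<in> {k\<in>{2..40}. even k}" for k
  proof -
    from that obtain m where m: "k = 2 * m" by (auto elim: evenE)
    thus ?thesis using assms(2)[of m] that by (auto simp: y_def)
  qed
  then obtain M :: nat where M: "M > 0" "\<And>k. k \<in> {k\<in>{2..40}. even k} \<Longrightarrow> real M * y k \<in> \<int>"
    using common_denominator[of "{k\<in>{2..40}. even k}" y] by auto
  show False
  proof (rule integral_forms_contradiction[where s = 40 and e = 41 and \<alpha> = c and \<beta> = 1 and M = "real M * 2"])
    show "(607 / 200) ^ 41 * (4 ^ 10 * (11 / 200) ^ 2 * (10 / 27) ^ 4 * (4 / 27) ^ (40 - 14)) < (1::real)"
      by (simp add: power_divide)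
    fix n :: nat assume n: "even n" "n \<ge> 2"
    define N where "N = n div 2"
    have N: "n = 2 * N" "N \<ge> 1" using n by (auto simp: N_def)
    define d where "d = real (lcm_upto n)"
    define e where "e = d ^ 40"
    define D where "D = 2 * (d * e)"
    define X where "X = suminf (Rterm 40 n)"
    define Y where "Y = (\<Sum>m. Rterm 40 n m * Rlog 40 n m)"
    obtain \<rho> q q' where lf:
      "\<And>k. k \<in> {1..40} \<Longrightarrow> 2 * e * \<rho> k \<in> \<int>" "D * q' \<in> \<int>"
      "\<And>k. odd (40 + k) \<Longrightarrow> \<rho> k = 0" "\<rho> 1 = 0" "q = 0"
      "X = (\<Sum>k=2..40. \<rho> k * S_half k) + q"
      "Y = - (\<Sum>k=1..40. real k * \<rho> k * S_half (Suc k)) - q'"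
      unfolding d_def D_def S_half_def e_def X_def Y_def power_Suc[symmetric] by (rule linear_forms[OF N, of 40]) auto
    have "(\<Sum>k=1..40. real k * \<rho> k * S_half (Suc k)) = real 1 * \<rho> 1 * S_half (Suc 1) + (\<Sum>k=Suc 1..40. real k * \<rho> k * S_half (Suc k))"
      by (rule sum.atLeast_Suc_atMost) simp
    hence V: "Y = - (\<Sum>k=2..40. real k * \<rho> k * S_half (Suc k)) - q'"
      unfolding lf(4,7) by (simp add: numeral_2_eq_2)
    have "c * X + 1 * Y = - (\<Sum>k=2..40. \<rho> k * y k) - q'"
      unfolding V lf(5,6) y_def by (simp add: sum_distrib_left sum_subtractf algebra_simps del: sum.cl_ivl_Suc)
    hence "real M * D * (c * X + 1 * Y) = real M * D * (- (\<Sum>k=2..40. \<rho> k * y k) - q')"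
      by (rule arg_cong)
    also have "\<dots> = - (\<Sum>k=2..40. d * ((2 * e * \<rho> k) * (real M * y k))) - real M * (D * q')"
      unfolding D_def by (simp add: right_diff_distrib sum_distrib_left mult_ac del: sum.cl_ivl_Suc)
    also have "\<dots> \<in> \<int>"
    proof (intro Ints_diff Ints_minus Ints_sum)
      fix k :: nat assume k: "k \<in> {2..40}"
      have d: "d \<in> \<int>" by (simp add: d_def)
      show "d * ((2 * e * \<rho> k) * (real M * y k)) \<in> \<int>"
      proof (cases "even k")
        case True
        thus ?thesis using k by (intro Ints_mult[OF d] Ints_mult[OF lf(1)] M) auto
      next
        case False
        hence "\<rho> k = 0" by (intro lf) auto
        thus ?thesis by simp
      qed
    qed (intro Ints_mult lf Ints_of_nat)
    finally have "real M * D * (c * X + 1 * Y) \<in> \<int>" .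
    moreover have "real M * D = real M * 2 * real (lcm_upto n) ^ 41"
      unfolding D_def e_def d_def power_Suc[symmetric] by simp
    ultimately show "real M * 2 * real (lcm_upto n) ^ 41 * (c * suminf (Rterm 40 n) + 1 * (\<Sum>m. Rterm 40 n m * Rlog 40 n m)) \<in> \<int>"
      by (simp only: X_def Y_def)
  qed (use M assms(1) in auto)
qed

text \<open>Euler's formula for \<open>2 * m + 2\<close> contains one \<open>pi\<close> more than
  the member, whence \<open>lam / pi\<close>. This coefficient does not depend on \<open>m\<close>,
  so a single combination of \<open>U\<close> and \<open>V\<close> serves all members at
  once.\<close>

lemma first_collection_term:
  assumes "m \<ge> 1"
  shows "(2 ^ (2 * m + 1) - 1) * (zeta (real (2 * m + 1)) -
            lam * ((2 ^ (2 * m) * (2 ^ (2 * m + 2) - 1) * \<bar>Bernoulli (2 * m + 2)\<bar>) /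
                 ((2 ^ (2 * m + 1) - 1) * (real m + 1) * fact (2 * m))) * pi ^ (2 * m + 1)) =
    S_half (2 * m + 1) - lam / pi * real (2 * m + 1) * S_half (2 * m + 2)"
proof -
  have "(2::real) ^ (2 * m + 1) > 1" by (rule one_less_power) auto
  hence P: "(2::real) ^ (2 * m + 1) - 1 \<noteq> 0" by simp
  have e: "2 * (m + 1) = 2 * m + 2" by simp
  have f: "fact (2 * m + 2) = 2 * (real m + 1) * real (2 * m + 1) * (fact (2 * m) :: real)"
    by (simp add: algebra_simps)
  have p: "4 * 2 ^ (2 * m) = (2::real) ^ (2 * m + 2)" "pi ^ (2 * m + 1) * pi = pi ^ (2 * m + 2)" by simp_all
  have S: "S_half (2 * m + 2) = 4 * 2 ^ (2 * m) * (2 ^ (2 * m + 2) - 1) * \<bar>Bernoulli (2 * m + 2)\<bar> *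
      (pi ^ (2 * m + 1) * pi) / (2 * (2 * (real m + 1) * real (2 * m + 1) * fact (2 * m)))"
    using zeta_even_Bernoulli[of "m + 1"] unfolding e p f[symmetric] S_half_def by simp
  have alg: "P * (z - l * (T * Q * B / (P * u * F)) * p) =
      P * z - l / pi * v * (4 * T * Q * B * (p * pi) / (2 * (2 * u * v * F)))"
    if "P \<noteq> 0" "F > 0" "u > 0" "v > 0" for P z l T Q B u v F p :: real
    using that by (simp add: field_simps)
  show ?thesis
    unfolding S S_half_def[of "2 * m + 1"] by (rule alg[OF P]) auto
qed

text \<open>Euler's formula for \<open>2 * m\<close> leaves one \<open>pi\<close> over, whence
  \<open>4 * lam * pi\<close>, again the same for every \<open>m\<close>.\<close>

lemma second_collection_term:
  assumes "m \<ge> 1"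
  shows "real (2 * m) * ((2 ^ (2 * m + 1) - 1) * (zeta (real (2 * m + 1)) -
            lam * ((2 ^ (2 * m) * (2 ^ (2 * m) - 1) * \<bar>Bernoulli (2 * m)\<bar>) /
                 ((2 ^ (2 * m + 1) - 1) * real m * fact (2 * m))) * pi ^ (2 * m + 1))) =
    real (2 * m) * S_half (2 * m + 1) - 4 * lam * pi * S_half (2 * m)"
proof -
  have "(2::real) ^ (2 * m + 1) > 1" by (rule one_less_power) auto
  hence P: "(2::real) ^ (2 * m + 1) - 1 \<noteq> 0" by simp
  have S: "S_half (2 * m) = 2 ^ (2 * m) * (2 ^ (2 * m) - 1) * \<bar>Bernoulli (2 * m)\<bar> * pi ^ (2 * m) / (2 * fact (2 * m))"
    using zeta_even_Bernoulli[of m] assms by (simp add: S_half_def)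
  have alg: "2 * x * (P * (z - l * (T * Q * B / (P * x * F)) * (p * pi))) =
      2 * x * (P * z) - 4 * l * pi * (T * Q * B * p / (2 * F))"
    if "P \<noteq> 0" "F > 0" "x > 0" for P z l T Q B x F p :: real
    using that by (simp add: field_simps)
  show ?thesis
    unfolding S using assms alg[OF P, of "fact (2 * m)" "real m" "zeta (real (2 * m + 1))" lam "2 ^ (2 * m)" "2 ^ (2 * m) - 1" "\<bar>Bernoulli (2 * m)\<bar>" "pi ^ (2 * m)"]
    by (simp add: S_half_def mult_ac)
qed

theorem theorem1:
  fixes lam :: real
  shows "(\<exists>x \<in> {zeta (real (2 * m + 1)) -
            lam * ((2 ^ (2 * m) * (2 ^ (2 * m + 2) - 1) * \<bar>Bernoulli (2 * m + 2)\<bar>) /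
                 ((2 ^ (2 * m + 1) - 1) * (real m + 1) * fact (2 * m))) * pi ^ (2 * m + 1)
            | m :: nat. m \<in> {1..19}}. x \<notin> \<rat>) \<and>
         (\<exists>x \<in> {zeta (real (2 * m + 1)) -
            lam * ((2 ^ (2 * m) * (2 ^ (2 * m) - 1) * \<bar>Bernoulli (2 * m)\<bar>) /
                 ((2 ^ (2 * m + 1) - 1) * real m * fact (2 * m))) * pi ^ (2 * m + 1)
            | m :: nat. m \<in> {1..21}}. x \<notin> \<rat>)"
proof -
  define f where "f l m = zeta (real (2 * m + 1)) -
            l * ((2 ^ (2 * m) * (2 ^ (2 * m + 2) - 1) * \<bar>Bernoulli (2 * m + 2)\<bar>) /
                 ((2 ^ (2 * m + 1) - 1) * (real m + 1) * fact (2 * m))) * pi ^ (2 * m + 1)" for l m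
  define g where "g m = zeta (real (2 * m + 1)) -
            lam * ((2 ^ (2 * m) * (2 ^ (2 * m) - 1) * \<bar>Bernoulli (2 * m)\<bar>) /
                 ((2 ^ (2 * m + 1) - 1) * real m * fact (2 * m))) * pi ^ (2 * m + 1)" for m
  have pow: "(2 ^ (2 * m + 1) - 1 :: real) \<in> \<rat>" for m :: nat
    by (intro Rats_diff Rats_power) auto
  have 1: "\<exists>m\<in>{1..19}. f l m \<notin> \<rat>" for l
  proof (rule ccontr)
    assume "\<not> (\<exists>m\<in>{1..19}. f l m \<notin> \<rat>)"
    hence rat: "f l m \<in> \<rat>" if "m \<in> {1..19}" for m using that by blast
    show False
    proof (rule not_all_rational_odd[of "l / pi"])
      fix m :: nat assume m: "m \<in> {1..19}"
      hence "(2 ^ (2 * m + 1) - 1) * f l m \<in> \<rat>" by (intro Rats_mult pow rat)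
      thus "S_half (2 * m + 1) - l / pi * real (2 * m + 1) * S_half (2 * m + 2) \<in> \<rat>"
        using m unfolding f_def by (subst (asm) first_collection_term) auto
    qed
  qed
  have 2: "\<exists>m\<in>{1..21}. g m \<notin> \<rat>"
  proof (cases "lam = 0")
    case True
    obtain m where "m \<in> {1..19}" "f 0 m \<notin> \<rat>" using 1[of 0] by blast
    thus ?thesis using True by (intro bexI[of _ m]) (auto simp: f_def g_def)
  next
    case False
    show ?thesis
    proof (rule ccontr)
      assume "\<not> (\<exists>m\<in>{1..21}. g m \<notin> \<rat>)"
      hence rat: "g m \<in> \<rat>" if "m \<in> {1..21}" for m using that by blast
      show False
      proof (rule not_all_rational_even[of "4 * lam * pi"])
        fix m :: nat assume m: "m \<in> {1..20}"
        hence "real (2 * m) * ((2 ^ (2 * m + 1) - 1) * g m) \<in> \<rat>"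
          by (intro Rats_mult pow rat Rats_of_nat) auto
        thus "real (2 * m) * S_half (2 * m + 1) - 4 * lam * pi * S_half (2 * m) \<in> \<rat>"
          using m unfolding g_def by (subst (asm) second_collection_term) auto
      qed (use False in auto)
    qed
  qed
  show ?thesis using 1[of lam] 2 unfolding f_def g_def by blast
qed


end
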